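(* A graph is planar, $4$-connected and $K_{2,5}$-minor-free if and only if it is (isomorphic to) the square $C_n^2$ of a cycle $C_n$ of even length $n \ge 6$.
   Context: All graphs are finite and simple. A graph $H$ is a minor of a graph $G$ if $H$ can be obtained from a subgraph of $G$ by contracting edges and deleting any resulting loops and parallel edges; $G$ is $H$-minor-free if $H$ is not a minor of $G$. $K_{2,5}$ is the complete bipartite graph with parts of sizes $2$ and $5$. The square $G^2$ of a graph $G$ is the graph on the same vertex set as $G$ in which two (distinct) vertices are adjacent exactly when they are at distance at most two in $G$. $C_n$ denotes the cycle with $n$ vertices. *)

theory Defs
  imports "HOL-Analysis.Analysis" "Graph_Theory.Graph_Theory"
begin

text \<open>
  A finite simple graph is a \<^locale>\<open>pair_graph\<close>: finitely many vertices and a symmetric,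
  irreflexive set of arcs, an edge being a pair of opposite arcs.
\<close>

definition edges :: "'a pair_pre_digraph \<Rightarrow> 'a set set" where
  "edges G = {{u, v} |u v. (u, v) \<in> parcs G}"

text \<open>
  Drawings use one curve per undirected edge. The relative interior of a curve, i.e. the curve
  without the images of the two ends of its edge, must avoid all vertices and all other edges.
\<close>

definition plane_drawing ::
    "'a pair_pre_digraph \<Rightarrow> ('a \<Rightarrow> complex) \<Rightarrow> ('a set \<Rightarrow> real \<Rightarrow> complex) \<Rightarrow> bool" where
  "plane_drawing G p \<gamma> \<longleftrightarrow>
     inj_on p (pverts G) \<and>
     (\<forall>e\<in>edges G. arc (\<gamma> e) \<and> {pathstart (\<gamma> e), pathfinish (\<gamma> e)} = p ` e) \<and>
     (\<forall>e\<in>edges G. (path_image (\<gamma> e) - p ` e) \<inter> p ` pverts G = {}) \<and>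
     (\<forall>e\<in>edges G. \<forall>f\<in>edges G. e \<noteq> f \<longrightarrow> (path_image (\<gamma> e) - p ` e) \<inter> path_image (\<gamma> f) = {})"

definition planar :: "'a pair_pre_digraph \<Rightarrow> bool" where
  "planar G \<longleftrightarrow> (\<exists>p \<gamma>. plane_drawing G p \<gamma>)"

text \<open>The qualified name excludes the topological \<open>connected\<close>. Since \<open>k < card (pverts G)\<close>,
  the vertex set \<open>pverts G - X\<close> is never empty.\<close>

definition k_connected :: "nat \<Rightarrow> 'a pair_pre_digraph \<Rightarrow> bool" where
  "k_connected k G \<longleftrightarrow>
     k < card (pverts G) \<and>
     (\<forall>X \<subseteq> pverts G. card X < k \<longrightarrow>
        Digraph_Component.connected (induce_subgraph (with_proj G) (pverts G - X)))"

text \<open>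
  Contracting \<open>uv\<close> identifies \<open>v\<close> with \<open>u\<close>. Parallel edges merge because the arcs form a set,
  and loops are removed by the condition \<open>x \<noteq> y\<close>.
\<close>

definition contract_edge :: "'a pair_pre_digraph \<Rightarrow> 'a \<Rightarrow> 'a \<Rightarrow> 'a pair_pre_digraph" where
  "contract_edge G u v =
     \<lparr>pverts = pverts G - {v},
      parcs = {(x, y). x \<noteq> y \<and> (\<exists>(a, b)\<in>parcs G. x = (id(v := u)) a \<and> y = (id(v := u)) b)}\<rparr>"

inductive contracts_to :: "'a pair_pre_digraph \<Rightarrow> 'a pair_pre_digraph \<Rightarrow> bool" where
  refl: "contracts_to G G"
| step: "contracts_to G K \<Longrightarrow> (u, v) \<in> parcs K \<Longrightarrow> contracts_to G (contract_edge K u v)"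

text \<open>
  A \<^const>\<open>subgraph\<close> in the directed sense may contain just one of two opposite arcs; requiring
  \<^locale>\<open>pair_graph\<close> as well gives exactly the undirected subgraphs.
\<close>

definition minor_of :: "'b pair_pre_digraph \<Rightarrow> 'a pair_pre_digraph \<Rightarrow> bool" where
  "minor_of H G \<longleftrightarrow>
     (\<exists>S K. pair_graph S \<and> subgraph (with_proj S) (with_proj G) \<and> contracts_to S K \<and>
            digraph_iso (with_proj K) (with_proj H))"

definition minor_free :: "'b pair_pre_digraph \<Rightarrow> 'a pair_pre_digraph \<Rightarrow> bool" where
  "minor_free H G \<longleftrightarrow> \<not> minor_of H G"

definition complete_bipartite_graph :: "nat \<Rightarrow> nat \<Rightarrow> nat pair_pre_digraph" where
  "complete_bipartite_graph m n =
     \<lparr>pverts = {..<m + n},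
      parcs = {..<m} \<times> {m..<m + n} \<union> {m..<m + n} \<times> {..<m}\<rparr>"

lemma complete_bipartite_graph: "K\<^bsub>m,n\<^esub> (with_proj (complete_bipartite_graph m n))"
proof -
  have "{..<m + n} = {..<m} \<union> {m..<m + n}" "{..<m} \<inter> {m..<m + n} = {}"
    "card {..<m} = m" "card {m..<m + n} = n"
    by auto
  then show ?thesis
    unfolding complete_bipartite_digraph_pair_def complete_bipartite_graph_def
    by (metis finite_lessThan pair_pre_digraph.select_convs)
qed

text \<open>The cycle on \<open>n\<close> vertices for \<open>n \<ge> 3\<close>; a loop or a single edge for \<open>n = 1, 2\<close>.\<close>

definition cycle_graph :: "nat \<Rightarrow> nat pair_pre_digraph" where
  "cycle_graph n =
     \<lparr>pverts = {..<n},
      parcs = {(i, j). i < n \<and> j < n \<and> (j = Suc i mod n \<or> i = Suc j mod n)}\<rparr>"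

text \<open>\<^const>\<open>wf_digraph.\<mu>\<close> with unit weights is the distance in the graph
  (\<open>\<infinity>\<close> if there is no walk).\<close>

definition graph_square :: "'a pair_pre_digraph \<Rightarrow> 'a pair_pre_digraph" where
  "graph_square G =
     \<lparr>pverts = pverts G,
      parcs = {(u, v). u \<in> pverts G \<and> v \<in> pverts G \<and> u \<noteq> v \<and>
                       wf_digraph.\<mu> (with_proj G) (\<lambda>_. 1) u v \<le> 2}\<rparr>"

lemma pair_graph_contract_edge:
  assumes "pair_graph G" "(u, v) \<in> parcs G"
  shows "pair_graph (contract_edge G u v)"
proof -
  interpret pair_graph G by fact
  have uv: "u \<in> pverts G" "u \<noteq> v"
    using assms(2) arc_fst_in_verts pair_no_loops by force+
  have fin: "finite (pverts G - {v})" using pair_finite_verts by simp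
  have sub: "parcs (contract_edge G u v) \<subseteq> (pverts G - {v}) \<times> (pverts G - {v})"
    using uv by (auto simp: contract_edge_def split: if_splits dest: in_arcsD1 in_arcsD2)
  have "finite (parcs (contract_edge G u v))"
    by (rule finite_subset[OF sub]) (use fin in simp)
  moreover have "sym (parcs (contract_edge G u v))"
    using arcs_ends_symmetric[OF pair_sym_arcs]
    by (fastforce simp: contract_edge_def sym_def)
  moreover have "finite (pverts (contract_edge G u v))"
    using fin by (simp add: contract_edge_def)
  moreover have "parcs (contract_edge G u v) \<subseteq>
      pverts (contract_edge G u v) \<times> pverts (contract_edge G u v)"
    using sub by (simp add: contract_edge_def)
  moreover have "fst e \<noteq> snd e" if "e \<in> parcs (contract_edge G u v)" for e
    using that by (auto simp: contract_edge_def)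
  ultimately show ?thesis
    by unfold_locales (auto simp: symmetric_def)
qed

end

theory Submission
  imports Defs
begin

text \<open>
  Forward direction: planarity is used only through the absence of \<open>K\<^bsub>3,3\<^esub>\<close> minors (and of \<open>K\<^bsub>5\<^esub>\<close>
  when there are five vertices). For a component \<open>A\<close> of \<open>G - N[v]\<close>, a further component would yield
  \<open>K\<^bsub>3,3\<^esub>\<close>, so \<open>v\<close> and \<open>A\<close> are hubs with common leaves \<open>N(v)\<close>, and excluding \<open>K\<^bsub>2,5\<^esub>\<close>
  makes the graph 4-regular. A connected
  set with six outside neighbours, each having a single neighbour in the set, leads to \<open>K\<^bsub>2,5\<^esub>\<close> or
  \<open>K\<^bsub>3,3\<^esub>\<close>. Hence every edge lies in a triangle and no neighbourhood is the union of two disjoint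
  edges, so every neighbourhood contains a spanning path. Such a path extends to a cyclic sequence
  in which \<open>v\<^sub>i\<close> is adjacent to the vertices at cyclic distance 1 and 2, and odd length yields
  \<open>K\<^bsub>3,3\<^esub>\<close>. The nonplanarity of \<open>K\<^bsub>3,3\<^esub>\<close> and \<open>K\<^bsub>5\<^esub>\<close> comes from a theta curve: a connected set disjoint
  from it does not accumulate at the interiors of all three arcs.

  Backward direction: the even square is an antiprism. If it had a \<open>K\<^bsub>2,5\<^esub>\<close> minor, each of the five
  leaves could be charged to one of the four positions next to the two ends of a hub.
\<close>

section \<open>Connected sets and models of bipartite minors\<close>

text \<open>Since planarity enters only through forbidden minors, neither faces nor Euler's formula
  are needed, and the topology reduces to the Jordan curve theorem for a theta curve. The constants
  come from a count: K25-freeness bounds the common neighbourhood of two disjoint connected sets by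
  four from above, 4-connectedness bounds separating neighbourhoods by four from below. With all
  degrees equal to four, an edge in no triangle has 3 + 3 outside neighbours, and a triangle whose
  corners have no further common neighbours has 2 + 2 + 2; this is where six neighbours come from.
  Five vertices would force K5, which contains no K33 minor and so needs an obstruction of its own.
  Six vertices are too few for the separation argument that extends the cyclic sequence, and are
  treated directly. Connectedness is phrased by crossed cuts because the arguments typically end in
  a cut that no edge crosses, and because minimal closed sets then yield components without any
  walks.\<close>

definition cut_connected :: "('a \<times> 'a) set \<Rightarrow> 'a set \<Rightarrow> bool" where
  "cut_connected E U \<longleftrightarrow> U \<noteq> {} \<and> (\<forall>P. P \<subset> U \<longrightarrow> P \<noteq> {} \<longrightarrow> (\<exists>x\<in>P. \<exists>y\<in>U - P. (x, y) \<in> E))"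

definition nbhd :: "('a \<times> 'a) set \<Rightarrow> 'a set \<Rightarrow> 'a set" where
  "nbhd E A = E `` A - A"

text \<open>In the models below the hubs are connected sets, while the leaves are single vertices.\<close>

definition has_K33 :: "('a \<times> 'a) set \<Rightarrow> bool" where
  "has_K33 E \<longleftrightarrow> (\<exists>A B C. cut_connected E A \<and> cut_connected E B \<and> cut_connected E C \<and>
     A \<inter> B = {} \<and> A \<inter> C = {} \<and> B \<inter> C = {} \<and> 3 \<le> card (nbhd E A \<inter> nbhd E B \<inter> nbhd E C))"

definition has_K25 :: "('a \<times> 'a) set \<Rightarrow> bool" where
  "has_K25 E \<longleftrightarrow> (\<exists>A B. cut_connected E A \<and> cut_connected E B \<and> A \<inter> B = {} \<and>
     5 \<le> card (nbhd E A \<inter> nbhd E B))"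

lemma cut_connected_singleton [simp]: "cut_connected E {v}"
  by (auto simp: cut_connected_def)

text \<open>A proper part of the union either cuts \<open>U\<close> or \<open>W\<close> properly, or
  contains one of them and misses the other. In the last case they are disjoint and the assumed edge
  crosses, directly or by symmetry.\<close>

lemma cut_connected_Un:
  assumes "sym E" "cut_connected E U" "cut_connected E W"
    and "U \<inter> W \<noteq> {} \<or> (\<exists>u\<in>U. \<exists>w\<in>W. (u, w) \<in> E)"
  shows "cut_connected E (U \<union> W)"
  unfolding cut_connected_def
proof (intro conjI allI impI)
  show "U \<union> W \<noteq> {}" using assms by (auto simp: cut_connected_def)
next
  fix P assume P: "P \<subset> U \<union> W" "P \<noteq> {}"
  consider "P \<inter> U \<subset> U" "P \<inter> U \<noteq> {}" | "P \<inter> W \<subset> W" "P \<inter> W \<noteq> {}"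
    | "(P \<inter> U = {} \<or> U \<subseteq> P) \<and> (P \<inter> W = {} \<or> W \<subseteq> P)" by blast
  then show "\<exists>x\<in>P. \<exists>y\<in>U \<union> W - P. (x, y) \<in> E"
  proof cases
    case 1
    then obtain x y where "x \<in> P \<inter> U" "y \<in> U - (P \<inter> U)" "(x, y) \<in> E"
      using assms(2) unfolding cut_connected_def by meson
    then show ?thesis by blast
  next
    case 2
    then obtain x y where "x \<in> P \<inter> W" "y \<in> W - (P \<inter> W)" "(x, y) \<in> E"
      using assms(3) unfolding cut_connected_def by meson
    then show ?thesis by blast
  next
    case 3
    then consider "U \<subseteq> P" "P \<inter> W = {}" | "W \<subseteq> P" "P \<inter> U = {}" using P by blast
    then show ?thesis
    proof cases
      case 1
      have "U \<inter> W = {}" using 1 by blast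
      with 1 show ?thesis using assms(4) by blast
    next
      case 2
      have "U \<inter> W = {}" using 2 by blast
      with 2 show ?thesis using assms(1,4) by (meson DiffI UnI1 disjoint_iff subsetD symD)
    qed
  qed
qed

lemma cut_connected_insert:
  assumes "sym E" "cut_connected E U" "u \<in> U" "(u, x) \<in> E"
  shows "cut_connected E (insert x U)"
  using cut_connected_Un[of E U "{x}"] assms by auto

lemma cut_connected_pair: "sym E \<Longrightarrow> (u, v) \<in> E \<Longrightarrow> cut_connected E {u, v}"
  using cut_connected_insert[of E "{v}" v u] by (auto dest: symD)

text \<open>Take a minimal non-empty subset of \<open>W\<close> that no edge leaves within
  \<open>W\<close>: an uncrossed cut of it would be a smaller such subset.\<close>

lemma obtain_component:
  assumes "finite W" "W \<noteq> {}"
  obtains Y where "Y \<subseteq> W" "cut_connected E Y" "nbhd E Y \<inter> W = {}"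
proof -
  define S where "S = {Y. Y \<subseteq> W \<and> Y \<noteq> {} \<and> nbhd E Y \<inter> W = {}}"
  have "finite S" "W \<in> S" using assms by (auto simp: S_def nbhd_def)
  then obtain Y where Y: "Y \<in> S" "\<And>Z. Z \<in> S \<Longrightarrow> \<not> Z \<subset> Y"
    using finite_has_minimal2[of S W] by (metis order.strict_iff_order)
  have "cut_connected E Y"
    unfolding cut_connected_def
  proof (intro conjI allI impI)
    show "Y \<noteq> {}" using Y by (auto simp: S_def)
    fix P assume P: "P \<subset> Y" "P \<noteq> {}"
    then have "P \<notin> S" using Y by blast
    then obtain x y where "x \<in> P" "y \<in> W - P" "(x, y) \<in> E"
      using P Y(1) by (auto simp: S_def nbhd_def)
    moreover have "y \<in> Y" using calculation P Y(1) by (auto simp: S_def nbhd_def)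
    ultimately show "\<exists>x\<in>P. \<exists>y\<in>Y - P. (x, y) \<in> E" by blast
  qed
  then show ?thesis using that Y by (auto simp: S_def)
qed

lemma has_K33I:
  assumes "cut_connected E A" "cut_connected E B" "cut_connected E C"
    "A \<inter> B = {}" "A \<inter> C = {}" "B \<inter> C = {}"
    "S \<subseteq> nbhd E A" "S \<subseteq> nbhd E B" "S \<subseteq> nbhd E C" "3 \<le> card S" "finite E"
  shows "has_K33 E"
proof -
  have "finite (nbhd E A)" using assms(11) by (auto simp: nbhd_def intro: finite_Image)
  then have "card S \<le> card (nbhd E A \<inter> nbhd E B \<inter> nbhd E C)"
    using assms by (intro card_mono) auto
  then show ?thesis unfolding has_K33_def using assms by (meson order_trans)
qed

lemma has_K25I:
  assumes "cut_connected E A" "cut_connected E B" "A \<inter> B = {}"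
    "S \<subseteq> nbhd E A" "S \<subseteq> nbhd E B" "5 \<le> card S" "finite E"
  shows "has_K25 E"
proof -
  have "finite (nbhd E A)" using assms(7) by (auto simp: nbhd_def intro: finite_Image)
  then have "card S \<le> card (nbhd E A \<inter> nbhd E B)"
    using assms by (intro card_mono) auto
  then show ?thesis unfolding has_K25_def using assms by (meson order_trans)
qed

lemma card_2_obtain: "card A = 2 \<Longrightarrow> (\<And>x y. A = {x, y} \<Longrightarrow> x \<noteq> y \<Longrightarrow> P) \<Longrightarrow> P"
  by (metis card_2_iff)

section \<open>4-connected graphs without \<open>K\<^bsub>3,3\<^esub>\<close> and \<open>K\<^bsub>2,5\<^esub>\<close>\<close>

text \<open>The assumption \<open>sep\<close> is 4-connectedness.\<close>

locale K33_K25_free =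
  fixes V :: "'a set" and E :: "('a \<times> 'a) set"
  assumes fin: "finite V" and E_sub: "E \<subseteq> V \<times> V" and sym: "sym E" and irrefl: "(x, x) \<notin> E"
    and sep: "A \<subseteq> V \<Longrightarrow> A \<noteq> {} \<Longrightarrow> A \<union> nbhd E A \<noteq> V \<Longrightarrow> 4 \<le> card (nbhd E A)"
    and big: "6 \<le> card V" and no_K33: "\<not> has_K33 E" and no_K25: "\<not> has_K25 E"
begin

lemma finE: "finite E"
  using fin E_sub finite_subset by blast

lemma fin_nbhd: "finite (nbhd E A)" "finite (E `` A)"
  using finE by (auto simp: nbhd_def intro: finite_Image)

lemma sym_iff: "(x, y) \<in> E \<longleftrightarrow> (y, x) \<in> E"
  using sym by (meson symD)

lemma inV: "(x, y) \<in> E \<Longrightarrow> x \<in> V" "(x, y) \<in> E \<Longrightarrow> y \<in> V"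
  using E_sub by auto

lemma nbhd_single: "nbhd E {v} = E `` {v}"
  using irrefl by (auto simp: nbhd_def)

lemma nbhd_sub: "nbhd E A \<subseteq> V"
  using E_sub by (auto simp: nbhd_def)

section \<open>Components beyond a neighbourhood, and 4-regularity\<close>

lemma separated_card:
  assumes "A \<subseteq> V" "A \<noteq> {}" "z \<in> V" "z \<notin> A" "z \<notin> nbhd E A"
  shows "4 \<le> card (nbhd E A)"
  using sep[of A] assms by blast

lemma common_nbhd_le_2:
  assumes "cut_connected E A" "cut_connected E B" "cut_connected E C"
    "A \<inter> B = {}" "A \<inter> C = {}" "B \<inter> C = {}"
    "S \<subseteq> nbhd E A" "S \<subseteq> nbhd E B" "S \<subseteq> nbhd E C"
  shows "card S \<le> 2"
proof (rule ccontr)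
  assume "\<not> card S \<le> 2"
  then have "3 \<le> card S" by simp
  then have "has_K33 E" using has_K33I[OF assms _ finE] by blast
  then show False using no_K33 by blast
qed

lemma common_nbhd_le_4:
  assumes "cut_connected E A" "cut_connected E B" "A \<inter> B = {}" "S \<subseteq> nbhd E A" "S \<subseteq> nbhd E B"
  shows "card S \<le> 4"
proof (rule ccontr)
  assume "\<not> card S \<le> 4"
  then have "5 \<le> card S" by simp
  then have "has_K25 E" using has_K25I[OF assms _ finE] by blast
  then show False using no_K25 by blast
qed

text \<open>If some other vertex \<open>m\<close> misses a vertex, a component \<open>Y\<close> of
  its non-neighbours has four neighbours, all adjacent to \<open>m\<close>; those other than
  \<open>v\<close> are leaves of a K33 with hubs \<open>v\<close>, \<open>m\<close>,
  \<open>Y\<close>. If every vertex is universal, six vertices split 3 + 3 give the K33.\<close>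

lemma no_universal_vertex:
  assumes v: "v \<in> V" shows "insert v (E `` {v}) \<noteq> V"
proof
  assume univ: "insert v (E `` {v}) = V"
  show False
  proof (cases "\<exists>m\<in>V. m \<noteq> v \<and> insert m (E `` {m}) \<noteq> V")
    case True
    then obtain m where m: "m \<in> V" "m \<noteq> v" "insert m (E `` {m}) \<noteq> V" by blast
    define W where "W = V - insert m (E `` {m})"
    have "W \<noteq> {}" "finite W" using m inV fin by (auto simp: W_def)
    then obtain Y where Y: "Y \<subseteq> W" "cut_connected E Y" "nbhd E Y \<inter> W = {}"
      using obtain_component by metis
    have vm: "(m, v) \<in> E" using univ m sym_iff by blast
    have mY: "m \<notin> nbhd E Y" using Y(1) sym_iff by (auto simp: W_def nbhd_def)
    have NY: "nbhd E Y \<subseteq> E `` {m}" using Y(3) nbhd_sub[of Y] mY by (auto simp: W_def)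
    have "4 \<le> card (nbhd E Y)"
      by (rule separated_card[of Y m]) (use Y m mY in \<open>auto simp: W_def cut_connected_def\<close>)
    then have "3 \<le> card (nbhd E Y - {v})"
      using fin_nbhd by (auto simp: card_Diff_singleton_if)
    moreover have "card (nbhd E Y - {v}) \<le> 2"
    proof (rule common_nbhd_le_2[of "{v}" "{m}" Y])
      show "{v} \<inter> Y = {}" "{m} \<inter> Y = {}" using Y(1) vm by (auto simp: W_def)
      show "nbhd E Y - {v} \<subseteq> nbhd E {v}" using univ nbhd_sub[of Y] by (auto simp: nbhd_single)
    qed (use Y m NY in \<open>auto simp: nbhd_single\<close>)
    ultimately show False by simp
  next
    case False
    have all: "(x, y) \<in> E" if "x \<in> V" "y \<in> V" "x \<noteq> y" for x y
    proof -
      have "insert x (E `` {x}) = V" using False univ that(1) by metis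
      then have "y \<in> insert x (E `` {x})" using that(2) by simp
      then show ?thesis using that(3) by simp
    qed
    obtain T where T: "T \<subseteq> V" "card T = 6" using big obtain_subset_with_card_n by metis
    obtain U where U: "U \<subseteq> T" "card U = 3" 
    proof -
      have "3 \<le> card T" using T by simp
      then show ?thesis using that obtain_subset_with_card_n by metis
    qed
    have "finite T" using T fin finite_subset by blast
    then have "card (T - U) = 3" using U T by (simp add: card_Diff_subset finite_subset)
    then obtain a b c where abc: "T - U = {a, b, c}" "a \<noteq> b" "a \<noteq> c" "b \<noteq> c"
      by (auto simp: card_3_iff)
    have "card U \<le> 2"
      by (rule common_nbhd_le_2[of "{a}" "{b}" "{c}"])
        (use abc U T in \<open>auto simp: nbhd_single intro!: all\<close>)
    then show False using U by simp
  qed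
qed

lemma outside_component:
  assumes v: "v \<in> V"
  obtains A where "cut_connected E A" "A \<subseteq> V - insert v (E `` {v})" "nbhd E A = E `` {v}"
proof -
  define W where "W = V - insert v (E `` {v})"
  have "W \<noteq> {}" "finite W" using no_universal_vertex[OF v] inV fin v by (auto simp: W_def)
  then obtain A where A: "A \<subseteq> W" "cut_connected E A" "nbhd E A \<inter> W = {}"
    using obtain_component by metis
  have vA: "v \<notin> nbhd E A" "v \<notin> A" using A(1) sym_iff by (auto simp: W_def nbhd_def)
  have NA: "nbhd E A \<subseteq> E `` {v}" using A(3) nbhd_sub[of A] vA by (auto simp: W_def)
  have Ane: "A \<noteq> {}" using A(2) by (auto simp: cut_connected_def)
  have "V \<subseteq> insert v (nbhd E A \<union> A)"
  proof (rule ccontr)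
    \<comment> \<open>a further component \<open>Y\<close> would be the third hub of a \<open>K\<^bsub>3,3\<^esub>\<close>\<close>
    define X where "X = V - insert v (nbhd E A \<union> A)"
    assume "\<not> ?thesis"
    then have "X \<noteq> {}" "finite X" using fin by (auto simp: X_def)
    then obtain Y where Y: "Y \<subseteq> X" "cut_connected E Y" "nbhd E Y \<inter> X = {}"
      using obtain_component by metis
    have "nbhd E Y \<inter> A = {}" using Y(1) sym_iff by (auto simp: X_def nbhd_def)
    then have NY: "nbhd E Y \<subseteq> insert v (nbhd E A)" using Y(3) nbhd_sub[of Y] by (auto simp: X_def)
    obtain a where "a \<in> A" using Ane by blast
    have "4 \<le> card (nbhd E Y)"
      by (rule separated_card[of Y a])
        (use Y A \<open>a \<in> A\<close> \<open>nbhd E Y \<inter> A = {}\<close> in \<open>auto simp: X_def W_def cut_connected_def\<close>)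
    \<comment> \<open>\<open>Y\<close> may contain neighbours of \<open>v\<close> that miss
      \<open>A\<close>, so \<open>v\<close> itself can be among the four neighbours of
      \<open>Y\<close>; three usable leaves remain.\<close>
    then have "3 \<le> card (nbhd E Y - {v})"
      using fin_nbhd by (auto simp: card_Diff_singleton_if)
    moreover have "card (nbhd E Y - {v}) \<le> 2"
    proof (rule common_nbhd_le_2[of "{v}" A Y])
      show "{v} \<inter> Y = {}" "A \<inter> Y = {}" using Y(1) by (auto simp: X_def)
      show "nbhd E Y - {v} \<subseteq> nbhd E {v}" using NA NY by (auto simp: nbhd_single)
    qed (use Y A NY NA vA in \<open>auto simp: nbhd_single\<close>)
    ultimately show False by simp
  qed
  then have "E `` {v} \<subseteq> nbhd E A" using A(1) inV irrefl unfolding W_def by blast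
  then show ?thesis using that A NA by (auto simp: W_def)
qed

lemma degree: assumes "v \<in> V" shows "card (E `` {v}) = 4"
proof -
  obtain A where A: "cut_connected E A" "A \<subseteq> V - insert v (E `` {v})" "nbhd E A = E `` {v}"
    using outside_component[OF assms] .
  have "card (E `` {v}) \<le> 4"
    by (rule common_nbhd_le_4[of "{v}" A]) (use A in \<open>auto simp: nbhd_single\<close>)
  moreover have "4 \<le> card (nbhd E {v})"
    using sep[of "{v}"] assms no_universal_vertex[OF assms] by (simp add: nbhd_single)
  ultimately show ?thesis by (simp add: nbhd_single)
qed

text \<open>Every neighbour of \<open>v\<close> also sees the component beyond the neighbourhood of
  \<open>v\<close>. Later this rules out coincidences: adjacent vertices never have nested closed
  neighbourhoods.\<close>

lemma neighbour_outside:
  assumes "(v, u) \<in> E" shows "\<not> E `` {u} \<subseteq> insert v (E `` {v})"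
proof
  assume *: "E `` {u} \<subseteq> insert v (E `` {v})"
  obtain A where A: "cut_connected E A" "A \<subseteq> V - insert v (E `` {v})" "nbhd E A = E `` {v}"
    using outside_component[of v] assms inV by metis
  then have "u \<in> nbhd E A" using assms by simp
  then obtain x where "x \<in> A" "(u, x) \<in> E" using sym_iff by (auto simp: nbhd_def)
  then show False using * A by blast
qed

text \<open>By 4-regularity each vertex of \<open>M\<close> keeps three neighbours outside
  \<open>h\<close>. If nothing lies beyond \<open>M\<close>, these edges form a cubic graph on
  \<open>M\<close>; otherwise each component beyond \<open>M\<close> takes exactly four vertices of
  \<open>M\<close>, and counting decides how they can be placed.\<close>

lemma six_neighbours:
  assumes h: "cut_connected E h" "h \<subseteq> V" and M: "card (nbhd E h) = 6"
    and one: "\<And>m. m \<in> nbhd E h \<Longrightarrow> card (E `` {m} \<inter> h) = 1"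
  shows False
proof -
  define M where "M = nbhd E h"
  define W where "W = V - h - M"
  have finM: "finite M" using fin_nbhd by (simp add: M_def)
  have cM: "card M = 6" using M by (simp add: M_def)
  have hM: "h \<inter> M = {}" by (auto simp: M_def nbhd_def)
  have MV: "M \<subseteq> V" using nbhd_sub by (auto simp: M_def)
  have ndeg: "card (E `` {m} - h) = 3" if "m \<in> M" for m
  proof -
    have "card (E `` {m}) = card (E `` {m} \<inter> h) + card (E `` {m} - h)"
      using fin_nbhd by (metis card_Int_Diff)
    then show ?thesis using degree[of m] one[of m] that MV by (auto simp: M_def)
  qed
  have hW: "(x, y) \<notin> E" "(y, x) \<notin> E" if "x \<in> h" "y \<in> W" for x y
    using that sym_iff by (auto simp: W_def M_def nbhd_def)
  have hne: "h \<noteq> {}" using h by (auto simp: cut_connected_def)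
  \<comment> \<open>At least four because \<open>h\<close> lies beyond \<open>nbhd E Y\<close>, at
    most four because \<open>h\<close> and \<open>Y\<close> would be the hubs of a K25.\<close>
  have comp: "nbhd E Y \<subseteq> M \<and> card (nbhd E Y) = 4"
    if Y: "Y \<subseteq> W" "cut_connected E Y" "nbhd E Y \<inter> W = {}" for Y
  proof -
    have "nbhd E Y \<inter> h = {}" using Y hW by (auto simp: nbhd_def)
    then have 1: "nbhd E Y \<subseteq> M" using Y(3) nbhd_sub[of Y] by (auto simp: W_def)
    obtain z where "z \<in> h" using hne by blast
    have "4 \<le> card (nbhd E Y)"
      by (rule separated_card[of Y z]) (use Y \<open>z \<in> h\<close> h \<open>nbhd E Y \<inter> h = {}\<close> in
        \<open>auto simp: W_def cut_connected_def\<close>)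
    moreover have "card (nbhd E Y) \<le> 4"
      by (rule common_nbhd_le_4[of h Y]) (use Y h 1 in \<open>auto simp: W_def M_def\<close>)
    ultimately show ?thesis using 1 by simp
  qed
  show False
  proof (cases "W = {}")
    case True
    have nin: "E `` {m} - h \<subseteq> M - {m}" if "m \<in> M" for m
      using True that inV irrefl by (auto simp: W_def)
    obtain m where m: "m \<in> M" using cM by fastforce
    define N3 where "N3 = E `` {m} - h"
    have N3: "card N3 = 3" "N3 \<subseteq> M - {m}" using ndeg[OF m] nin[OF m] by (auto simp: N3_def)
    have "card (M - {m} - N3) = 2"
      using N3 cM finM m by (simp add: card_Diff_subset finite_subset[of N3 "M - {m}"])
    then obtain s t where st: "M - {m} - N3 = {s, t}" "s \<noteq> t" by (rule card_2_obtain)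
    have stM: "s \<in> M" "t \<in> M" "s \<noteq> m" "t \<noteq> m" "s \<notin> N3" "t \<notin> N3"
      using st by blast+
    have nm: "(m, s) \<notin> E" "(s, m) \<notin> E" "(m, t) \<notin> E" "(t, m) \<notin> E"
      using stM hM sym_iff by (auto simp: N3_def)
    have Ms: "M = insert m (insert s (insert t N3))" using st N3 m by blast
    have finN: "finite N3" using N3 using finM finite_subset by blast
    \<comment> \<open>A connected part of \<open>{s, t}\<close> that dominates \<open>N3\<close> is
      the third hub of a K33, next to \<open>h\<close> and \<open>m\<close>.\<close>
    have K: False if C: "cut_connected E C" "C \<subseteq> {s, t}" "N3 \<subseteq> nbhd E C" for C
    proof -
      have "card N3 \<le> 2"
        by (rule common_nbhd_le_2[of h "{m}" C])
          (use h m C hM N3 stM in \<open>auto simp: M_def[symmetric] nbhd_single N3_def\<close>)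
      then show False using N3 by simp
    qed
    show False
    proof (cases "(s, t) \<in> E")
      case False
      then have "E `` {s} - h \<subseteq> N3" using nin[OF stM(1)] nm Ms by auto
      then have "E `` {s} - h = N3" using N3 ndeg[OF stM(1)] finN by (simp add: card_subset_eq)
      then have "N3 \<subseteq> nbhd E {s}" by (auto simp: nbhd_single)
      then show False using K[of "{s}"] by simp
    next
      case True
      \<comment> \<open>Some \<open>p\<close> in \<open>N3\<close> sees neither \<open>s\<close> nor
        \<open>t\<close>. The degrees then determine the neighbours of \<open>s\<close>,
        \<open>t\<close> and \<open>p\<close>, and a vertex of \<open>Q\<close> is adjacent to all
        of \<open>m\<close>, \<open>p\<close>, \<open>s\<close>, \<open>t\<close>, one too
        many.\<close>
      have "\<not> N3 \<subseteq> nbhd E {s, t}" using K[of "{s, t}"] cut_connected_pair[OF sym True] by auto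
      then obtain p where p: "p \<in> N3" "p \<notin> nbhd E {s, t}" by blast
      have ps: "(p, s) \<notin> E" "(p, t) \<notin> E" "(s, p) \<notin> E" "(t, p) \<notin> E"
        using p stM sym_iff by (auto simp: nbhd_def)
      have pM: "p \<in> M" "p \<noteq> m" "p \<noteq> s" "p \<noteq> t" using p N3 stM by auto
      define Q where "Q = N3 - {p}"
      have Q: "card Q = 2" "finite Q" using p N3 finN by (auto simp: Q_def)
      have N3Q: "N3 = insert p Q" "p \<notin> Q" using p by (auto simp: Q_def)
      have sQ: "E `` {s} - h = insert t Q"
      proof (rule card_subset_eq)
        show "E `` {s} - h \<subseteq> insert t Q" using nin[OF stM(1)] nm ps Ms N3Q by auto
        show "card (E `` {s} - h) = card (insert t Q)"
          using ndeg[OF stM(1)] Q stM N3Q by simp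
      qed (use Q in simp)
      have tQ: "E `` {t} - h = insert s Q"
      proof (rule card_subset_eq)
        show "E `` {t} - h \<subseteq> insert s Q" using nin[OF stM(2)] nm ps Ms N3Q by auto
        show "card (E `` {t} - h) = card (insert s Q)"
          using ndeg[OF stM(2)] Q stM N3Q by simp
      qed (use Q in simp)
      have pQ: "E `` {p} - h = insert m Q"
      proof (rule card_subset_eq)
        show "E `` {p} - h \<subseteq> insert m Q" using nin[OF pM(1)] ps Ms N3Q by auto
        show "card (E `` {p} - h) = card (insert m Q)"
          using ndeg[OF pM(1)] Q m N3 N3Q by auto
      qed (use Q in simp)
      obtain q where q: "q \<in> Q" using Q by fastforce
      have qM: "q \<in> M" "q \<noteq> m" "q \<noteq> s" "q \<noteq> t" "q \<noteq> p"
        using q N3Q N3 stM by auto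
      have "q \<in> N3" using q N3Q by blast
      then have "(m, q) \<in> E" by (simp add: N3_def)
      moreover have "(p, q) \<in> E" "(s, q) \<in> E" "(t, q) \<in> E" using q sQ tQ pQ by blast+
      ultimately have "{m, p, s, t} \<subseteq> E `` {q} - h"
        using sym_iff m stM pM hM by blast
      moreover have "card {m, p, s, t} = 4" using stM st(2) pM by simp
      ultimately have "4 \<le> card (E `` {q} - h)"
        using card_mono[of "E `` {q} - h" "{m, p, s, t}"] fin_nbhd by auto
      then show False using ndeg[OF qM(1)] by simp
    qed
  next
    case False
    have "finite W" using fin by (simp add: W_def)
    then obtain Y where Y: "Y \<subseteq> W" "cut_connected E Y" "nbhd E Y \<inter> W = {}"
      using obtain_component[of W E] False by blast
    note cY = comp[OF Y]
    show False
    proof (cases "Y = W")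
      case False
      then have "W - Y \<noteq> {}" using Y by blast
      then obtain Z where Z: "Z \<subseteq> W - Y" "cut_connected E Z" "nbhd E Z \<inter> (W - Y) = {}"
        using obtain_component[of "W - Y" E] \<open>finite W\<close> by blast
      have "nbhd E Z \<inter> Y = {}" using Y(3) Z(1) sym_iff by (fastforce simp: nbhd_def)
      then have Z': "Z \<subseteq> W" "nbhd E Z \<inter> W = {}" using Z by blast+
      note cZ = comp[OF Z'(1) Z(2) Z'(2)]
      have dis: "Y \<inter> Z = {}" "h \<inter> Y = {}" "h \<inter> Z = {}" using Y Z by (auto simp: W_def)
      have le2: "card (nbhd E Y \<inter> nbhd E Z) \<le> 2"
        by (rule common_nbhd_le_2[of h Y Z]) (use Y Z h dis cY in \<open>auto simp: M_def\<close>)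
      have sum: "card (nbhd E Y \<union> nbhd E Z) + card (nbhd E Y \<inter> nbhd E Z) = 8"
        using card_Un_Int[of "nbhd E Y" "nbhd E Z"] cY cZ fin_nbhd by simp
      \<comment> \<open>Two sets of size four with at most two common elements fit into the six
        vertices of \<open>M\<close> only if they cover \<open>M\<close> and overlap.\<close>
      have "card (nbhd E Y \<union> nbhd E Z) \<le> 6"
        using card_mono[OF finM, of "nbhd E Y \<union> nbhd E Z"] cY cZ cM by auto
      then have "card (nbhd E Y \<union> nbhd E Z) = card M" "card (nbhd E Y \<inter> nbhd E Z) \<noteq> 0"
        using le2 sum cM by auto
      \<comment> \<open>\<open>Y\<close> and \<open>Z\<close>, joined through a common neighbour, form a hub opposite to \<open>h\<close> in a \<open>K\<^bsub>2,5\<^esub>\<close>\<close>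
      then have un: "nbhd E Y \<union> nbhd E Z = M" and "nbhd E Y \<inter> nbhd E Z \<noteq> {}"
        using cY cZ finM card_subset_eq[OF finM, of "nbhd E Y \<union> nbhd E Z"] by auto
      then obtain n where n: "n \<in> nbhd E Y" "n \<in> nbhd E Z" by blast
      then obtain y z where yz: "y \<in> Y" "(y, n) \<in> E" "z \<in> Z" "(z, n) \<in> E"
        by (auto simp: nbhd_def)
      have c1: "cut_connected E (insert n Y)" using cut_connected_insert[OF sym Y(2)] yz by blast
      have c2: "cut_connected E (insert n Z)" using cut_connected_insert[OF sym Z(2)] yz by blast
      have cc: "cut_connected E (insert n Y \<union> insert n Z)"
        by (rule cut_connected_Un[OF sym c1 c2]) auto
      have nM: "n \<in> M" using n cY by blast
      have "card (M - {n}) \<le> 4"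
      proof (rule common_nbhd_le_4[OF h(1) cc])
        show "h \<inter> (insert n Y \<union> insert n Z) = {}" using dis nM hM by auto
        show "M - {n} \<subseteq> nbhd E h" by (auto simp: M_def)
        show "M - {n} \<subseteq> nbhd E (insert n Y \<union> insert n Z)"
        proof
          fix x assume x: "x \<in> M - {n}"
          then have "x \<notin> W" by (auto simp: W_def)
          then show "x \<in> nbhd E (insert n Y \<union> insert n Z)" using x un Y Z by (auto simp: nbhd_def)
        qed
      qed
      then show False using nM cM finM by simp
    next
      case True
      define N where "N = nbhd E W"
      have N: "N \<subseteq> M" "card N = 4" "cut_connected E W" using cY True Y by (auto simp: N_def)
      have finN: "finite N" using fin_nbhd by (simp add: N_def)
      have "card (M - N) = 2" using N cM finN by (simp add: card_Diff_subset)
      then obtain a b where ab: "M - N = {a, b}" "a \<noteq> b" by (rule card_2_obtain)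
      have abM: "a \<in> M" "b \<in> M" "a \<notin> N" "b \<notin> N" using ab by blast+
      have WM: "W \<inter> M = {}" "W \<inter> h = {}" by (auto simp: W_def)
      have nW: "E `` {x} - h \<subseteq> M - {x}" if "x \<in> M" "x \<notin> N" for x
      proof
        fix y assume y: "y \<in> E `` {x} - h"
        then have "y \<notin> W" using that WM sym_iff by (fastforce simp: N_def nbhd_def)
        then show "y \<in> M - {x}" using y inV irrefl by (auto simp: W_def)
      qed
      have Ms: "M = insert a (insert b N)" using ab N by blast
      \<comment> \<open>otherwise \<open>W\<close> extended by \<open>n\<close> would be a hub of a \<open>K\<^bsub>2,5\<^esub>\<close>; in the end \<open>{a, b}\<close> becomes the
        third hub of a \<open>K\<^bsub>3,3\<^esub>\<close>\<close>
      have no_both: "\<not> ((a, n) \<in> E \<and> (b, n) \<in> E)" if n: "n \<in> N" for n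
      proof
        assume both: "(a, n) \<in> E \<and> (b, n) \<in> E"
        obtain w where "w \<in> W" "(w, n) \<in> E" using n by (auto simp: N_def nbhd_def)
        then have c: "cut_connected E (insert n W)" using cut_connected_insert[OF sym N(3)] by blast
        have nM: "n \<in> M" using n N by blast
        have "card (M - {n}) \<le> 4"
        proof (rule common_nbhd_le_4[OF h(1) c])
          show "h \<inter> insert n W = {}" using WM nM hM by auto
          show "M - {n} \<subseteq> nbhd E h" by (auto simp: M_def)
          show "M - {n} \<subseteq> nbhd E (insert n W)"
          proof
            fix x assume x: "x \<in> M - {n}"
            then have "x \<notin> W" using WM by blast
            moreover have "x \<in> E `` insert n W"
            proof (cases "x \<in> N")
              case True then show ?thesis by (auto simp: N_def nbhd_def)
            next
              case False
              then have "x = a \<or> x = b" using x Ms by blast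
              then show ?thesis using both sym_iff by blast
            qed
            ultimately show "x \<in> nbhd E (insert n W)" using x by (auto simp: nbhd_def)
          qed
        qed
        then show False using nM cM finM by simp
      qed
      define X where "X = E `` {a} \<inter> N"
      define X' where "X' = E `` {b} \<inter> N"
      have fX: "finite X" "finite X'" using finN by (auto simp: X_def X'_def)
      have dX: "X \<inter> X' = {}" using no_both by (auto simp: X_def X'_def)
      have XN: "X \<union> X' \<subseteq> N" by (auto simp: X_def X'_def)
      \<comment> \<open>\<open>a\<close> and \<open>b\<close> each need three neighbours outside
        \<open>h\<close>, yet share the four vertices of \<open>N\<close> without overlap; so they
        must be adjacent and take two each.\<close>
      have "card (X \<union> X') \<le> 4" using card_mono[OF finN XN] N by simp
      then have le4: "card X + card X' \<le> 4" using card_Un_disjoint[OF fX dX] by simp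
      have sa: "E `` {a} - h \<subseteq> (if (a, b) \<in> E then insert b X else X)"
        using nW[OF abM(1,3)] Ms by (auto simp: X_def)
      have sb: "E `` {b} - h \<subseteq> (if (a, b) \<in> E then insert a X' else X')"
        using nW[OF abM(2,4)] Ms sym_iff by (auto simp: X'_def)
      have ba: "b \<notin> X" "a \<notin> X'" using abM by (auto simp: X_def X'_def)
      have "(a, b) \<in> E"
      proof (rule ccontr)
        assume "(a, b) \<notin> E"
        then have "E `` {a} - h \<subseteq> X" "E `` {b} - h \<subseteq> X'" using sa sb by simp_all
        then have "3 \<le> card X" "3 \<le> card X'"
          using card_mono[OF fX(1)] card_mono[OF fX(2)] ndeg[OF abM(1)] ndeg[OF abM(2)] by metis+
        then show False using le4 by simp
      qed
      then have "card (E `` {a} - h) \<le> card (insert b X)" "card (E `` {b} - h) \<le> card (insert a X')"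
        using sa sb fX by (simp_all add: card_mono)
      then have "2 \<le> card X" "2 \<le> card X'" using ba fX ndeg[OF abM(1)] ndeg[OF abM(2)] by simp_all
      then have "card (X \<union> X') = card N" using le4 N card_Un_disjoint[OF fX dX] by simp
      then have un: "X \<union> X' = N" using XN finN card_subset_eq by blast
      have "card N \<le> 2"
      proof (rule common_nbhd_le_2[OF h(1) N(3) cut_connected_pair[OF sym \<open>(a, b) \<in> E\<close>]])
        show "N \<subseteq> nbhd E {a, b}" using un abM by (auto simp: X_def X'_def nbhd_def)
      qed (use N WM hM abM in \<open>auto simp: N_def M_def\<close>)
      then show False using N by simp
    qed
  qed
qed

end

text \<open>For \<open>5 \<le> n\<close> this is adjacency in
  \<open>graph_square (cycle_graph n)\<close>; the form by residues keeps distances out of the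
  search for the labelling.\<close>

definition square_adj :: "nat \<Rightarrow> nat \<Rightarrow> nat \<Rightarrow> bool" where
  "square_adj n i j \<longleftrightarrow> i \<noteq> j \<and>
     (j = (i + 1) mod n \<or> j = (i + 2) mod n \<or> i = (j + 1) mod n \<or> i = (j + 2) mod n)"

section \<open>Triangles and spanning paths in neighbourhoods\<close>

context K33_K25_free
begin

text \<open>Otherwise the pair \<open>{u, v}\<close> has 3 + 3 outside neighbours, each attached to
  one end only.\<close>

lemma edge_in_triangle:
  assumes "(u, v) \<in> E" shows "\<exists>w. (u, w) \<in> E \<and> (v, w) \<in> E"
proof (rule ccontr)
  assume none: "\<not> ?thesis"
  have uv: "u \<noteq> v" "(v, u) \<in> E" "u \<in> V" "v \<in> V" using assms irrefl sym_iff inV by blast+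
  have N: "nbhd E {u, v} = (E `` {u} - {v}) \<union> (E `` {v} - {u})"
    using irrefl by (auto simp: nbhd_def)
  have "card (nbhd E {u, v}) = card (E `` {u} - {v}) + card (E `` {v} - {u})"
    unfolding N by (rule card_Un_disjoint) (use fin_nbhd none in auto)
  then have c: "card (nbhd E {u, v}) = 6"
    using degree uv assms fin_nbhd by (simp add: card_Diff_singleton_if)
  show False
  proof (rule six_neighbours[OF cut_connected_pair[OF sym assms] _ c])
    fix m assume "m \<in> nbhd E {u, v}"
    then consider "(u, m) \<in> E" "(v, m) \<notin> E" "m \<noteq> u" "m \<noteq> v" | "(v, m) \<in> E" "(u, m) \<notin> E" "m \<noteq> u" "m \<noteq> v"
      using none by (auto simp: nbhd_def)
    then show "card (E `` {m} \<inter> {u, v}) = 1"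
    proof cases
      case 1
      then have "E `` {m} \<inter> {u, v} = {u}" using sym_iff by blast
      then show ?thesis by simp
    next
      case 2
      then have "E `` {m} \<inter> {u, v} = {v}" using sym_iff by blast
      then show ?thesis by simp
    qed
  qed (use uv in auto)
qed

lemma four_neighbours:
  assumes "v \<in> V" "{a, b, c, d} \<subseteq> E `` {v}" "distinct [a, b, c, d]"
  shows "E `` {v} = {a, b, c, d}"
proof -
  have "card {a, b, c, d} = card (E `` {v})" using degree[OF assms(1)] assms(3) by simp
  from card_subset_eq[OF fin_nbhd(2) assms(2) this] show ?thesis by (rule HOL.sym)
qed

lemma obtain_fourth_neighbour:
  assumes "v \<in> V" "(v, a) \<in> E" "(v, b) \<in> E" "(v, c) \<in> E" "distinct [a, b, c]"
  obtains d where "E `` {v} = {a, b, c, d}" "distinct [a, b, c, d]"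
proof -
  have "card (E `` {v} - {a, b, c}) = 1"
    using degree[OF assms(1)] assms by (subst card_Diff_subset) auto
  then obtain d where "E `` {v} - {a, b, c} = {d}" by (auto simp: card_1_singleton_iff)
  then have "E `` {v} = {a, b, c, d}" "d \<notin> {a, b, c}" using assms by blast+
  then show ?thesis using that assms by auto
qed

text \<open>If the remaining neighbours of \<open>a\<close> and \<open>b\<close> are disjoint, the
  triangle \<open>{v, a, b}\<close> has six outside neighbours, each attached to one corner. If they
  share \<open>x\<close>, the triangles on the edges to the last neighbours \<open>r\<close> and
  \<open>r'\<close> make both adjacent to \<open>x\<close>, and then \<open>{v, r, r'}\<close>
  separates \<open>{a, b, x}\<close> from \<open>c\<close>.\<close>

lemma no_two_disjoint_triangles:
  assumes v: "E `` {v} = {a, b, c, d}" "distinct [a, b, c, d]" and ab: "(a, b) \<in> E"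
    and sepd: "(a, c) \<notin> E" "(a, d) \<notin> E" "(b, c) \<notin> E" "(b, d) \<notin> E"
  shows False
proof -
  have va: "(v, a) \<in> E" "(v, b) \<in> E" "(v, c) \<in> E" "(v, d) \<in> E" using v by blast+
  have av: "(a, v) \<in> E" "(b, v) \<in> E" "(c, v) \<in> E" "(d, v) \<in> E" "(b, a) \<in> E"
    using va ab sym_iff by blast+
  have inV': "v \<in> V" "a \<in> V" "b \<in> V" "c \<in> V" "d \<in> V" using va inV by blast+
  have ne: "v \<noteq> a" "v \<noteq> b" "v \<noteq> c" "v \<noteq> d" "a \<noteq> b" "a \<noteq> c" "a \<noteq> d" "b \<noteq> c" "b \<noteq> d" "c \<noteq> d"
    using va irrefl v by auto
  have cc: "cut_connected E {v, a, b}"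
    using cut_connected_insert[OF sym cut_connected_pair[OF sym ab], of a v] av by simp
  define Na where "Na = E `` {a} - {v, b}"
  define Nb where "Nb = E `` {b} - {v, a}"
  have cNa: "card Na = 2" "card Nb = 2"
    using degree[OF inV'(2)] degree[OF inV'(3)] av ab ne by (auto simp: Na_def Nb_def card_Diff_subset)
  have fN: "finite Na" "finite Nb" using fin_nbhd by (auto simp: Na_def Nb_def)
  have Nne: "x \<noteq> v" "x \<noteq> a" "x \<noteq> b" "x \<noteq> c" "x \<noteq> d" "(v, x) \<notin> E" if "x \<in> Na \<union> Nb" for x
  proof -
    have "(v, y) \<in> E \<longleftrightarrow> y \<in> {a, b, c, d}" for y using v by blast
    then show "x \<noteq> v" "x \<noteq> a" "x \<noteq> b" "x \<noteq> c" "x \<noteq> d" "(v, x) \<notin> E"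
      using that irrefl sepd by (auto simp: Na_def Nb_def)
  qed
  show False
  proof (cases "Na \<inter> Nb = {}")
    case True
    have N: "nbhd E {v, a, b} = (Na \<union> Nb) \<union> {c, d}"
      using v va ne irrefl sepd by (auto simp: nbhd_def Na_def Nb_def)
    have c6: "card (nbhd E {v, a, b}) = 6"
    proof -
      have "card ((Na \<union> Nb) \<union> {c, d}) = card (Na \<union> Nb) + card {c, d}"
        by (rule card_Un_disjoint) (use fN Nne(4,5) in blast)+
      then show ?thesis unfolding N using True cNa fN ne by (simp add: card_Un_disjoint)
    qed
    show False
    proof (rule six_neighbours[OF cc _ c6])
      show "{v, a, b} \<subseteq> V" using inV' by simp
      fix m assume "m \<in> nbhd E {v, a, b}"
      then consider "m \<in> Na" "m \<notin> Nb" | "m \<in> Nb" "m \<notin> Na" | "m = c" | "m = d"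
        using N True by blast
      then show "card (E `` {m} \<inter> {v, a, b}) = 1"
      proof cases
        case 1
        then have "m \<noteq> v" "m \<noteq> a" "(v, m) \<notin> E" using Nne(1,2,6)[of m] by blast+
        then have "(a, m) \<in> E" "(b, m) \<notin> E" "(v, m) \<notin> E"
          using 1 by (simp_all add: Na_def Nb_def)
        then have "E `` {m} \<inter> {v, a, b} = {a}" using sym_iff by blast
        then show ?thesis by simp
      next
        case 2
        then have "m \<noteq> v" "m \<noteq> b" "(v, m) \<notin> E" using Nne(1,3,6)[of m] by blast+
        then have "(a, m) \<notin> E" "(b, m) \<in> E" "(v, m) \<notin> E"
          using 2 by (simp_all add: Na_def Nb_def)
        then have "E `` {m} \<inter> {v, a, b} = {b}" using sym_iff by blast
        then show ?thesis by simp
      next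
        case 3
        then have "E `` {m} \<inter> {v, a, b} = {v}" using sepd sym_iff av by blast
        then show ?thesis by simp
      next
        case 4
        then have "E `` {m} \<inter> {v, a, b} = {v}" using sepd sym_iff av by blast
        then show ?thesis by simp
      qed
    qed
  next
    case False
    then obtain x where x: "x \<in> Na" "x \<in> Nb" by blast
    have "card (Na - {x}) = 1" "card (Nb - {x}) = 1" using cNa x fN by simp_all
    then obtain r r' where "Na - {x} = {r}" "Nb - {x} = {r'}" by (auto simp: card_1_singleton_iff)
    then have N: "Na = {x, r}" "Nb = {x, r'}" "r \<noteq> x" "r' \<noteq> x" using x by blast+
    have Ea: "E `` {a} = {v, b, x, r}" "E `` {b} = {v, a, x, r'}"
      using N av ab by (auto simp: Na_def Nb_def)
    have rne: "r \<noteq> v" "r \<noteq> a" "r \<noteq> b" "r' \<noteq> v" "r' \<noteq> a" "r' \<noteq> b" "(v, r) \<notin> E" "(v, r') \<notin> E"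
      "x \<noteq> v" "x \<noteq> a" "x \<noteq> b" "x \<noteq> c" "r \<noteq> c" "r' \<noteq> c"
      using Nne(1-4,6)[of r] Nne(1-4,6)[of r'] Nne(1-4)[of x] N by simp_all
    \<comment> \<open>Otherwise \<open>a\<close> and \<open>b\<close> would have nested closed
      neighbourhoods.\<close>
    have "r \<noteq> r'"
    proof
      assume "r = r'"
      then have "E `` {b} \<subseteq> insert a (E `` {a})" using Ea by auto
      then show False using neighbour_outside[OF ab] by blast
    qed
    have ar: "(a, r) \<in> E" "(b, r') \<in> E" "(x, a) \<in> E" "(x, b) \<in> E" using Ea sym_iff by blast+
    have br: "(b, r) \<notin> E" "(a, r') \<notin> E" using Ea \<open>r \<noteq> r'\<close> N rne by auto
    have "(x, r) \<in> E"
    proof -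
      obtain w where w: "(a, w) \<in> E" "(r, w) \<in> E" using edge_in_triangle[OF ar(1)] by blast
      then have "w \<in> {v, b, x, r}" using Ea(1) by blast
      moreover have "w \<noteq> v" "w \<noteq> b" "w \<noteq> r"
        using w(2) rne(7) br(1) irrefl sym_iff by blast+
      ultimately show ?thesis using w(2) sym_iff by blast
    qed
    moreover have "(x, r') \<in> E"
    proof -
      obtain w where w: "(b, w) \<in> E" "(r', w) \<in> E" using edge_in_triangle[OF ar(2)] by blast
      then have "w \<in> {v, a, x, r'}" using Ea(2) by blast
      moreover have "w \<noteq> v" "w \<noteq> a" "w \<noteq> r'"
        using w(2) rne(8) br(2) irrefl sym_iff by blast+
      ultimately show ?thesis using w(2) sym_iff by blast
    qed
    ultimately have Ex: "E `` {x} = {a, b, r, r'}"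
      using four_neighbours[of x a b r r'] ar inV ne rne \<open>r \<noteq> r'\<close> by auto
    have N3: "nbhd E {a, b, x} \<subseteq> {v, r, r'}" using Ea Ex by (auto simp: nbhd_def)
    have "card (nbhd E {a, b, x}) \<le> card {v, r, r'}" by (rule card_mono[OF _ N3]) simp
    moreover have "c \<notin> nbhd E {a, b, x}" using N3 ne rne by blast
    then have "4 \<le> card (nbhd E {a, b, x})"
      using separated_card[of "{a, b, x}" c] inV' ar(3) inV ne rne by simp
    moreover have "card {v, r, r'} \<le> 3" by (simp add: card_insert_if)
    ultimately show False by simp
  qed
qed

text \<open>The graph on the four neighbours has no isolated vertex and is not just two disjoint
  edges, so it contains a path on three vertices. The fourth vertex attaches to an end of it:
  attached to the middle vertex \<open>b\<close>, it would put all neighbours of \<open>b\<close>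
  into the closed neighbourhood of \<open>v\<close>.\<close>

lemma neighbourhood_path:
  assumes "v \<in> V"
  obtains p q r s where "E `` {v} = {p, q, r, s}" "distinct [p, q, r, s]"
    "(p, q) \<in> E" "(q, r) \<in> E" "(r, s) \<in> E"
proof -
  have nb: "\<exists>w. w \<in> E `` {v} \<and> (u, w) \<in> E" if "u \<in> E `` {v}" for u
    using edge_in_triangle[of v u] that by blast
  note result = that
  have goal: thesis if H: "E `` {v} = {a, b, c, d}" "distinct [a, b, c, d]" "(a, b) \<in> E" "(b, c) \<in> E" for a b c d
  proof -
    have "d \<in> E `` {v}" using H by blast
    then obtain w where "w \<in> {a, b, c, d}" "(d, w) \<in> E" using nb H(1) by blast
    then consider "(d, a) \<in> E" | "(d, b) \<in> E" | "(c, d) \<in> E" using sym_iff irrefl by blast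
    then show thesis
    proof cases
      case 1
      then show ?thesis using result[of d a b c] H by auto
    next
      case 2
      have "(v, b) \<in> E" "b \<in> V" using H(1) inV by blast+
      moreover have "E `` {b} = {v, a, c, d}"
        using four_neighbours[of b v a c d] H 2 sym_iff irrefl calculation by auto
      ultimately show ?thesis using neighbour_outside[of v b] H(1) by blast
    next
      case 3
      then show ?thesis using result[of a b c d] H by auto
    qed
  qed
  have "card (E `` {v}) = 4" using degree assms by blast
  then obtain a where a: "a \<in> E `` {v}" by (metis card.empty ex_in_conv zero_neq_numeral)
  then obtain b where b: "b \<in> E `` {v}" "(a, b) \<in> E" using nb by blast
  have ab: "a \<noteq> b" using b irrefl by blast
  have "card (E `` {v} - {a, b}) = 2" using degree[OF assms] a b ab by (simp add: card_Diff_subset)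
  then obtain c d where cd: "E `` {v} - {a, b} = {c, d}" "c \<noteq> d" by (rule card_2_obtain)
  then have Ev: "E `` {v} = {a, b, c, d}" "distinct [a, b, c, d]" using a b ab by auto
  consider "(a, c) \<in> E" | "(a, d) \<in> E" | "(b, c) \<in> E" | "(b, d) \<in> E"
    using no_two_disjoint_triangles[OF Ev b(2)] by blast
  then show thesis
  proof cases
    case 1
    then show ?thesis using goal[of b a c d] Ev b sym_iff by auto
  next
    case 2
    then show ?thesis using goal[of b a d c] Ev b sym_iff by auto
  next
    case 3
    then show ?thesis using goal[of a b c d] Ev b by auto
  next
    case 4
    then show ?thesis using goal[of a b d c] Ev b by auto
  qed
qed

text \<open>Five consecutive vertices of the cyclic order under construction.\<close>

definition window :: "'a \<times> 'a \<times> 'a \<times> 'a \<times> 'a \<Rightarrow> bool" where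
  "window = (\<lambda>(p, q, r, s, t). E `` {r} = {p, q, s, t} \<and> distinct [p, q, r, s, t] \<and>
     (p, q) \<in> E \<and> (q, s) \<in> E \<and> (s, t) \<in> E)"

text \<open>The fourth neighbour \<open>u\<close> of \<open>s\<close> needs a triangle on the edge
  \<open>s u\<close>, with third vertex \<open>q\<close> or \<open>t\<close>. In the case of
  \<open>q\<close>, the set \<open>{q, r, s}\<close> would have only three neighbours, and 3 + 3 < 7
  leaves a vertex separated from it.\<close>

lemma window_step:
  assumes "7 \<le> card V" "window (p, q, r, s, t)"
  shows "\<exists>u. window (q, r, s, t, u)"
proof -
  have W: "E `` {r} = {p, q, s, t}" "distinct [p, q, r, s, t]" "(p, q) \<in> E" "(q, s) \<in> E" "(s, t) \<in> E"
    using assms(2) by (auto simp: window_def)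
  have r: "(r, p) \<in> E" "(r, q) \<in> E" "(r, s) \<in> E" "(r, t) \<in> E" using W by blast+
  have r': "(q, r) \<in> E" "(s, r) \<in> E" "(s, q) \<in> E" "(q, p) \<in> E" using r W sym_iff by blast+
  have V': "s \<in> V" "q \<in> V" "r \<in> V" using r inV by blast+
  obtain u where u: "E `` {s} = {q, r, t, u}" "distinct [q, r, t, u]"
    using obtain_fourth_neighbour[OF V'(1) r'(3) r'(2) W(5)] W(2) by auto
  have su: "(s, u) \<in> E" "u \<noteq> s" using u irrefl by blast+
  have "u \<noteq> p"
  proof
    assume "u = p"
    then have "E `` {s} \<subseteq> insert r (E `` {r})" using u W by auto
    then show False using neighbour_outside[OF r(3)] by blast
  qed
  have nru: "(r, u) \<notin> E" using W(1) u \<open>u \<noteq> p\<close> su by auto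
  obtain w where w: "(s, w) \<in> E" "(u, w) \<in> E" using edge_in_triangle[OF su(1)] by blast
  then have "w \<in> {q, r, t, u}" using u(1) by blast
  moreover have "w \<noteq> u" "w \<noteq> r" using w(2) irrefl nru sym_iff by blast+
  ultimately consider "(u, q) \<in> E" | "(u, t) \<in> E" using w(2) by blast
  then have "(t, u) \<in> E"
  proof cases
    case 1
    then have "(q, u) \<in> E" using sym_iff by blast
    then have Eq: "E `` {q} = {p, r, s, u}"
      using four_neighbours[OF V'(2), of p r s u] r' W \<open>u \<noteq> p\<close> su u by auto
    have N: "nbhd E {q, r, s} \<subseteq> {p, t, u}" using Eq W u by (auto simp: nbhd_def)
    have c3: "card {p, t, u} \<le> 3" by (simp add: card_insert_if)
    have "card (nbhd E {q, r, s}) \<le> 3" using card_mono[OF _ N] c3 by simp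
    moreover have "{q, r, s} \<union> nbhd E {q, r, s} \<noteq> V"
    proof
      assume "{q, r, s} \<union> nbhd E {q, r, s} = V"
      moreover have "card ({q, r, s} \<union> nbhd E {q, r, s}) \<le> card {q, r, s} + card (nbhd E {q, r, s})"
        by (rule card_Un_le)
      moreover have "card {q, r, s} \<le> 3" by (simp add: card_insert_if)
      ultimately show False using assms(1) \<open>card (nbhd E {q, r, s}) \<le> 3\<close> by simp
    qed
    then have "4 \<le> card (nbhd E {q, r, s})" using sep[of "{q, r, s}"] V' by simp
    ultimately show ?thesis by simp
  next
    case 2
    then show ?thesis using sym_iff by blast
  qed
  then have "window (q, r, s, t, u)"
    using W u su r' r \<open>u \<noteq> p\<close> nru by (auto simp: window_def)
  then show ?thesis by blast
qed

text \<open>Dependent choice on overlapping windows: \<open>shift\<close> makes the first four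
  entries of a window the last four of its predecessor, so the sequence \<open>f\<close> of first
  entries recovers whole windows.\<close>

lemma window_sequence:
  assumes "7 \<le> card V"
  obtains f :: "nat \<Rightarrow> 'a" where
    "\<And>i. window (f i, f (i + 1), f (i + 2), f (i + 3), f (i + 4))"
proof -
  obtain v where "v \<in> V" using big by fastforce
  then obtain p q r s where *: "E `` {v} = {p, q, r, s}" "distinct [p, q, r, s]"
    "(p, q) \<in> E" "(q, r) \<in> E" "(r, s) \<in> E" by (rule neighbourhood_path)
  then have w0: "window (p, q, v, r, s)" using irrefl by (auto simp: window_def)
  define shift :: "'a \<times> 'a \<times> 'a \<times> 'a \<times> 'a \<Rightarrow> 'a \<times> 'a \<times> 'a \<times> 'a \<times> 'a \<Rightarrow> bool" where
    "shift x y \<longleftrightarrow> fst y = fst (snd x) \<and> fst (snd y) = fst (snd (snd x)) \<and>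
      fst (snd (snd y)) = fst (snd (snd (snd x))) \<and>
      fst (snd (snd (snd y))) = snd (snd (snd (snd x)))" for x y
  have "\<exists>y. window y \<and> shift x y" if w: "window x" for x
  proof -
    obtain a b c d e where x: "x = (a, b, c, d, e)" by (cases x)
    then obtain u where "window (b, c, d, e, u)" using w window_step[OF assms] by blast
    moreover have "shift x (b, c, d, e, u)" by (simp add: shift_def x)
    ultimately show ?thesis by blast
  qed
  then have "\<exists>g. \<forall>n::nat. window (g n) \<and> shift (g n) (g (Suc n))"
    using dependent_nat_choice[of "\<lambda>_. window" "\<lambda>_. shift"] w0 by metis
  then obtain g where g: "\<And>n::nat. window (g n)" "\<And>n. shift (g n) (g (Suc n))" by metis
  define f where "f n = fst (g n)" for n
  have 1: "f (i + 1) = fst (snd (g i))" for i using g(2)[of i] by (simp add: f_def shift_def)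
  have 2: "f (i + 2) = fst (snd (snd (g i)))" for i
    using 1[of "Suc i"] g(2)[of i] by (simp add: shift_def)
  have 3: "f (i + 3) = fst (snd (snd (snd (g i))))" for i
    using 2[of "Suc i"] g(2)[of i] by (simp add: shift_def eval_nat_numeral)
  have 4: "f (i + 4) = snd (snd (snd (snd (g i))))" for i
    using 3[of "Suc i"] g(2)[of i] by (simp add: shift_def eval_nat_numeral)
  have "g i = (f i, f (i + 1), f (i + 2), f (i + 3), f (i + 4))" for i
    unfolding 1 2 3 4 by (simp add: f_def)
  then show ?thesis using that g(1) by metis
qed

end

section \<open>Cyclic indices, and closing up the sequence of windows\<close>

lemma mod_less_twice: "m < 2 * n \<Longrightarrow> m mod n = (if m < n then m else m - n)" for m n :: nat
  by (auto simp: mod_if)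

text \<open>Backward steps are written \<open>n - 1\<close> and \<open>n - 2\<close> to stay within
  the naturals; this is the shape in which neighbourhoods arise from the cyclic sequence.\<close>

lemma square_adj_iff:
  assumes "5 \<le> n" "i < n" "j < n"
  shows "square_adj n i j \<longleftrightarrow> j \<in> {(i + 1) mod n, (i + 2) mod n, (i + (n - 1)) mod n, (i + (n - 2)) mod n}"
proof -
  have mods: "x = (y + k) mod n \<longleftrightarrow> x = y + k \<or> x + n = y + k" if "x < n" "y < n" "k < n" for x y k
    using that by (auto simp: mod_less_twice)
  have 1: "j = (i + 1) mod n \<longleftrightarrow> j = i + 1 \<or> j + n = i + 1"
    "j = (i + 2) mod n \<longleftrightarrow> j = i + 2 \<or> j + n = i + 2"
    "j = (i + (n - 1)) mod n \<longleftrightarrow> j = i + (n - 1) \<or> j + n = i + (n - 1)"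
    "j = (i + (n - 2)) mod n \<longleftrightarrow> j = i + (n - 2) \<or> j + n = i + (n - 2)"
    "i = (j + 1) mod n \<longleftrightarrow> i = j + 1 \<or> i + n = j + 1"
    "i = (j + 2) mod n \<longleftrightarrow> i = j + 2 \<or> i + n = j + 2"
    by (rule mods; use assms in linarith)+
  have "j = i + (n - 1) \<or> j + n = i + (n - 1) \<longleftrightarrow> i = j + 1 \<or> i + n = j + 1"
    "j = i + (n - 2) \<or> j + n = i + (n - 2) \<longleftrightarrow> i = j + 2 \<or> i + n = j + 2"
    "j = i + 1 \<or> j + n = i + 1 \<or> j = i + 2 \<or> j + n = i + 2 \<or> i = j + 1 \<or> i + n = j + 1 \<or>
      i = j + 2 \<or> i + n = j + 2 \<Longrightarrow> i \<noteq> j"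
    using assms by linarith+
  then show ?thesis unfolding square_adj_def insert_iff 1 by blast
qed

lemma inj_on_add_mod: "a < n \<Longrightarrow> inj_on (\<lambda>k. (a + k) mod n) {..<n}" for a n :: nat
  by (auto simp: inj_on_def mod_less_twice split: if_splits)

text \<open>The steps 1, 2, 4, 5 modulo six omit only the antipode, so this square is the
  octahedron.\<close>

lemma square_adj_six:
  assumes "i < 6" "j < 6"
  shows "square_adj 6 i j \<longleftrightarrow> i \<noteq> j \<and> j \<noteq> (i + 3) mod 6"
proof -
  have "i = 0 \<or> i = 1 \<or> i = 2 \<or> i = 3 \<or> i = 4 \<or> i = 5" "j = 0 \<or> j = 1 \<or> j = 2 \<or> j = 3 \<or> j = 4 \<or> j = 5"
    using assms by linarith+
  then show ?thesis by (elim disjE) (simp_all add: square_adj_def)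
qed

context K33_K25_free
begin

lemma chain_connected:
  assumes "\<And>k. (f (m + 2 * k), f (m + 2 * k + 2)) \<in> E"
  shows "cut_connected E ((\<lambda>k. f (m + 2 * k)) ` {..K::nat})"
proof (induction K)
  case (Suc K)
  have "(\<lambda>k. f (m + 2 * k)) ` {..Suc K} = insert (f (m + 2 * Suc K)) ((\<lambda>k. f (m + 2 * k)) ` {..K})"
    by (simp add: atMost_Suc)
  then show ?case
    using cut_connected_insert[OF sym Suc, of "f (m + 2 * K)" "f (m + 2 * Suc K)"] assms[of K] by auto
qed simp

text \<open>Degree four leaves each vertex exactly one non-neighbour, so \<open>opp\<close> is an
  involution without fixed points. One vertex from each of the three pairs, followed by their
  opposites in the same order, puts non-neighbours three steps apart.\<close>

lemma six_vertices:
  assumes "card V = 6"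
  shows "\<exists>f. bij_betw f {..<6} V \<and> (\<forall>i<6. \<forall>j<6. (f i, f j) \<in> E \<longleftrightarrow> square_adj 6 i j)"
proof -
  have "\<exists>w. V - insert v (E `` {v}) = {w}" if "v \<in> V" for v
  proof -
    have "card (insert v (E `` {v})) = 5" using degree[OF that] irrefl fin_nbhd by simp
    then have "card (V - insert v (E `` {v})) = 1"
      using that assms inV fin_nbhd by (subst card_Diff_subset) auto
    then show ?thesis by (simp add: card_1_singleton_iff)
  qed
  then obtain opp where opp: "V - insert v (E `` {v}) = {opp v}" if "v \<in> V" for v by metis
  have adj: "(x, y) \<in> E \<longleftrightarrow> x \<noteq> y \<and> y \<noteq> opp x" if "x \<in> V" "y \<in> V" for x y
    using opp[OF that(1)] that(2) irrefl by blast
  have oV: "opp x \<in> V" "opp x \<noteq> x" if "x \<in> V" for x using opp[OF that] by blast+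
  have oo: "opp (opp x) = x" if "x \<in> V" for x
    using adj[OF that oV(1)[OF that]] adj[OF oV(1)[OF that] that] oV(2)[OF that] sym_iff by metis
  obtain a where a: "a \<in> V" using big by fastforce
  define A where "A = {a, opp a}"
  have "card A \<le> 2" by (simp add: A_def card_insert_if)
  then have "V - A \<noteq> {}" using assms card_mono[of A V] by (auto simp: A_def)
  then obtain b where b: "b \<in> V" "b \<notin> A" by blast
  define B where "B = {a, opp a, b, opp b}"
  have "card B \<le> 4" by (simp add: B_def card_insert_if)
  then have "V - B \<noteq> {}" using assms card_mono[of B V] by (auto simp: B_def)
  then obtain c where c: "c \<in> V" "c \<notin> B" by blast
  define f where "f = (!) [a, b, c, opp a, opp b, opp c]"
  have d: "distinct [a, b, c, opp a, opp b, opp c]"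
  proof -
    have ne: "b \<noteq> a" "b \<noteq> opp a" "c \<noteq> a" "c \<noteq> opp a" "c \<noteq> b" "c \<noteq> opp b"
      using b c by (simp_all add: A_def B_def)
    have "opp b \<noteq> a" "opp c \<noteq> a" "opp c \<noteq> b" using ne oo[OF b(1)] oo[OF c(1)] by auto
    moreover have "opp a \<noteq> opp b" "opp a \<noteq> opp c" "opp b \<noteq> opp c"
      using ne oo[OF a] oo[OF b(1)] oo[OF c(1)] by metis+
    ultimately show ?thesis using ne oV(2)[OF a] oV(2)[OF b(1)] oV(2)[OF c(1)] by auto
  qed
  have "card (set [a, b, c, opp a, opp b, opp c]) = 6" using distinct_card[OF d] by simp
  moreover have "set [a, b, c, opp a, opp b, opp c] \<subseteq> V" using a b c oV by auto
  ultimately have set: "set [a, b, c, opp a, opp b, opp c] = V"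
    using card_subset_eq[OF fin] assms by metis
  have six: "{..<6} = {..<length [a, b, c, opp a, opp b, opp c]}" by simp
  have bij: "bij_betw f {..<6} V" unfolding f_def six by (rule bij_betw_nth[OF d HOL.refl set[symmetric]])
  have fV: "f i \<in> V" if "i < 6" for i using bij that by (auto simp: bij_betw_def)
  have inj: "f i = f j \<longleftrightarrow> i = j" if "i < 6" "j < 6" for i j
    using bij that by (auto simp: bij_betw_def inj_on_def)
  have opp_f: "opp (f i) = f ((i + 3) mod 6)" if "i < 6" for i
  proof -
    have "i = 0 \<or> i = 1 \<or> i = 2 \<or> i = 3 \<or> i = 4 \<or> i = 5" using that by linarith
    then show ?thesis using oo[OF a] oo[OF b(1)] oo[OF c(1)] by (elim disjE) (simp_all add: f_def)
  qed
  have "(f i, f j) \<in> E \<longleftrightarrow> square_adj 6 i j" if "i < 6" "j < 6" for i j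
    using adj[OF fV[OF that(1)] fV[OF that(2)]] opp_f[OF that(1)] inj that
    by (simp add: square_adj_six)
  then show ?thesis using bij by blast
qed

text \<open>Finiteness gives a first repetition \<open>f k = f n\<close>. Since degree four leaves
  no room for additional neighbours, it can only occur at \<open>k = 0\<close>, and the sequence
  closes up.\<close>

lemma seven_vertices:
  assumes "7 \<le> card V"
  shows "\<exists>n f. 6 \<le> n \<and> even n \<and> bij_betw f {..<n} V \<and>
    (\<forall>i<n. \<forall>j<n. (f i, f j) \<in> E \<longleftrightarrow> square_adj n i j)"
proof -
  obtain f :: "nat \<Rightarrow> 'a" where w: "\<And>i. window (f i, f (i + 1), f (i + 2), f (i + 3), f (i + 4))"
    using window_sequence[OF assms] by blast
  have nb: "E `` {f (i + 2)} = {f i, f (i + 1), f (i + 3), f (i + 4)}"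
    and dist: "distinct [f i, f (i + 1), f (i + 2), f (i + 3), f (i + 4)]"
    and e1: "(f i, f (i + 1)) \<in> E" for i
    using w[of i] by (auto simp: window_def)
  have e2: "(f i, f (i + 2)) \<in> E" for i using nb[of i] sym_iff by blast
  have e1': "(f (i + 1), f i) \<in> E" and e2': "(f (i + 2), f i) \<in> E" for i
    using e1 e2 sym_iff by blast+
  have fV: "f i \<in> V" for i using e1 inV by blast
  have close: "f i \<noteq> f j" if "i < j" "j < i + 5" for i j
  proof -
    have "j = i + 1 \<or> j = i + 2 \<or> j = i + 3 \<or> j = i + 4" using that by arith
    then show ?thesis using dist[of i] by auto
  qed
  have "\<exists>j k. k < j \<and> f k = f j"
  proof (rule ccontr)
    assume "\<not> ?thesis"
    then have "inj f" by (metis injI linorder_neqE_nat)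
    then have "infinite (range f)" using range_inj_infinite by blast
    moreover have "range f \<subseteq> V" using fV by blast
    ultimately show False using fin finite_subset by blast
  qed
  then obtain n where n: "\<exists>k<n. f k = f n" and min: "\<And>j. j < n \<Longrightarrow> \<not> (\<exists>k<j. f k = f j)"
    using exists_least_iff[of "\<lambda>j. \<exists>k<j. f k = f j"] by blast
  obtain k where k: "k < n" "f k = f n" using n by blast
  have inj: "f a = f b \<longleftrightarrow> a = b" if "a < n" "b < n" for a b
    using min that by (metis linorder_neqE_nat)
  have kn: "k + 5 \<le> n" using close[of k n] k by (metis not_less)
  have n1: "(f n, f (n - 1)) \<in> E" "(f n, f (n - 2)) \<in> E"
    using e1'[of "n - 1"] e2'[of "n - 2"] kn by (auto simp: numeral_2_eq_2 Suc_diff_Suc)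
  \<comment> \<open>For \<open>2 \<le> k\<close> the four neighbours of \<open>f k\<close> have
    indices between \<open>k - 2\<close> and \<open>k + 2\<close>, so it cannot also see
    \<open>f (n - 1)\<close>; for \<open>k = 1\<close> the surplus neighbour is
    \<open>f 0\<close>.\<close>
  have k0: "k = 0"
  proof (rule ccontr)
    assume "k \<noteq> 0"
    then consider "k = 1" | "2 \<le> k" by linarith
    then show False
    proof cases
      case 1
      have "E `` {f 1} = {f 2, f 3, f (n - 1), f (n - 2)}"
        by (rule four_neighbours[OF fV])
          (use e1[of 1] e2[of 1] n1 k 1 kn inj in \<open>auto simp: numeral_eq_Suc\<close>)
      then have "f 0 \<in> {f 2, f 3, f (n - 1), f (n - 2)}" using e1'[of 0] by auto
      then show False using inj kn 1 by auto
    next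
      case 2
      have "k - 2 + 2 = k" using 2 by simp
      then have "f (n - 1) \<in> E `` {f (k - 2 + 2)}" using n1(1) k(2) by simp
      then have "f (n - 1) \<in> {f (k - 2), f (k - 2 + 1), f (k - 2 + 3), f (k - 2 + 4)}"
        unfolding nb .
      then show False using inj kn 2 by auto
    qed
  qed
  have fn: "f n = f 0" using k k0 by simp
  have E0: "E `` {f 0} = {f 1, f 2, f (n - 1), f (n - 2)}"
    by (rule four_neighbours[OF fV])
      (use e1[of 0] e2[of 0] n1 fn kn inj in \<open>auto simp: numeral_eq_Suc\<close>)
  have E2: "E `` {f 2} = {f 0, f 1, f 3, f 4}" using nb[of 0] by (simp add: numeral_eq_Suc)
  have E3: "E `` {f 3} = {f 1, f 2, f 4, f 5}" using nb[of 1] by (simp add: numeral_eq_Suc)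
  \<comment> \<open>With period five, \<open>{f 0, f 2, f 3}\<close> would have just the two
    neighbours \<open>f 1\<close> and \<open>f 4\<close>, although there are at least seven
    vertices.\<close>
  have "n \<noteq> 5"
  proof
    assume "n = 5"
    then have "nbhd E {f 0, f 2, f 3} \<subseteq> {f 1, f 4}"
      using E0 E2 E3 fn by (auto simp: nbhd_def)
    then have c: "card (nbhd E {f 0, f 2, f 3}) \<le> card {f 1, f 4}" by (rule card_mono[rotated]) simp
    also have "\<dots> \<le> 2" by (simp add: card_insert_if)
    finally have c: "card (nbhd E {f 0, f 2, f 3}) \<le> 2" .
    have "card ({f 0, f 2, f 3} \<union> nbhd E {f 0, f 2, f 3}) \<le> card {f 0, f 2, f 3} + card (nbhd E {f 0, f 2, f 3})"
      by (rule card_Un_le)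
    moreover have "card {f 0, f 2, f 3} \<le> 3" by (simp add: card_insert_if)
    ultimately have "{f 0, f 2, f 3} \<union> nbhd E {f 0, f 2, f 3} \<noteq> V" using assms c by auto
    then show False using sep[of "{f 0, f 2, f 3}"] fV c by auto
  qed
  then have n6: "6 \<le> n" using kn k0 by simp
  \<comment> \<open>The edge of length two from \<open>n - 1\<close> ends at index
    \<open>n + 1\<close>, so periodicity is needed one step beyond \<open>n\<close>.\<close>
  have fn1: "f (n + 1) = f 1"
  proof -
    have "f (n + 1) \<in> E `` {f 0}" using e1[of n] fn by simp
    moreover have "f (n - 1) \<noteq> f (n + 1)" "f (n - 2) \<noteq> f (n + 1)"
      by (rule close; use n6 in linarith)+
    moreover have "f (n + 1) \<noteq> f 2"
    proof
      assume "f (n + 1) = f 2"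
      then have "f (n - 1) \<in> E `` {f 2}" using e2'[of "n - 1"] n6 by simp
      then show False unfolding E2 using inj n6 by auto
    qed
    ultimately show ?thesis unfolding E0 by (metis empty_iff insert_iff)
  qed
  have per: "f m = f (m mod n)" if m: "m < n + 2" for m
  proof -
    consider "m < n" | "m = n" | "m = n + 1" using m by linarith
    then show ?thesis using fn fn1 n6 by cases (auto simp: mod_less_twice)
  qed
  have nbs: "E `` {f a} = f ` {(a + 1) mod n, (a + 2) mod n, (a + (n - 1)) mod n, (a + (n - 2)) mod n}"
    (is "_ = f ` ?S") if a: "a < n" for a
  proof (rule card_subset_eq[OF fin_nbhd(2), symmetric])
    have "f ((a + 1) mod n) \<in> E `` {f a}" using per[of "a + 1"] e1[of a] a by simp
    moreover have "f ((a + 2) mod n) \<in> E `` {f a}" using per[of "a + 2"] e2[of a] a by simp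
    moreover have "f ((a + (n - 1)) mod n) \<in> E `` {f a}"
    proof (cases "a = 0")
      case True then show ?thesis using E0 n6 by auto
    next
      case False
      then have "(a + (n - 1)) mod n = a - 1" using a n6 by (auto simp: mod_less_twice)
      then show ?thesis using e1'[of "a - 1"] False by simp
    qed
    moreover have "f ((a + (n - 2)) mod n) \<in> E `` {f a}"
    proof -
      consider "a = 0" | "a = 1" | "2 \<le> a" by linarith
      then show ?thesis
      proof cases
        case 1 then show ?thesis using E0 n6 by auto
      next
        case 2
        then have "(a + (n - 2)) mod n = n - 1" using n6 by (auto simp: mod_less_twice)
        moreover have "n - 1 + 2 = n + 1" using n6 by simp
        ultimately show ?thesis using e2'[of "n - 1"] fn1 2 by (metis Image_singleton_iff)
      next
        case 3
        then have "(a + (n - 2)) mod n = a - 2" using a n6 by (auto simp: mod_less_twice)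
        moreover have "a - 2 + 2 = a" using 3 by simp
        ultimately show ?thesis using e2'[of "a - 2"] by (metis Image_singleton_iff)
      qed
    qed
    ultimately show "f ` ?S \<subseteq> E `` {f a}" by simp
    have "inj_on f ?S"
    proof (rule inj_onI)
      fix x y assume "x \<in> ?S" "y \<in> ?S" "f x = f y"
      moreover have "x < n" "y < n" using calculation n6 by auto
      ultimately show "x = y" using inj by blast
    qed
    then have "card (f ` ?S) = card ?S" by (rule card_image)
    also have "?S = (\<lambda>k. (a + k) mod n) ` {1, 2, n - 1, n - 2}" by simp
    also have "card \<dots> = card {1, 2, n - 1, n - 2}"
      using n6 by (intro card_image inj_on_subset[OF inj_on_add_mod[OF a]]) auto
    also have "\<dots> = 4"
    proof -
      have "1 \<noteq> n - 1" "1 \<noteq> n - 2" "2 \<noteq> n - 1" "2 \<noteq> n - 2" "n - 1 \<noteq> n - 2"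
        using n6 by linarith+
      then show ?thesis by simp
    qed
    finally show "card (f ` ?S) = card (E `` {f a})" using degree[OF fV] by simp
  qed
  have adj: "(f i, f j) \<in> E \<longleftrightarrow> square_adj n i j" if "i < n" "j < n" for i j
  proof -
    have "(f i, f j) \<in> E \<longleftrightarrow> f j \<in> E `` {f i}" by simp
    also have "\<dots> \<longleftrightarrow> j \<in> {(i + 1) mod n, (i + 2) mod n, (i + (n - 1)) mod n, (i + (n - 2)) mod n}"
      unfolding nbs[OF that(1)] using inj that n6 by auto
    finally show ?thesis using square_adj_iff[of n i j] that n6 by simp
  qed
  define R where "R = f ` {..<n}"
  \<comment> \<open>No edge leaves the vertices of the closed sequence, so 4-connectedness makes
    them all of \<open>V\<close>.\<close>
  have "nbhd E R = {}"
  proof -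
    have "E `` {f a} \<subseteq> R" if "a < n" for a
      unfolding nbs[OF that] using n6 by (auto simp: R_def)
    then show ?thesis by (auto simp: nbhd_def R_def)
  qed
  moreover have "R \<subseteq> V" "f 0 \<in> R" using fV n6 by (auto simp: R_def)
  ultimately have RV: "R = V" using sep[of R] by auto
  have bij: "bij_betw f {..<n} V"
    using RV inj by (auto simp: bij_betw_def inj_on_def R_def)
  then have cn: "card V = n" using bij_betw_same_card by fastforce
  have "even n"
  proof (rule ccontr)
    assume "odd n"
    then obtain q where q: "n = 2 * q + 1" by (rule oddE)
    then have q3: "3 \<le> q" using cn assms by linarith
    \<comment> \<open>For odd \<open>n\<close> the steps by 2 starting at \<open>f 5\<close> end next to \<open>f 0\<close>, those starting at \<open>f 6\<close> next to
      \<open>f 1\<close>. These two paths, the second extended by \<open>f 1\<close>, and \<open>f 2\<close> are the hubs of a \<open>K\<^bsub>3,3\<^esub>\<close>.\<close>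
    define A where "A = (\<lambda>k. f (5 + 2 * k)) ` {..q - 3}"
    define B where "B = (\<lambda>k. f (6 + 2 * k)) ` {..q - 3}"
    have step: "(f (m + 2 * k), f (m + 2 * k + 2)) \<in> E" for m k using e2 by blast
    have cA: "cut_connected E A" unfolding A_def by (rule chain_connected) (rule step)
    have cB: "cut_connected E B" unfolding B_def by (rule chain_connected) (rule step)
    have last: "5 + 2 * (q - 3) + 2 = n" "6 + 2 * (q - 3) + 2 = n + 1" using q q3 by auto
    have lastB: "f (6 + 2 * (q - 3)) \<in> B" "(f (6 + 2 * (q - 3)), f 1) \<in> E"
      using e2[of "6 + 2 * (q - 3)"] last fn1 by (auto simp: B_def)
    have cB1: "cut_connected E (insert (f 1) B)" by (rule cut_connected_insert[OF sym cB lastB])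
    have idxA: "\<exists>i. x = f i \<and> 5 \<le> i \<and> i < n \<and> odd i" if "x \<in> A" for x
      using that last by (fastforce simp: A_def)
    have idxB: "\<exists>i. x = f i \<and> 6 \<le> i \<and> i < n \<and> even i" if "x \<in> B" for x
      using that last by (fastforce simp: B_def)
    have f5: "f 5 \<in> A" "f 6 \<in> B" by (force simp: A_def B_def)+
    have notA: "f i \<notin> A" if "i < 5" for i using idxA inj that n6 by fastforce
    have notB: "f i \<notin> B" if "i < 6" for i using idxB inj that n6 by fastforce
    have "card {f 0, f 3, f 4} \<le> 2"
    proof (rule common_nbhd_le_2[OF cut_connected_singleton[of E "f 2"] cA cB1])
      show "{f 2} \<inter> A = {}" using notA[of 2] by simp
      show "{f 2} \<inter> insert (f 1) B = {}" using notB[of 2] inj n6 by simp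
      show "A \<inter> insert (f 1) B = {}"
      proof -
        have "A \<inter> B = {}" using idxA idxB inj by (metis disjoint_iff)
        then show ?thesis using notA[of 1] by simp
      qed
      show "{f 0, f 3, f 4} \<subseteq> nbhd E {f 2}" unfolding nbhd_single E2 by simp
      have "(f (5 + 2 * (q - 3)), f 0) \<in> E" using e2[of "5 + 2 * (q - 3)"] last fn by simp
      moreover have "f (5 + 2 * (q - 3)) \<in> A" by (simp add: A_def)
      moreover have "(f 5, f 3) \<in> E" "(f 5, f 4) \<in> E"
        using e2'[of 3] e1'[of 4] by simp_all
      ultimately show "{f 0, f 3, f 4} \<subseteq> nbhd E A"
        using f5 notA[of 0] notA[of 3] notA[of 4] by (auto simp: nbhd_def)
      have "(f 1, f 0) \<in> E" "(f 1, f 3) \<in> E" "(f 6, f 4) \<in> E"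
        using e1'[of 0] e2[of 1] e2'[of 4] by (simp_all add: numeral_eq_Suc)
      then show "{f 0, f 3, f 4} \<subseteq> nbhd E (insert (f 1) B)"
        using f5 notB[of 0] notB[of 3] notB[of 4] inj n6 by (auto simp: nbhd_def)
    qed
    moreover have "card {f 0, f 3, f 4} = 3" using inj n6 by simp
    ultimately show False by simp
  qed
  then show ?thesis using n6 bij adj by blast
qed

lemma is_cycle_square:
  "\<exists>n f. 6 \<le> n \<and> even n \<and> bij_betw f {..<n} V \<and>
    (\<forall>i<n. \<forall>j<n. (f i, f j) \<in> E \<longleftrightarrow> square_adj n i j)"
proof (cases "card V = 6")
  case True
  then obtain f where "bij_betw f {..<6} V" "\<forall>i<6. \<forall>j<6. (f i, f j) \<in> E \<longleftrightarrow> square_adj 6 i j"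
    using six_vertices by blast
  then show ?thesis by (intro exI[of _ 6] exI[of _ f]) simp
next
  case False
  then show ?thesis using seven_vertices big by simp
qed

end

section \<open>Theta curves and plane drawings\<close>

text \<open>The unqualified name \<open>connected\<close> refers to connected digraphs here.\<close>

abbreviation top_connected :: "'a::topological_space set \<Rightarrow> bool" where
  "top_connected \<equiv> Topological_Spaces.connected"

definition arc_between :: "(real \<Rightarrow> complex) \<Rightarrow> complex \<Rightarrow> complex \<Rightarrow> bool" where
  "arc_between c a b \<longleftrightarrow> arc c \<and> pathstart c = a \<and> pathfinish c = b"

lemma arc_between_simple_path: "arc_between c a b \<Longrightarrow> simple_path c"
  by (simp add: arc_between_def arc_imp_simple_path)

lemma arc_between_ends: "arc_between c a b \<Longrightarrow> a \<in> path_image c \<and> b \<in> path_image c \<and> a \<noteq> b"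
  by (metis arc_between_def arc_distinct_ends pathfinish_in_path_image pathstart_in_path_image)

lemma arc_between_open_arc:
  assumes "arc_between c a b"
  shows "top_connected (path_image c - {a, b})" "path_image c - {a, b} \<noteq> {}"
proof -
  have "{a, b} = {pathstart c, pathfinish c}" using assms by (simp add: arc_between_def)
  then show "top_connected (path_image c - {a, b})" "path_image c - {a, b} \<noteq> {}"
    using connected_simple_path_endless[OF arc_between_simple_path[OF assms]]
      nonempty_simple_path_endless[OF arc_between_simple_path[OF assms]] by metis+
qed

lemma arc_between_closed: "arc_between c a b \<Longrightarrow> closed (path_image c)"
  by (simp add: arc_between_def closed_arc_image)

lemma arc_between_rev: "arc_between c a b \<Longrightarrow> arc_between (reversepath c) b a"
  by (simp add: arc_between_def arc_reversepath)

lemma Jordan_arcs: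
  assumes "arc_between c d1 d2" "arc_between e d1 d2" "path_image c \<inter> path_image e = {d1, d2}"
  defines "J \<equiv> path_image c \<union> path_image e"
  shows "open (inside J)" "open (outside J)" "\<not> bounded (outside J)" "inside J \<noteq> {}"
    "frontier (inside J) = J" "frontier (outside J) = J" "top_connected (outside J)"
proof -
  have s: "simple_path (c +++ reversepath e)"
    using assms(1-3) simple_path_join_loop_eq[of "reversepath e" c]
    by (simp add: arc_between_def arc_reversepath)
  have "path_image (c +++ reversepath e) = J"
    using assms(1,2) by (simp add: arc_between_def path_image_join J_def)
  moreover have "pathfinish (c +++ reversepath e) = pathstart (c +++ reversepath e)"
    using assms(1,2) by (simp add: arc_between_def)
  ultimately show "open (inside J)" "open (outside J)" "\<not> bounded (outside J)" "inside J \<noteq> {}"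
    "frontier (inside J) = J" "frontier (outside J) = J" "top_connected (outside J)"
    using Jordan_inside_outside[OF s] by simp_all
qed

lemma connected_in_side:
  assumes "top_connected S" "open (inside J)" "open (outside J)" "S \<inter> J = {}"
  shows "S \<subseteq> inside J \<or> S \<subseteq> outside J"
proof -
  have "S \<subseteq> inside J \<union> outside J" using assms(4) by auto
  moreover have "inside J \<inter> outside J \<inter> S = {}" by simp
  ultimately have "inside J \<inter> S = {} \<or> outside J \<inter> S = {}"
    using connectedD[OF assms(1-3)] by blast
  then show ?thesis using \<open>S \<subseteq> inside J \<union> outside J\<close> by blast
qed

locale theta =
  fixes c1 c2 c3 :: "real \<Rightarrow> complex" and a b :: complex
  assumes arcs: "arc_between c1 a b" "arc_between c2 a b" "arc_between c3 a b"
    and int12: "path_image c1 \<inter> path_image c2 = {a, b}"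
    and int13: "path_image c1 \<inter> path_image c3 = {a, b}"
    and int23: "path_image c2 \<inter> path_image c3 = {a, b}"
begin

text \<open>The third arc splits the inside of the closed curve into two insides. A connected set
  avoiding it lies in one of them, whose frontier contains no inner point of the opposite
  arc.\<close>

lemma inside_case:
  assumes c3: "path_image c3 - {a, b} \<subseteq> inside (path_image c1 \<union> path_image c2)"
    and S: "top_connected S" "S \<subseteq> inside (path_image c1 \<union> path_image c2)" "S \<inter> path_image c3 = {}"
    and x1: "x1 \<in> closure S" "x1 \<in> path_image c1" "x1 \<notin> {a, b}"
    and x2: "x2 \<in> closure S" "x2 \<in> path_image c2" "x2 \<notin> {a, b}"
  shows False
proof -
  let ?P1 = "path_image c1" and ?P2 = "path_image c2" and ?P3 = "path_image c3"
  have s: "simple_path c1" "pathstart c1 = a" "pathfinish c1 = b"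
    "simple_path c2" "pathstart c2 = a" "pathfinish c2 = b"
    "simple_path c3" "pathstart c3 = a" "pathfinish c3 = b" "a \<noteq> b"
    using arcs[THEN arc_between_simple_path] arcs(1)[THEN arc_between_ends] arcs
    by (simp_all add: arc_between_def)
  have "?P3 \<inter> inside (?P1 \<union> ?P2) \<noteq> {}"
    using arc_between_open_arc(2)[OF arcs(3)] c3 by blast
  then have disj: "inside (?P1 \<union> ?P3) \<inter> inside (?P2 \<union> ?P3) = {}"
    and un: "inside (?P1 \<union> ?P3) \<union> inside (?P2 \<union> ?P3) \<union> (?P3 - {a, b}) = inside (?P1 \<union> ?P2)"
    using split_inside_simple_closed_curve[OF s int12 int13 int23] by metis+
  note J13 = Jordan_arcs[OF arcs(1) arcs(3) int13]
  note J23 = Jordan_arcs[OF arcs(2) arcs(3) int23]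
  have "S \<subseteq> inside (?P1 \<union> ?P3) \<union> inside (?P2 \<union> ?P3)" using un S by blast
  then consider "S \<subseteq> inside (?P1 \<union> ?P3)" | "S \<subseteq> inside (?P2 \<union> ?P3)"
    using connectedD[OF S(1) J13(1) J23(1)] disj by blast
  then show False
  proof cases
    case 1
    then have "x2 \<in> closure (inside (?P1 \<union> ?P3))" using x2(1) closure_mono by blast
    then have "x2 \<in> inside (?P1 \<union> ?P3) \<union> (?P1 \<union> ?P3)"
      using J13(5) by (simp add: closure_Un_frontier)
    moreover have "x2 \<notin> ?P1 \<union> ?P3" using x2 int12 int23 by blast
    ultimately have "x2 \<in> inside (?P1 \<union> ?P2)" using un by blast
    then show False using x2(2) inside_no_overlap[of "?P1 \<union> ?P2"] by blast
  next
    case 2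
    then have "x1 \<in> closure (inside (?P2 \<union> ?P3))" using x1(1) closure_mono by blast
    then have "x1 \<in> inside (?P2 \<union> ?P3) \<union> (?P2 \<union> ?P3)"
      using J23(5) by (simp add: closure_Un_frontier)
    moreover have "x1 \<notin> ?P2 \<union> ?P3" using x1 int12 int13 by blast
    ultimately have "x1 \<in> inside (?P1 \<union> ?P2)" using un by blast
    then show False using x1(2) inside_no_overlap[of "?P1 \<union> ?P2"] by blast
  qed
qed

text \<open>Inversion at a point inside the closed curve turns its outside into an inside.\<close>

lemma outside_case:
  assumes c3: "path_image c3 - {a, b} \<subseteq> outside (path_image c1 \<union> path_image c2)"
    and S: "top_connected S" "S \<subseteq> outside (path_image c1 \<union> path_image c2)" "S \<inter> path_image c3 = {}"
    and x1: "x1 \<in> closure S" "x1 \<in> path_image c1" "x1 \<notin> {a, b}"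
    and x2: "x2 \<in> closure S" "x2 \<in> path_image c2" "x2 \<notin> {a, b}"
  shows False
proof -
  define J where "J = path_image c1 \<union> path_image c2"
  note J12 = Jordan_arcs[OF arcs(1,2) int12, folded J_def]
  obtain w where w: "w \<in> inside J" using J12(4) by blast
  define f where "f z = inverse (z - w)" for z
  define g where "g u = w + inverse u" for u
  have gf: "g (f z) = z" for z by (simp add: f_def g_def)
  have fg: "f (g u) = u" for u by (simp add: f_def g_def)
  have injf: "inj_on f A" for A by (metis gf inj_onI)
  have wJ: "w \<notin> J" "w \<notin> outside J"
    using w inside_no_overlap[of J] inside_Int_outside[of J] by blast+
  have wc: "w \<notin> path_image c1" "w \<notin> path_image c2" "w \<notin> path_image c3"
    using wJ c3 arc_between_ends[OF arcs(1)] by (auto simp: J_def)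
  have contf: "continuous_on A f" if "w \<notin> A" for A
    unfolding f_def using that by (auto intro!: continuous_intros)
  have arcf: "arc_between (f \<circ> c) (f a) (f b)" if "arc_between c a b" "w \<notin> path_image c" for c
  proof -
    have "simple_path (f \<circ> c)"
      using simple_path_continuous_image[of c f] arc_between_simple_path[OF that(1)] contf[OF that(2)] injf
      by blast
    moreover have "f a \<noteq> f b" using arc_between_ends[OF that(1)] by (metis gf)
    ultimately show ?thesis
      using that(1) by (auto simp: arc_between_def pathstart_compose pathfinish_compose arc_simple_path)
  qed
  have imf: "path_image (f \<circ> c) = f ` path_image c" for c by (rule path_image_compose)
  \<comment> \<open>If \<open>f z\<close> were outside the image of \<open>J\<close>, it would be
    joined there to points of very large modulus. The map \<open>g\<close> takes those close to
    \<open>w\<close>, which is inside \<open>J\<close>, although \<open>z\<close> is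
    outside.\<close>
  have out_in: "f z \<in> inside (f ` J)" if z: "z \<in> outside J" for z
  proof (rule ccontr)
    assume "f z \<notin> inside (f ` J)"
    moreover have "f z \<notin> f ` J"
    proof
      assume "f z \<in> f ` J"
      then have "z \<in> J" by (metis gf imageE)
      then show False using z outside_no_overlap[of J] by blast
    qed
    ultimately have fz: "f z \<in> outside (f ` J)" using inside_Un_outside[of "f ` J"] by blast
    have th: "arc_between (f \<circ> c1) (f a) (f b)" "arc_between (f \<circ> c2) (f a) (f b)"
      "path_image (f \<circ> c1) \<inter> path_image (f \<circ> c2) = {f a, f b}"
      using arcf arcs wc int12 injf[of UNIV] by (auto simp: imf image_Int[symmetric])
    have fJ: "f ` J = path_image (f \<circ> c1) \<union> path_image (f \<circ> c2)"
      by (simp add: J_def imf image_Un)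
    note Jf = Jordan_arcs[OF th, folded fJ]
    \<comment> \<open>Under the inversion 0 corresponds to infinity and is the only point at which
      \<open>g\<close> fails to be continuous; deleting it keeps the open outside connected.\<close>
    define Q where "Q = outside (f ` J) - {0}"
    have "top_connected Q" unfolding Q_def by (rule connected_open_delete[OF Jf(2,7)]) simp
    moreover have "continuous_on Q g" unfolding g_def Q_def by (auto intro!: continuous_intros)
    ultimately have cg: "top_connected (g ` Q)" by (rule connected_continuous_image[rotated])
    have "g ` Q \<inter> J = {}"
    proof -
      have "u \<in> f ` J" if "g u \<in> J" for u using that fg by (metis imageI)
      moreover have "u \<notin> f ` J" if "u \<in> Q" for u
        using that outside_no_overlap[of "f ` J"] unfolding Q_def by blast
      ultimately show ?thesis by blast
    qed
    moreover have "z \<in> g ` Q"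
    proof -
      have "z \<noteq> w" using z wJ by blast
      then have "f z \<in> Q" using fz by (simp add: Q_def f_def)
      then show ?thesis by (metis gf imageI)
    qed
    ultimately have gQ: "g ` Q \<subseteq> outside J"
      using connected_in_side[OF cg J12(1,2)] z inside_Int_outside[of J] by blast
    obtain e where e: "e > 0" "ball w e \<subseteq> inside J" using J12(1) w openE by blast
    obtain u where u: "u \<in> outside (f ` J)" "norm u > inverse e"
      using Jf(3) by (meson bounded_iff not_le)
    then have "u \<noteq> 0" using e by auto
    then have "norm (inverse u) < e" using u(2) e(1)
      by (metis inverse_inverse_eq inverse_less_iff_less norm_inverse positive_imp_inverse_positive zero_less_norm_iff)
    then have "g u \<in> inside J" using e(2) by (auto simp: g_def dist_norm)
    moreover have "g u \<in> outside J" using gQ u \<open>u \<noteq> 0\<close> by (auto simp: Q_def)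
    ultimately show False using inside_Int_outside[of J] by blast
  qed
  interpret F: theta "f \<circ> c1" "f \<circ> c2" "f \<circ> c3" "f a" "f b"
  proof
    show "arc_between (f \<circ> c1) (f a) (f b)" "arc_between (f \<circ> c2) (f a) (f b)"
      "arc_between (f \<circ> c3) (f a) (f b)" using arcf arcs wc by auto
    show "path_image (f \<circ> c1) \<inter> path_image (f \<circ> c2) = {f a, f b}"
      "path_image (f \<circ> c1) \<inter> path_image (f \<circ> c3) = {f a, f b}"
      "path_image (f \<circ> c2) \<inter> path_image (f \<circ> c3) = {f a, f b}"
      using int12 int13 int23 by (auto simp: imf image_Int[OF injf, symmetric])
  qed
  have fJ: "f ` J = path_image (f \<circ> c1) \<union> path_image (f \<circ> c2)"
    by (simp add: J_def imf image_Un)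
  have eqf: "f x = f y \<longleftrightarrow> x = y" for x y by (metis gf)
  \<comment> \<open>The closure of \<open>S\<close> stays within the outside of \<open>J\<close> and
    \<open>J\<close> itself, hence misses \<open>w\<close>; so \<open>f\<close> is continuous there
    and preserves accumulation.\<close>
  have cl: "f x \<in> closure (f ` S)" if "x \<in> closure S" for x
  proof -
    have "closure S \<subseteq> closure (outside J)" using S(2) closure_mono by (auto simp: J_def)
    also have "\<dots> = outside J \<union> J" using J12(6) by (simp add: closure_Un_frontier)
    finally have "w \<notin> closure S" using wJ by blast
    then have "f ` closure S \<subseteq> closure (f ` S)"
      by (intro image_closure_subset[OF contf closed_closure closure_subset])
    then show ?thesis using that by blast
  qed
  show False
  proof (rule F.inside_case[of "f ` S" "f x1" "f x2"])
    show "path_image (f \<circ> c3) - {f a, f b} \<subseteq> inside (path_image (f \<circ> c1) \<union> path_image (f \<circ> c2))"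
    proof -
      have "f ` path_image c3 - {f a, f b} \<subseteq> f ` (path_image c3 - {a, b})" by blast
      also have "f ` (path_image c3 - {a, b}) \<subseteq> inside (f ` J)"
        by (rule image_subsetI, rule out_in) (use c3[folded J_def] in blast)
      finally show ?thesis unfolding fJ[symmetric] unfolding imf .
    qed
    show "f ` S \<subseteq> inside (path_image (f \<circ> c1) \<union> path_image (f \<circ> c2))"
      unfolding fJ[symmetric]
      by (rule image_subsetI, rule out_in) (use S(2)[folded J_def] in blast)
    show "top_connected (f ` S)"
      using S(1) S(2)[folded J_def] wJ(2) by (intro connected_continuous_image contf) blast+
    show "f ` S \<inter> path_image (f \<circ> c3) = {}" using S(3) eqf by (auto simp: imf)
  qed (use x1 x2 cl eqf in \<open>auto simp: imf\<close>)
qed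

text \<open>The two preceding cases exclude each common side, so the closed curve separates
  \<open>S\<close> from the third arc. Both the K33 and the K5 argument rest on this.\<close>

lemma other_side:
  assumes S: "top_connected S" "S \<inter> (path_image c1 \<union> path_image c2 \<union> path_image c3) = {}"
    and x1: "x1 \<in> closure S" "x1 \<in> path_image c1" "x1 \<notin> {a, b}"
    and x2: "x2 \<in> closure S" "x2 \<in> path_image c2" "x2 \<notin> {a, b}"
  shows "S \<subseteq> inside (path_image c1 \<union> path_image c2) \<and>
      path_image c3 - {a, b} \<subseteq> outside (path_image c1 \<union> path_image c2) \<or>
    S \<subseteq> outside (path_image c1 \<union> path_image c2) \<and>
      path_image c3 - {a, b} \<subseteq> inside (path_image c1 \<union> path_image c2)"
proof -
  let ?J = "path_image c1 \<union> path_image c2"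
  note J12 = Jordan_arcs[OF arcs(1,2) int12]
  have 1: "S \<subseteq> inside ?J \<or> S \<subseteq> outside ?J"
    by (rule connected_in_side[OF S(1) J12(1,2)]) (use S(2) in auto)
  have 2: "path_image c3 - {a, b} \<subseteq> inside ?J \<or> path_image c3 - {a, b} \<subseteq> outside ?J"
    by (rule connected_in_side[OF arc_between_open_arc(1)[OF arcs(3)] J12(1,2)])
      (use int13 int23 in auto)
  show ?thesis using 1 2 inside_case[OF _ S(1) _ _ x1 x2] outside_case[OF _ S(1) _ _ x1 x2] S(2)
    by blast
qed

text \<open>\<open>x3\<close> lies in the open side opposite to \<open>S\<close>, where
  \<open>S\<close> cannot accumulate.\<close>

lemma not_all_three:
  assumes S: "top_connected S" "S \<inter> (path_image c1 \<union> path_image c2 \<union> path_image c3) = {}"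
    and x1: "x1 \<in> closure S" "x1 \<in> path_image c1" "x1 \<notin> {a, b}"
    and x2: "x2 \<in> closure S" "x2 \<in> path_image c2" "x2 \<notin> {a, b}"
    and x3: "x3 \<in> closure S" "x3 \<in> path_image c3" "x3 \<notin> {a, b}"
  shows False
proof -
  let ?J = "path_image c1 \<union> path_image c2"
  note J12 = Jordan_arcs[OF arcs(1,2) int12]
  have "S \<inter> D \<noteq> {}" if "open D" "x3 \<in> D" for D
    using open_Int_closure_eq_empty[OF that(1), of S] that(2) x3(1) by blast
  then have "x3 \<in> inside ?J \<Longrightarrow> S \<inter> inside ?J \<noteq> {}" "x3 \<in> outside ?J \<Longrightarrow> S \<inter> outside ?J \<noteq> {}"
    using J12(1,2) by blast+
  then show False
    using other_side[OF S x1 x2] x3(2,3) inside_Int_outside[of ?J] by blast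
qed

end

text \<open>The parameters of hits form a closed set and have a least element. The half-open segment
  before it is connected and avoids \<open>P\<close>, while the hit point is in its closure.\<close>

lemma obtain_first_hit:
  fixes q :: "real \<Rightarrow> complex"
  assumes "path q" "closed P" "pathstart q \<notin> P" "pathfinish q \<in> P"
  obtains S x where "top_connected S" "pathstart q \<in> S" "S \<subseteq> path_image q - P"
    "x \<in> closure S" "x \<in> P" "x \<in> path_image q"
proof -
  define K where "K = {0..1} \<inter> q -` P"
  have contq: "continuous_on {0..1} q" using assms(1) by (simp add: path_def)
  have "closed K" unfolding K_def using contq assms(2)
    by (simp add: continuous_closed_preimage)
  moreover have "1 \<in> K" using assms(4) by (simp add: K_def pathfinish_def)
  moreover have bdd: "bdd_below K" by (auto simp: K_def bdd_below_def)
  ultimately have t: "Inf K \<in> K" by (intro closed_contains_Inf) auto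
  define t where "t = Inf K"
  have tK: "t \<in> {0..1}" "q t \<in> P" using t by (auto simp: t_def K_def)
  then have "t \<noteq> 0" using assms(3) by (auto simp: pathstart_def)
  then have t0: "0 < t" using tK by simp
  have less: "s \<notin> K" if "s < t" for s using that cInf_lower[OF _ bdd, of s] by (auto simp: t_def)
  define S where "S = q ` {0..<t}"
  have sub: "{0..<t} \<subseteq> {0..1}" "{0..t} \<subseteq> {0..1}" using tK by auto
  have c: "top_connected S" unfolding S_def
    by (rule connected_continuous_image[OF continuous_on_subset[OF contq sub(1)]]) simp
  have "q ` closure {0..<t} \<subseteq> closure S" unfolding S_def
    by (rule image_closure_subset)
      (use t0 continuous_on_subset[OF contq sub(2)] in \<open>auto intro: closure_subset[THEN subsetD]\<close>)
  then have "q t \<in> closure S" using t0 by auto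
  moreover have "pathstart q \<in> S" using t0 by (auto simp: S_def pathstart_def)
  moreover have "S \<subseteq> path_image q - P"
    using less sub(1) by (auto simp: S_def path_image_def K_def)
  moreover have "q t \<in> path_image q" using tK by (simp add: path_image_def)
  ultimately show ?thesis using that c tK(2) by blast
qed

section \<open>Bags and spokes in a plane drawing\<close>

locale drawn_graph = pair_graph G for G :: "'a pair_pre_digraph" +
  fixes p :: "'a \<Rightarrow> complex" and \<gamma> :: "'a set \<Rightarrow> real \<Rightarrow> complex"
  assumes drawing: "plane_drawing G p \<gamma>"
begin

abbreviation curve :: "'a \<Rightarrow> 'a \<Rightarrow> complex set" where
  "curve u v \<equiv> path_image (\<gamma> {u, v})"

lemma edge_sym: "(u, v) \<in> parcs G \<Longrightarrow> (v, u) \<in> parcs G"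
  by (rule arcs_symmetric)

lemma edge_in: "(u, v) \<in> parcs G \<Longrightarrow> {u, v} \<in> edges G"
  by (auto simp: edges_def)

lemma inj_p: "u \<in> pverts G \<Longrightarrow> v \<in> pverts G \<Longrightarrow> p u = p v \<longleftrightarrow> u = v"
  using drawing by (auto simp: plane_drawing_def inj_on_def)

text \<open>A drawing fixes only the unordered pair of ends, so the curve may have to be
  reversed.\<close>

lemma obtain_arc:
  assumes "(u, v) \<in> parcs G"
  obtains c where "arc_between c (p u) (p v)" "path_image c = curve u v"
proof -
  have e: "Path_Connected.arc (\<gamma> {u, v})" "{pathstart (\<gamma> {u, v}), pathfinish (\<gamma> {u, v})} = {p u, p v}"
    using drawing edge_in[OF assms] by (auto simp: plane_drawing_def)
  then consider "pathstart (\<gamma> {u, v}) = p u" "pathfinish (\<gamma> {u, v}) = p v"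
    | "pathstart (\<gamma> {u, v}) = p v" "pathfinish (\<gamma> {u, v}) = p u" by (metis doubleton_eq_iff)
  then show ?thesis
  proof cases
    case 1
    then show ?thesis using that[of "\<gamma> {u, v}"] e by (simp add: arc_between_def)
  next
    case 2
    then show ?thesis using that[of "reversepath (\<gamma> {u, v})"] e
      by (simp add: arc_between_def arc_reversepath)
  qed
qed

lemma ends_on_curve:
  assumes "(u, v) \<in> parcs G" shows "p u \<in> curve u v" "p v \<in> curve u v"
  using obtain_arc[OF assms] arc_between_ends by metis+

lemma vertex_on_curve:
  assumes "(u, v) \<in> parcs G" "w \<in> pverts G" "p w \<in> curve u v" shows "w \<in> {u, v}"
proof -
  have "(curve u v - p ` {u, v}) \<inter> p ` pverts G = {}"
    using drawing edge_in[OF assms(1)] by (auto simp: plane_drawing_def)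
  then have "p w \<in> p ` {u, v}" using assms by blast
  then show ?thesis using inj_p assms wellformed' by auto
qed

text \<open>Either curve can play the part of the one whose relative interior avoids the other, so a
  common point is an end of both.\<close>

lemma curves_meet:
  assumes "(u, v) \<in> parcs G" "(x, y) \<in> parcs G" "{u, v} \<noteq> {x, y}" "z \<in> curve u v" "z \<in> curve x y"
  obtains w where "w \<in> {u, v}" "w \<in> {x, y}" "z = p w"
proof -
  have "(path_image (\<gamma> e) - p ` e) \<inter> path_image (\<gamma> f) = {}"
    if "e \<in> edges G" "f \<in> edges G" "e \<noteq> f" for e f
    using drawing that by (auto simp: plane_drawing_def)
  then have "z \<in> p ` {u, v}" "z \<in> p ` {x, y}"
    using edge_in assms by (metis Diff_iff IntI empty_iff)+
  then obtain w w' where w: "w \<in> {u, v}" "w' \<in> {x, y}" "z = p w" "z = p w'" by blast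
  then have "w = w'" using inj_p assms wellformed' by (metis insertE singletonD)
  then show ?thesis using that w by blast
qed

definition drawn :: "'a set \<Rightarrow> complex set" where
  "drawn B = p ` B \<union> (\<Union>(u, v)\<in>parcs G \<inter> B \<times> B. curve u v)"

lemma path_component_curve:
  assumes "(u, v) \<in> parcs G" "z \<in> curve u v" shows "path_component (curve u v) (p u) z"
proof -
  obtain c where c: "arc_between c (p u) (p v)" "path_image c = curve u v"
    using obtain_arc[OF assms(1)] .
  then have "path_connected (curve u v)"
    by (metis arc_between_def arc_imp_path path_connected_path_image)
  then show ?thesis using assms ends_on_curve by (meson path_connected_component)
qed

lemma path_component_drawn:
  assumes "cut_connected (parcs G) B" "x \<in> B" "z \<in> drawn B"
  shows "path_component (drawn B) (p x) z"
proof -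
  have sub: "curve u v \<subseteq> drawn B" if "(u, v) \<in> parcs G" "u \<in> B" "v \<in> B" for u v
    using that by (auto simp: drawn_def)
  define P where "P = {y \<in> B. path_component (drawn B) (p x) (p y)}"
  have "path_component (drawn B) (p x) (p x)" using assms by (auto simp: drawn_def path_component_refl_eq)
  then have xP: "x \<in> P" using assms by (simp add: P_def)
  have PB: "P = B"
  proof (rule ccontr)
    assume "P \<noteq> B"
    then have "P \<subset> B" "P \<noteq> {}" using xP by (auto simp: P_def)
    then obtain u v where uv: "u \<in> P" "v \<in> B - P" "(u, v) \<in> parcs G"
      using assms(1) unfolding cut_connected_def by meson
    have "path_component (drawn B) (p u) (p v)"
      by (rule path_component_of_subset[OF sub path_component_curve])
        (use uv ends_on_curve in \<open>auto simp: P_def\<close>)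
    then have "path_component (drawn B) (p x) (p v)"
      using uv(1) path_component_trans by (auto simp: P_def)
    then show False using uv by (simp add: P_def)
  qed
  consider y where "y \<in> B" "z = p y" | u v where "(u, v) \<in> parcs G" "u \<in> B" "v \<in> B" "z \<in> curve u v"
    using assms(3) by (auto simp: drawn_def)
  then show ?thesis
  proof cases
    case 1
    then show ?thesis using PB by (auto simp: P_def)
  next
    case 2
    then have "path_component (drawn B) (p u) z"
      by (meson path_component_of_subset path_component_curve sub)
    moreover have "u \<in> P" using PB 2 by simp
    ultimately show ?thesis using path_component_trans by (auto simp: P_def)
  qed
qed

lemma vertex_in_drawn:
  assumes "w \<in> pverts G" "B \<subseteq> pverts G" "p w \<in> drawn B" shows "w \<in> B"
proof -
  consider y where "y \<in> B" "p w = p y" | u v where "(u, v) \<in> parcs G" "u \<in> B" "v \<in> B" "p w \<in> curve u v"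
    using assms(3) by (auto simp: drawn_def)
  then show ?thesis
  proof cases
    case 1
    then show ?thesis using inj_p[of w y] assms by auto
  next
    case 2
    then show ?thesis using vertex_on_curve[OF 2(1) assms(1) 2(4)] by blast
  qed
qed

text \<open>Edges inside disjoint vertex sets have no common end, and different curves meet only at
  common ends.\<close>

lemma drawn_disjoint:
  assumes "A \<subseteq> pverts G" "B \<subseteq> pverts G" "A \<inter> B = {}" shows "drawn A \<inter> drawn B = {}"
proof (rule ccontr)
  assume "drawn A \<inter> drawn B \<noteq> {}"
  then obtain z where z: "z \<in> drawn A" "z \<in> drawn B" by blast
  consider w where "w \<in> A" "z = p w" | u v where "(u, v) \<in> parcs G" "u \<in> A" "v \<in> A" "z \<in> curve u v"
    using z(1) by (auto simp: drawn_def)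
  then show False
  proof cases
    case 1
    then show False using vertex_in_drawn[of w B] z(2) assms by auto
  next
    case 2
    consider w where "w \<in> B" "z = p w" | x y where "(x, y) \<in> parcs G" "x \<in> B" "y \<in> B" "z \<in> curve x y"
      using z(2) by (auto simp: drawn_def)
    then show False
    proof cases
      case 1
      then show False using vertex_in_drawn[of w A] z(1) assms by auto
    next
      case uv: 2
      then have "{u, v} \<noteq> {x, y}" using 2 uv assms by auto
      then show False using curves_meet[OF 2(1) uv(1) _ 2(4) uv(4)] 2 uv assms(3) by blast
    qed
  qed
qed

text \<open>Makes a spoke part of a drawn vertex set, so that \<open>drawn_disjoint\<close> governs
  spokes as well.\<close>

lemma drawn_insert:
  assumes "(a, x) \<in> parcs G" "x \<in> B" shows "curve a x \<union> drawn B \<subseteq> drawn (insert a B)"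
proof
  fix z assume "z \<in> curve a x \<union> drawn B"
  moreover have "drawn B \<subseteq> drawn (insert a B)"
    unfolding drawn_def by (intro Un_mono UN_mono image_mono) auto
  moreover have "z \<in> drawn (insert a B)" if "z \<in> curve a x"
    unfolding drawn_def by (rule UnI2, rule UN_I[of "(a, x)"]) (use assms that in auto)
  ultimately show "z \<in> drawn (insert a B)" by blast
qed

text \<open>Adding \<open>a\<close> and \<open>a'\<close> to their bags keeps the sets disjoint
  unless \<open>a = a'\<close>. In that case a common point avoids both drawn bags and lies on two
  different edges whose only common end is \<open>a\<close>.\<close>

lemma spokes_meet:
  assumes B: "B \<subseteq> pverts G" "B' \<subseteq> pverts G" "B \<inter> B' = {}"
    and a: "a \<notin> B \<union> B'" "a' \<notin> B \<union> B'" and x: "(a, x) \<in> parcs G" "x \<in> B" "(a', x') \<in> parcs G" "x' \<in> B'"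
    and z: "z \<in> curve a x \<union> drawn B" "z \<in> curve a' x' \<union> drawn B'"
  shows "a = a' \<and> z = p a"
proof -
  have V: "insert a B \<subseteq> pverts G" "insert a' B' \<subseteq> pverts G" using B x wellformed' by auto
  have z': "z \<in> drawn (insert a B)" "z \<in> drawn (insert a' B')"
    using z drawn_insert[OF x(1,2)] drawn_insert[OF x(3,4)] by blast+
  have eq: "a = a'"
  proof (rule ccontr)
    assume "a \<noteq> a'"
    then have "drawn (insert a B) \<inter> drawn (insert a' B') = {}"
      using a B(3) by (intro drawn_disjoint V) auto
    then show False using z' by blast
  qed
  have "drawn (insert a B) \<inter> drawn B' = {}" "drawn B \<inter> drawn (insert a' B') = {}"
    by (rule drawn_disjoint; use a B V in blast)+
  then have "z \<in> curve a x" "z \<in> curve a' x'" using z z' by blast+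
  moreover have "{a, x} \<noteq> {a', x'}" using eq x B(3) a by (auto simp: doubleton_eq_iff)
  ultimately obtain w where "w \<in> {a, x}" "w \<in> {a', x'}" "z = p w" using curves_meet x by metis
  then show ?thesis using eq x B(3) a by auto
qed

text \<open>The arc cannot avoid the drawn bag: the two outer curves are closed and can only meet at
  a common attachment vertex, which belongs to the bag. The point \<open>m\<close> is the target for
  the leg of the third vertex.\<close>

lemma obtain_side:
  assumes B: "cut_connected (parcs G) B" "B \<subseteq> pverts G"
    and a: "a \<notin> B" "a' \<notin> B" "a \<noteq> a'"
    and x: "(a, x) \<in> parcs G" "x \<in> B" "(a', x') \<in> parcs G" "x' \<in> B"
  obtains c m where "arc_between c (p a) (p a')"
    "path_image c \<subseteq> curve a x \<union> drawn B \<union> (curve a' x' \<union> drawn B)" "m \<in> path_image c" "m \<in> drawn B"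
proof -
  let ?W = "curve a x \<union> drawn B \<union> (curve a' x' \<union> drawn B)"
  have px: "p y \<in> drawn B" if "y \<in> B" for y using that by (simp add: drawn_def)
  have "path_component ?W (p a) (p x)"
    by (rule path_component_of_subset[OF _ path_component_curve[OF x(1) ends_on_curve(2)[OF x(1)]]]) auto
  moreover have "path_component ?W (p x) (p x')"
    by (rule path_component_of_subset[OF _ path_component_drawn[OF B(1) x(2) px[OF x(4)]]]) auto
  moreover have "path_component ?W (p a') (p x')"
    by (rule path_component_of_subset[OF _ path_component_curve[OF x(3) ends_on_curve(2)[OF x(3)]]]) auto
  ultimately have "path_component ?W (p a) (p a')"
    by (meson path_component_sym path_component_trans)
  then obtain q where q: "path q" "path_image q \<subseteq> ?W" "pathstart q = p a" "pathfinish q = p a'"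
    by (auto simp: path_component_def)
  have V: "a \<in> pverts G" "a' \<in> pverts G" using x wellformed' by auto
  then have "p a \<noteq> p a'" using inj_p a by simp
  then obtain c where c: "Path_Connected.arc c" "path_image c \<subseteq> path_image q" "pathstart c = p a" "pathfinish c = p a'"
    using path_contains_arc[OF q(1,3,4)] by metis
  then have cb: "arc_between c (p a) (p a')" by (simp add: arc_between_def)
  have cW: "path_image c \<subseteq> ?W" using c q by blast
  have "path_image c \<inter> drawn B \<noteq> {}"
  proof
    assume no: "path_image c \<inter> drawn B = {}"
    then have "path_image c \<subseteq> curve a x \<union> curve a' x'" using cW by blast
    moreover have "closed (curve a x)" "closed (curve a' x')"
      using obtain_arc[OF x(1)] obtain_arc[OF x(3)] arc_between_closed by metis+
    moreover have "top_connected (path_image c)" using c(1) by (simp add: connected_arc_image)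
    moreover have "p a \<in> curve a x \<inter> path_image c" "p a' \<in> curve a' x' \<inter> path_image c"
      using ends_on_curve x arc_between_ends[OF cb] by blast+
    ultimately obtain z where z: "z \<in> path_image c" "z \<in> curve a x" "z \<in> curve a' x'"
      unfolding connected_closed by blast
    have "{a, x} \<noteq> {a', x'}" using a x by (auto simp: doubleton_eq_iff)
    then obtain w where "w \<in> {a, x}" "w \<in> {a', x'}" "z = p w" using curves_meet x z by metis
    then have "z = p x" using a x by auto
    then show False using no z px[OF x(2)] by blast
  qed
  then show ?thesis using that cb cW by blast
qed

text \<open>A path from \<open>p a\<close> through the bag to \<open>m\<close> must hit
  \<open>P\<close>, since \<open>m\<close> is in it; the leg is that path before its first
  hit.\<close>

lemma obtain_leg:
  assumes B: "cut_connected (parcs G) B" and x: "(a, x) \<in> parcs G" "x \<in> B"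
    and P: "closed P" "p a \<notin> P" "m \<in> P" "m \<in> drawn B"
  obtains S y where "top_connected S" "p a \<in> S" "S \<subseteq> curve a x \<union> drawn B" "S \<inter> P = {}"
    "y \<in> closure S" "y \<in> P" "y \<in> curve a x \<union> drawn B"
proof -
  let ?W = "curve a x \<union> drawn B"
  have "path_component ?W (p a) (p x)"
    by (rule path_component_of_subset[OF _ path_component_curve[OF x(1) ends_on_curve(2)[OF x(1)]]]) auto
  moreover have "path_component ?W (p x) m"
    by (rule path_component_of_subset[OF _ path_component_drawn[OF B x(2) P(4)]]) auto
  ultimately have "path_component ?W (p a) m" by (rule path_component_trans)
  then obtain q where q: "path q" "path_image q \<subseteq> ?W" "pathstart q = p a" "pathfinish q = m"
    by (auto simp: path_component_def)
  have "pathstart q \<notin> P" "pathfinish q \<in> P" using q P by simp_all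
  then obtain S y where S: "top_connected S" "pathstart q \<in> S" "S \<subseteq> path_image q - P"
    "y \<in> closure S" "y \<in> P" "y \<in> path_image q"
    using obtain_first_hit[OF q(1) P(1)] by metis
  show ?thesis
  proof (rule that[OF S(1) _ _ _ S(4,5)])
    show "p a \<in> S" using S(2) q(3) by simp
    show "S \<subseteq> ?W" "S \<inter> P = {}" using S(3) q(2) by blast+
    show "y \<in> ?W" using S(6) q(2) by blast
  qed
qed

text \<open>Three arcs from \<open>a\<close> to \<open>b\<close>, one through each bag, form a theta curve. The vertex \<open>c\<close> with its legs,
  each cut off at the first hit of the arc through the same bag, is connected and accumulates at all
  three arcs.\<close>

lemma no_K33_minor:
  assumes B: "\<And>i. i < 3 \<Longrightarrow> cut_connected (parcs G) (B i) \<and> B i \<subseteq> pverts G"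
    and disj: "\<And>i j. i < 3 \<Longrightarrow> j < 3 \<Longrightarrow> i \<noteq> j \<Longrightarrow> B i \<inter> B j = {}"
    and a: "a \<noteq> b" "a \<noteq> c" "b \<noteq> c"
    and nb: "\<And>i. i < (3::nat) \<Longrightarrow> {a, b, c} \<subseteq> nbhd (parcs G) (B i)"
  shows False
proof -
  have "\<forall>i\<in>{..<3}. \<forall>v\<in>{a, b, c}. \<exists>x. x \<in> B i \<and> (v, x) \<in> parcs G"
    using nb edge_sym by (fastforce simp: nbhd_def)
  then have "\<exists>x. \<forall>i\<in>{..<3}. \<forall>v\<in>{a, b, c}. x i v \<in> B i \<and> (v, x i v) \<in> parcs G"
    by metis
  then obtain x where x: "\<And>i v. i < 3 \<Longrightarrow> v \<in> {a, b, c} \<Longrightarrow> x i v \<in> B i \<and> (v, x i v) \<in> parcs G"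
    by auto
  have notin: "v \<notin> B i" if "i < 3" "v \<in> {a, b, c}" for i v
    using nb[OF that(1)] that(2) by (auto simp: nbhd_def)
  have V: "v \<in> pverts G" if "v \<in> {a, b, c}" for v using x[of 0 v] that wellformed' by auto
  define spoke where "spoke i v = curve v (x i v) \<union> drawn (B i)" for i v
  have meet: "v = w \<and> z = p v"
    if "i < 3" "j < 3" "i \<noteq> j" "v \<in> {a, b, c}" "w \<in> {a, b, c}" "z \<in> spoke i v" "z \<in> spoke j w" for i j v w z
    using spokes_meet[of "B i" "B j" v w "x i v" "x j w" z] that B disj notin x by (simp add: spoke_def)
  have vertex: "w \<in> insert v (B i)" if "i < 3" "v \<in> {a, b, c}" "w \<in> {a, b, c}" "p w \<in> spoke i v" for i v w
  proof -
    have "p w \<in> drawn (insert v (B i))"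
      using drawn_insert[of v "x i v" "B i"] x[OF that(1,2)] that(4) by (auto simp: spoke_def)
    then show ?thesis using vertex_in_drawn[of w "insert v (B i)"] V that B by auto
  qed
  have "\<exists>g m. arc_between g (p a) (p b) \<and> path_image g \<subseteq> spoke i a \<union> spoke i b \<and>
      m \<in> path_image g \<and> m \<in> drawn (B i)" if i: "i < 3" for i
  proof -
    obtain g m where "arc_between g (p a) (p b)"
      "path_image g \<subseteq> curve a (x i a) \<union> drawn (B i) \<union> (curve b (x i b) \<union> drawn (B i))"
      "m \<in> path_image g" "m \<in> drawn (B i)"
      by (rule obtain_side[of "B i" a b "x i a" "x i b"])
        (use B[OF i] notin[OF i] a x[OF i] in auto)
    then show ?thesis unfolding spoke_def by blast
  qed
  then obtain g m where g: "\<And>i. i < 3 \<Longrightarrow> arc_between (g i) (p a) (p b)"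
    "\<And>i. i < 3 \<Longrightarrow> path_image (g i) \<subseteq> spoke i a \<union> spoke i b"
    "\<And>i. i < 3 \<Longrightarrow> m i \<in> path_image (g i)" "\<And>i. i < 3 \<Longrightarrow> m i \<in> drawn (B i)"
      by metis
  have cg: "p c \<notin> path_image (g i)" if i: "i < 3" for i
    using g(2)[OF i] vertex[OF i, of a c] vertex[OF i, of b c] notin[OF i, of c] a by blast
  define leg where "leg i S y \<longleftrightarrow> top_connected S \<and> p c \<in> S \<and> S \<subseteq> spoke i c \<and>
    S \<inter> path_image (g i) = {} \<and> y \<in> closure S \<and> y \<in> path_image (g i) \<and> y \<in> spoke i c" for i S y
  have "\<exists>S y. leg i S y" if i: "i < 3" for i
  proof -
    have "cut_connected (parcs G) (B i)" "(c, x i c) \<in> parcs G" "x i c \<in> B i"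
      using B[OF i] x[OF i, of c] by auto
    from obtain_leg[OF this arc_between_closed[OF g(1)[OF i]] cg[OF i] g(3,4)[OF i]]
    show ?thesis unfolding spoke_def leg_def by metis
  qed
  then obtain S y where leg: "\<And>i. i < 3 \<Longrightarrow> leg i (S i) (y i)" by metis
  have S: "top_connected (S i)" "p c \<in> S i" "S i \<subseteq> spoke i c" "S i \<inter> path_image (g i) = {}"
    "y i \<in> closure (S i)" "y i \<in> path_image (g i)" "y i \<in> spoke i c" if "i < 3" for i
    using leg[OF that] by (simp_all add: leg_def)
  \<comment> \<open>In the same bag the leg stops before the arc; in different bags the spoke of
    \<open>c\<close> is disjoint from those of \<open>a\<close> and \<open>b\<close>.\<close>
  have Sg: "S i \<inter> path_image (g j) = {}" if "i < 3" "j < 3" for i j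
  proof (cases "i = j")
    case True then show ?thesis using S(4) that by simp
  next
    case False
    then have "spoke i c \<inter> (spoke j a \<union> spoke j b) = {}"
      using meet[OF that False, of c] a by blast
    then show ?thesis using S(3)[OF that(1)] g(2)[OF that(2)] by blast
  qed
  have gg: "path_image (g i) \<inter> path_image (g j) = {p a, p b}" if "i < 3" "j < 3" "i \<noteq> j" for i j
  proof
    show "{p a, p b} \<subseteq> path_image (g i) \<inter> path_image (g j)"
      using g(1) that arc_between_ends by blast
    show "path_image (g i) \<inter> path_image (g j) \<subseteq> {p a, p b}"
      using g(2)[OF that(1)] g(2)[OF that(2)] meet[OF that] by blast
  qed
  \<comment> \<open>The spoke of \<open>c\<close> carries no vertices besides \<open>c\<close> and
    those of the bag, so its leg cannot first hit the arc at \<open>p a\<close> or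
    \<open>p b\<close>.\<close>
  have yn: "y i \<notin> {p a, p b}" if i: "i < 3" for i
    using S(7)[OF i] vertex[OF i, of c a] vertex[OF i, of c b] notin[OF i] a by auto
  interpret theta "g 0" "g 1" "g 2" "p a" "p b"
    by (rule theta.intro) (simp_all add: g(1) gg)
  define T where "T = S 0 \<union> S 1 \<union> S 2"
  have pc: "p c \<in> S 0 \<inter> S 1" "p c \<in> (S 0 \<union> S 1) \<inter> S 2" using S(2) by auto
  have "top_connected T" unfolding T_def
    by (intro connected_Un S(1)) (use pc in auto)
  moreover have "T \<inter> (path_image (g 0) \<union> path_image (g 1) \<union> path_image (g 2)) = {}"
    unfolding T_def Int_Un_distrib Int_Un_distrib2 using Sg by simp
  moreover have "S i \<subseteq> T" if "i < 3" for i
  proof -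
    have "i = 0 \<or> i = 1 \<or> i = 2" using that by auto
    then show ?thesis by (auto simp: T_def)
  qed
  then have "y i \<in> closure T" if "i < 3" for i using S(5) closure_mono that by blast
  ultimately show False
    using not_all_three[of T "y 0" "y 1" "y 2"] S(6) yn by simp
qed

end

section \<open>Nonplanarity of K5\<close>

lemma arc_between_join:
  assumes "arc_between g u v" "arc_between h v w" "path_image g \<inter> path_image h \<subseteq> {v}"
  shows "arc_between (g +++ h) u w" "path_image (g +++ h) = path_image g \<union> path_image h"
  using assms by (auto simp: arc_between_def arc_join path_image_join)

text \<open>A chord of the 4-cycle, without its ends, accumulates at them, and they are inner points
  of the arcs of the theta curve with the other chord. This is how one chord is compared with the
  other.\<close>

lemma arc_between_closure:
  assumes "arc_between c a b" shows "path_image c \<subseteq> closure (path_image c - {a, b})"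
proof -
  have "path_image c - {a, b} = c ` {0<..<1}"
    using simple_path_endless[OF arc_between_simple_path[OF assms]] assms by (simp add: arc_between_def)
  moreover have "c ` closure {0<..<1} \<subseteq> closure (c ` {0<..<1})"
    by (rule image_closure_subset)
      (use assms in \<open>auto simp: arc_between_def arc_def path_def intro: closure_subset[THEN subsetD]\<close>)
  ultimately show ?thesis by (simp add: path_image_def)
qed

context drawn_graph
begin

text \<open>With respect to the 4-cycle \<open>a c e d\<close>, the chords \<open>a e\<close> and \<open>c d\<close> and the star at \<open>b\<close> would have to
  lie pairwise on different sides.\<close>

lemma no_K5:
  assumes d: "distinct [a, b, c, d, e]"
    and adj: "\<And>u v. u \<in> {a, b, c, d, e} \<Longrightarrow> v \<in> {a, b, c, d, e} \<Longrightarrow> u \<noteq> v \<Longrightarrow> (u, v) \<in> parcs G"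
  shows False
proof -
  let ?K = "{a, b, c, d, e}"
  have V: "u \<in> pverts G" if "u \<in> ?K" for u
    using adj[of u a] adj[of u b] that d wellformed' by (cases "u = a") auto
  have meet: "curve u v \<inter> curve x y \<subseteq> p ` ({u, v} \<inter> {x, y})"
    if uv: "u \<in> ?K" "v \<in> ?K" "x \<in> ?K" "y \<in> ?K" "u \<noteq> v" "x \<noteq> y" "{u, v} \<noteq> {x, y}" for u v x y
  proof
    fix z assume "z \<in> curve u v \<inter> curve x y"
    then obtain w where "w \<in> {u, v}" "w \<in> {x, y}" "z = p w"
      using curves_meet[OF adj[OF uv(1,2,5)] adj[OF uv(3,4,6)] uv(7)] by blast
    then show "z \<in> p ` ({u, v} \<inter> {x, y})" by blast
  qed
  have pne: "p u \<noteq> p v" if "u \<in> ?K" "v \<in> ?K" "u \<noteq> v" for u v using inj_p V that by blast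
  obtain ac where ac: "arc_between ac (p a) (p c)" "path_image ac = curve a c"
    by (rule obtain_arc[OF adj[of a c]]) (use d in auto)
  obtain ce where ce: "arc_between ce (p c) (p e)" "path_image ce = curve c e"
    by (rule obtain_arc[OF adj[of c e]]) (use d in auto)
  obtain ad where ad: "arc_between ad (p a) (p d)" "path_image ad = curve a d"
    by (rule obtain_arc[OF adj[of a d]]) (use d in auto)
  obtain de where de: "arc_between de (p d) (p e)" "path_image de = curve d e"
    by (rule obtain_arc[OF adj[of d e]]) (use d in auto)
  obtain ae where ae: "arc_between ae (p a) (p e)" "path_image ae = curve a e"
    by (rule obtain_arc[OF adj[of a e]]) (use d in auto)
  obtain cd where cd: "arc_between cd (p c) (p d)" "path_image cd = curve c d"
    by (rule obtain_arc[OF adj[of c d]]) (use d in auto)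
  have m: "curve a c \<inter> curve c e \<subseteq> {p c}" "curve a d \<inter> curve d e \<subseteq> {p d}"
    "curve a c \<inter> curve a d \<subseteq> {p a}" "curve c e \<inter> curve d e \<subseteq> {p e}"
    "curve a c \<inter> curve d e = {}" "curve a d \<inter> curve c e = {}" "curve a e \<inter> curve c d = {}"
    "curve a e \<inter> curve a c \<subseteq> {p a}" "curve a e \<inter> curve a d \<subseteq> {p a}"
    "curve a e \<inter> curve c e \<subseteq> {p e}" "curve a e \<inter> curve d e \<subseteq> {p e}"
    "curve c d \<inter> curve a c \<subseteq> {p c}" "curve c d \<inter> curve c e \<subseteq> {p c}"
    "curve c d \<inter> curve a d \<subseteq> {p d}" "curve c d \<inter> curve d e \<subseteq> {p d}"
    using d meet[of a c c e] meet[of a d d e] meet[of a c a d] meet[of c e d e] meet[of a c d e]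
      meet[of a d c e] meet[of a e c d] meet[of a e a c] meet[of a e a d] meet[of a e c e]
      meet[of a e d e] meet[of c d a c] meet[of c d c e] meet[of c d a d] meet[of c d d e]
    by (auto simp: doubleton_eq_iff)
  have ace: "arc_between (ac +++ ce) (p a) (p e)" "path_image (ac +++ ce) = curve a c \<union> curve c e"
    using arc_between_join[OF ac(1) ce(1)] ac ce m by simp_all
  have ade: "arc_between (ad +++ de) (p a) (p e)" "path_image (ad +++ de) = curve a d \<union> curve d e"
    using arc_between_join[OF ad(1) de(1)] ad de m by simp_all
  have cad: "arc_between (reversepath ac +++ ad) (p c) (p d)"
    "path_image (reversepath ac +++ ad) = curve a c \<union> curve a d"
    using arc_between_join[OF arc_between_rev[OF ac(1)] ad(1)] ac ad m by simp_all
  have ced: "arc_between (ce +++ reversepath de) (p c) (p d)"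
    "path_image (ce +++ reversepath de) = curve c e \<union> curve d e"
    using arc_between_join[OF ce(1) arc_between_rev[OF de(1)]] ce de m by simp_all
  have on: "p a \<in> curve a c" "p a \<in> curve a d" "p a \<in> curve a e" "p c \<in> curve a c" "p c \<in> curve c e"
    "p c \<in> curve c d" "p d \<in> curve a d" "p d \<in> curve d e" "p d \<in> curve c d" "p e \<in> curve c e"
    "p e \<in> curve d e" "p e \<in> curve a e"
    using ac ce ad de ae cd arc_between_ends by metis+
  have i1: "(curve a c \<union> curve c e) \<inter> (curve a d \<union> curve d e) = {p a, p e}"
    using m(3-6) on(1,2,10,11) by blast
  have i2: "(curve a c \<union> curve c e) \<inter> curve a e = {p a, p e}" using m(8,10) on(1,3,10,12) by blast
  have i3: "(curve a d \<union> curve d e) \<inter> curve a e = {p a, p e}" using m(9,11) on(2,3,11,12) by blast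
  have i4: "(curve a c \<union> curve a d) \<inter> (curve c e \<union> curve d e) = {p c, p d}"
    using m(1,2,5,6) on(4,5,7,8) by blast
  have i5: "(curve a c \<union> curve a d) \<inter> curve c d = {p c, p d}" using m(12,14) on(4,6,7,9) by blast
  have i6: "(curve c e \<union> curve d e) \<inter> curve c d = {p c, p d}" using m(13,15) on(5,6,8,9) by blast
  \<comment> \<open>The same 4-cycle is split in two ways: at \<open>a\<close> and \<open>e\<close>
    with third arc \<open>a e\<close>, and at \<open>c\<close> and \<open>d\<close> with third arc
    \<open>c d\<close>.\<close>
  interpret T1: theta "ac +++ ce" "ad +++ de" ae "p a" "p e"
    by (rule theta.intro) (simp_all only: ace ade ae i1 i2 i3)
  interpret T2: theta "reversepath ac +++ ad" "ce +++ reversepath de" cd "p c" "p d"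
    by (rule theta.intro) (simp_all only: cad ced cd i4 i5 i6)
  define J where "J = curve a c \<union> curve c e \<union> (curve a d \<union> curve d e)"
  have J1: "path_image (ac +++ ce) \<union> path_image (ad +++ de) = J" using ace ade by (simp add: J_def)
  have J2: "path_image (reversepath ac +++ ad) \<union> path_image (ce +++ reversepath de) = J"
    using cad ced by (auto simp: J_def)
  have pn: "p a \<noteq> p c" "p a \<noteq> p d" "p a \<noteq> p e" "p c \<noteq> p d" "p c \<noteq> p e" "p d \<noteq> p e"
    using pne d by auto
  \<comment> \<open>Each leg of the star at \<open>b\<close> is stopped just before
    \<open>p x\<close>: the star then avoids the 4-cycle but accumulates at all four of its
    vertices.\<close>
  have "\<exists>S. top_connected S \<and> p b \<in> S \<and> S \<subseteq> curve b x - {p x} \<and> p x \<in> closure S"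
    if x: "x \<in> ?K" "x \<noteq> b" for x
  proof -
    obtain g where g: "arc_between g (p b) (p x)" "path_image g = curve b x"
      by (rule obtain_arc[OF adj[of b x]]) (use x in auto)
    have "path g" "pathstart g \<notin> {p x}" "pathfinish g \<in> {p x}"
      using g(1) arc_between_ends[OF g(1)] by (auto simp: arc_between_def arc_imp_path)
    then obtain S y where "top_connected S" "pathstart g \<in> S" "S \<subseteq> path_image g - {p x}" "y \<in> closure S" "y \<in> {p x}"
      using obtain_first_hit[of g "{p x}"] by (metis closed_singleton)
    then show ?thesis using g by (auto simp: arc_between_def)
  qed
  then obtain S where S: "\<And>x. x \<in> ?K \<Longrightarrow> x \<noteq> b \<Longrightarrow>
    top_connected (S x) \<and> p b \<in> S x \<and> S x \<subseteq> curve b x - {p x} \<and> p x \<in> closure (S x)" by metis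
  have Sx: "S x \<inter> curve u v = {}" if "x \<in> ?K" "x \<noteq> b" "u \<in> ?K" "v \<in> ?K" "u \<noteq> v" "u \<noteq> b" "v \<noteq> b" for x u v
  proof -
    have "curve b x \<inter> curve u v \<subseteq> p ` ({b, x} \<inter> {u, v})"
      by (rule meet) (use that in \<open>auto simp: doubleton_eq_iff\<close>)
    also have "\<dots> \<subseteq> {p x}" using that by auto
    finally show ?thesis using S[OF that(1,2)] by blast
  qed
  define T where "T = S a \<union> S c \<union> S d \<union> S e"
  have cT: "top_connected T" unfolding T_def by (intro connected_Un) (use S d in auto)
  have clT: "p a \<in> closure T" "p c \<in> closure T" "p d \<in> closure T" "p e \<in> closure T"
    using S[of a] S[of c] S[of d] S[of e] d by (auto simp: T_def closure_Un)
  have avoid: "T \<inter> curve u v = {}" if "u \<in> ?K" "v \<in> ?K" "u \<noteq> v" "u \<noteq> b" "v \<noteq> b" for u v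
    using Sx that d by (auto simp: T_def)
  have TJ: "T \<inter> J = {}"
    using avoid[of a c] avoid[of c e] avoid[of a d] avoid[of d e] d by (auto simp: J_def)
  have T3: "T \<inter> curve a e = {}" "T \<inter> curve c d = {}" using avoid[of a e] avoid[of c d] d by auto
  have Tne: "T \<noteq> {}" using S[of a] d by (auto simp: T_def)
  let ?Q = "curve a e - {p a, p e}" and ?R = "curve c d - {p c, p d}"
  have opp1: "T \<subseteq> inside J \<and> ?Q \<subseteq> outside J \<or> T \<subseteq> outside J \<and> ?Q \<subseteq> inside J"
  proof -
    have "T \<inter> (J \<union> path_image ae) = {}" using TJ T3 ae(2) by blast
    then show ?thesis unfolding ae(2)[symmetric]
      by (rule T1.other_side[unfolded J1, OF cT _ clT(2) _ _ clT(3)]) (use on pn ace(2) ade(2) in simp_all)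
  qed
  have opp2: "T \<subseteq> inside J \<and> ?R \<subseteq> outside J \<or> T \<subseteq> outside J \<and> ?R \<subseteq> inside J"
  proof -
    have "T \<inter> (J \<union> path_image cd) = {}" using TJ T3 cd(2) by blast
    then show ?thesis unfolding cd(2)[symmetric]
      by (rule T2.other_side[unfolded J2, OF cT _ clT(1) _ _ clT(4)]) (use on pn cad(2) ced(2) in simp_all)
  qed
  have RJ: "?R \<inter> J = {}" "?R \<inter> curve a e = {}"
    unfolding J_def using i5 i6 m(7) by blast+
  have clR: "p c \<in> closure ?R" "p d \<in> closure ?R" using arc_between_closure[OF cd(1)] cd(2) on by auto
  have opp3: "?R \<subseteq> inside J \<and> ?Q \<subseteq> outside J \<or> ?R \<subseteq> outside J \<and> ?Q \<subseteq> inside J"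
  proof -
    have "?R \<inter> (J \<union> path_image ae) = {}" using RJ ae(2) by blast
    moreover have "top_connected ?R" using arc_between_open_arc(1)[OF cd(1)] cd(2) by simp
    ultimately show ?thesis unfolding ae(2)[symmetric]
      by (intro T1.other_side[unfolded J1, OF _ _ clR(1) _ _ clR(2)]) (use on pn ace(2) ade(2) in simp_all)
  qed
  have "?Q \<noteq> {}" "?R \<noteq> {}" using arc_between_open_arc(2) ae cd by metis+
  then show False using opp1 opp2 opp3 Tne inside_Int_outside[of J] by blast
qed

end

section \<open>Minors and bags\<close>

lemma digraph_iso_pairI:
  assumes "pair_graph K" "bij_betw \<phi> (pverts K) (pverts H)"
    and "\<And>x y. (x, y) \<in> parcs K \<Longrightarrow> (\<phi> x, \<phi> y) \<in> parcs H"
    and "\<And>i j. (i, j) \<in> parcs H \<Longrightarrow> \<exists>x y. (x, y) \<in> parcs K \<and> \<phi> x = i \<and> \<phi> y = j"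
  shows "digraph_iso (with_proj K) (with_proj H)"
proof -
  interpret pair_graph K by fact
  define f where "f = \<lparr>iso_verts = \<phi>, iso_arcs = map_prod \<phi> \<phi>, iso_head = snd, iso_tail = fst\<rparr>"
  have inj: "inj_on \<phi> (pverts K)" and im: "\<phi> ` pverts K = pverts H"
    using assms(2) by (auto simp: bij_betw_def)
  have "inj_on (map_prod \<phi> \<phi>) (parcs K)"
    by (rule inj_on_subset[OF map_prod_inj_on[OF inj inj]]) (auto dest: in_arcsD1 in_arcsD2)
  then have "digraph_isomorphism f"
    unfolding digraph_isomorphism_def using inj wf_digraph_axioms by (auto simp: f_def)
  moreover have "map_prod \<phi> \<phi> ` parcs K = parcs H"
  proof
    show "map_prod \<phi> \<phi> ` parcs K \<subseteq> parcs H" using assms(3) by auto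
    show "parcs H \<subseteq> map_prod \<phi> \<phi> ` parcs K"
    proof (rule subrelI)
      fix i j assume "(i, j) \<in> parcs H"
      then obtain x y where "(x, y) \<in> parcs K" "\<phi> x = i" "\<phi> y = j" using assms(4) by blast
      then show "(i, j) \<in> map_prod \<phi> \<phi> ` parcs K" by (intro image_eqI[of _ _ "(x, y)"]) simp_all
    qed
  qed
  then have "with_proj H = app_iso f (with_proj K)"
    using im by (simp add: app_iso_def with_proj_def f_def)
  ultimately show ?thesis unfolding digraph_iso_def by auto
qed

text \<open>In both graphs arcs are pairs with the projections as ends, so the vertex map determines
  the arc map.\<close>

lemma digraph_iso_pairE:
  assumes "pair_graph G" "digraph_iso (with_proj G) (with_proj H)"
  obtains \<phi> where "bij_betw \<phi> (pverts G) (pverts H)"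
    "\<And>x y. x \<in> pverts G \<Longrightarrow> y \<in> pverts G \<Longrightarrow> (x, y) \<in> parcs G \<longleftrightarrow> (\<phi> x, \<phi> y) \<in> parcs H"
proof -
  interpret pair_graph G by fact
  obtain f where f: "digraph_isomorphism f" "with_proj H = app_iso f (with_proj G)"
    using assms(2) unfolding digraph_iso_def by auto
  have V: "pverts H = iso_verts f ` pverts G" and A: "parcs H = iso_arcs f ` parcs G"
    and tl: "iso_tail f = fst" and hd: "iso_head f = snd"
    using f(2) by (simp_all add: app_iso_def with_proj_def)
  have inj: "inj_on (iso_verts f) (pverts G)"
    and ends: "\<And>a. a \<in> parcs G \<Longrightarrow> iso_verts f (fst a) = fst (iso_arcs f a) \<and> iso_verts f (snd a) = snd (iso_arcs f a)"
    using f(1) unfolding digraph_isomorphism_def tl hd by auto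
  have arc: "iso_arcs f (x, y) = (iso_verts f x, iso_verts f y)" if "(x, y) \<in> parcs G" for x y
    using ends[OF that] by (simp add: prod_eq_iff)
  show ?thesis
  proof (rule that)
    show "bij_betw (iso_verts f) (pverts G) (pverts H)" using inj V by (simp add: bij_betw_def)
    fix x y assume xy: "x \<in> pverts G" "y \<in> pverts G"
    show "(x, y) \<in> parcs G \<longleftrightarrow> (iso_verts f x, iso_verts f y) \<in> parcs H"
    proof
      assume "(x, y) \<in> parcs G"
      then show "(iso_verts f x, iso_verts f y) \<in> parcs H" using arc A by (metis imageI)
    next
      assume "(iso_verts f x, iso_verts f y) \<in> parcs H"
      then obtain u v where uv: "(u, v) \<in> parcs G" "iso_arcs f (u, v) = (iso_verts f x, iso_verts f y)"
        unfolding A by auto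
      then have "iso_verts f u = iso_verts f x" "iso_verts f v = iso_verts f y" using arc by auto
      then have "u = x" "v = y" using inj xy in_arcsD1[OF uv(1)] in_arcsD2[OF uv(1)] by (auto dest: inj_onD)
      then show "(x, y) \<in> parcs G" using uv by simp
    qed
  qed
qed

text \<open>\<open>H\<close> is the quotient of \<open>K\<close> by connected fibres of
  \<open>\<phi>\<close>. Edges inside fibres are permitted, so the property survives contracting one
  of them; once \<open>\<phi>\<close> is injective it says that \<open>\<phi>\<close> is an
  isomorphism.\<close>

definition bag_quotient ::
    "'b pair_pre_digraph \<Rightarrow> ('a \<Rightarrow> 'b) \<Rightarrow> 'a pair_pre_digraph \<Rightarrow> bool" where
  "bag_quotient H \<phi> K \<longleftrightarrow> pair_graph K \<and> \<phi> ` pverts K = pverts H \<and>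
     (\<forall>i\<in>pverts H. cut_connected (parcs K) {x \<in> pverts K. \<phi> x = i}) \<and>
     (\<forall>x y. (x, y) \<in> parcs K \<longrightarrow> \<phi> x \<noteq> \<phi> y \<longrightarrow> (\<phi> x, \<phi> y) \<in> parcs H) \<and>
     (\<forall>i j. (i, j) \<in> parcs H \<longrightarrow> i \<noteq> j \<and> (\<exists>x y. (x, y) \<in> parcs K \<and> \<phi> x = i \<and> \<phi> y = j))"

text \<open>The map \<open>r\<close> sending \<open>v\<close> to \<open>u\<close> does not change
  \<open>\<phi>\<close>, so edges are simply transported along it; only the connectedness of the
  fibres needs an argument.\<close>

lemma bag_quotient_contract_edge:
  assumes Q: "bag_quotient H \<phi> K" and uv: "(u, v) \<in> parcs K" "\<phi> u = \<phi> v"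
  shows "bag_quotient H \<phi> (contract_edge K u v)"
proof -
  let ?K = "contract_edge K u v"
  interpret pair_graph K using Q by (simp add: bag_quotient_def)
  define r where "r = id(v := u)"
  have ne: "u \<noteq> v" using uv(1) no_loops' by blast
  have V: "u \<in> pverts K" "v \<in> pverts K" using uv(1) in_arcsD1 in_arcsD2 by blast+
  have pv: "pverts ?K = pverts K - {v}" by (simp add: contract_edge_def)
  have pa: "(x, y) \<in> parcs ?K \<longleftrightarrow> x \<noteq> y \<and> (\<exists>a b. (a, b) \<in> parcs K \<and> x = r a \<and> y = r b)" for x y
    by (simp add: contract_edge_def r_def Bex_def split_paired_Ex)
  have paI: "(r a, r b) \<in> parcs ?K" if "(a, b) \<in> parcs K" "r a \<noteq> r b" for a b
    unfolding pa using that by blast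
  have \<phi>r: "\<phi> (r a) = \<phi> a" for a using uv(2) by (simp add: r_def)
  have ru: "r v = u" "\<And>a. a \<noteq> v \<Longrightarrow> r a = a" by (simp_all add: r_def)
  have conn: "cut_connected (parcs ?K) {x \<in> pverts ?K. \<phi> x = i}" (is "cut_connected _ ?F'")
    if i: "i \<in> pverts H" for i
  proof -
    let ?F = "{x \<in> pverts K. \<phi> x = i}"
    have F: "cut_connected (parcs K) ?F" using Q i by (simp add: bag_quotient_def)
    have F': "?F' = ?F - {v}" using pv by auto
    have uF: "u \<in> ?F \<longleftrightarrow> v \<in> ?F" using V uv(2) by simp
    show ?thesis unfolding cut_connected_def
    proof (intro conjI allI impI)
      have "?F \<noteq> {}" using F by (simp add: cut_connected_def)
      then show "?F' \<noteq> {}" using F' uF ne by blast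
    next
      fix P assume P: "P \<subset> ?F'" "P \<noteq> {}"
      show "\<exists>x\<in>P. \<exists>y\<in>?F' - P. (x, y) \<in> parcs ?K"
      proof (cases "u \<in> P")
        case True
        \<comment> \<open>A side of the cut that contains \<open>u\<close> is pulled back together
          with \<open>v\<close>, any other side unchanged; then \<open>r\<close> takes a crossing
          edge to a crossing edge.\<close>
        have "insert v P \<subset> ?F" using P F' True uF by blast
        then obtain x y where xy: "x \<in> insert v P" "y \<in> ?F - insert v P" "(x, y) \<in> parcs K"
          using F unfolding cut_connected_def by (metis insert_not_empty)
        have "r x \<in> P" using xy(1) True P F' ru by (cases "x = v") auto
        moreover have "r y = y" "y \<in> ?F' - P" using xy(2) F' ru by auto
        moreover have "r x \<noteq> y" using calculation by blast
        ultimately show ?thesis using paI[OF xy(3)] by auto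
      next
        case False
        have "P \<subset> ?F" using P F' by blast
        then obtain x y where xy: "x \<in> P" "y \<in> ?F - P" "(x, y) \<in> parcs K"
          using F P(2) unfolding cut_connected_def by meson
        have "x \<noteq> v" using xy(1) P F' by blast
        then have "r x = x" using ru by blast
        moreover have ry: "r y \<in> ?F' - P"
        proof (cases "y = v")
          case True
          then show ?thesis using xy(2) uF F' ne False ru by auto
        next
          case False
          then show ?thesis using xy(2) F' ru by auto
        qed
        moreover have "x \<noteq> r y" using ry xy(1) by blast
        ultimately show ?thesis using paI[OF xy(3)] xy(1) by auto
      qed
    qed
  qed
  have "pair_graph ?K" by (rule pair_graph_contract_edge[OF pair_graph uv(1)])
  moreover have "\<phi> ` pverts ?K = pverts H"
  proof -
    have "\<phi> v \<in> \<phi> ` (pverts K - {v})" using V ne uv(2) by (intro image_eqI[of _ _ u]) simp_all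
    then have "\<phi> ` pverts ?K = \<phi> ` pverts K"
      unfolding pv using V(2) by (metis image_insert insert_Diff insert_absorb)
    then show ?thesis using Q by (simp add: bag_quotient_def)
  qed
  moreover have "(\<phi> x, \<phi> y) \<in> parcs H" if xy: "(x, y) \<in> parcs ?K" "\<phi> x \<noteq> \<phi> y" for x y
  proof -
    obtain a b where ab: "(a, b) \<in> parcs K" "x = r a" "y = r b" using xy(1) unfolding pa by blast
    then have "\<phi> a \<noteq> \<phi> b" using xy(2) \<phi>r by simp
    then have "(\<phi> a, \<phi> b) \<in> parcs H" using Q ab(1) unfolding bag_quotient_def by blast
    then show ?thesis using ab \<phi>r by simp
  qed
  moreover have "i \<noteq> j \<and> (\<exists>x y. (x, y) \<in> parcs ?K \<and> \<phi> x = i \<and> \<phi> y = j)" if H: "(i, j) \<in> parcs H" for i j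
  proof -
    obtain a b where ab: "(a, b) \<in> parcs K" "\<phi> a = i" "\<phi> b = j" and ij: "i \<noteq> j"
      using Q H unfolding bag_quotient_def by blast
    then have "r a \<noteq> r b" using \<phi>r by metis
    then have "(r a, r b) \<in> parcs ?K" by (rule paI[OF ab(1)])
    then show ?thesis using \<phi>r ab(2,3) ij by blast
  qed
  ultimately show ?thesis using conn unfolding bag_quotient_def by blast
qed

text \<open>In a fibre with a second vertex, an edge crosses the cut \<open>{x}\<close>; contracting
  it lowers the number of vertices and preserves the quotient.\<close>

lemma bag_quotient_contracts:
  assumes "bag_quotient H \<phi> K" "contracts_to S K"
  shows "\<exists>K'. contracts_to S K' \<and> digraph_iso (with_proj K') (with_proj H)"
  using assms
proof (induction "card (pverts K)" arbitrary: K rule: less_induct)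
  case less
  interpret pair_graph K using less.prems by (simp add: bag_quotient_def)
  show ?case
  proof (cases "inj_on \<phi> (pverts K)")
    case True
    have "digraph_iso (with_proj K) (with_proj H)"
    proof (rule digraph_iso_pairI[OF pair_graph])
      show "bij_betw \<phi> (pverts K) (pverts H)"
        using True less.prems by (simp add: bij_betw_def bag_quotient_def)
      show "(\<phi> x, \<phi> y) \<in> parcs H" if "(x, y) \<in> parcs K" for x y
      proof -
        have "\<phi> x \<noteq> \<phi> y"
          using True that in_arcsD1[OF that] in_arcsD2[OF that] no_loops' by (meson inj_onD)
        then show ?thesis using less.prems that by (simp add: bag_quotient_def)
      qed
      show "\<exists>x y. (x, y) \<in> parcs K \<and> \<phi> x = i \<and> \<phi> y = j" if "(i, j) \<in> parcs H" for i j
        using less.prems(1) that unfolding bag_quotient_def by blast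
    qed
    then show ?thesis using less.prems by blast
  next
    case False
    then obtain x y where xy: "x \<in> pverts K" "y \<in> pverts K" "x \<noteq> y" "\<phi> x = \<phi> y"
      by (auto simp: inj_on_def)
    let ?F = "{z \<in> pverts K. \<phi> z = \<phi> x}"
    have "cut_connected (parcs K) ?F" using less.prems xy by (auto simp: bag_quotient_def)
    moreover have "{x} \<subset> ?F" "{x} \<noteq> {}" using xy by auto
    ultimately obtain x' z where "x' \<in> {x}" and z': "z \<in> ?F - {x}" "(x', z) \<in> parcs K"
      unfolding cut_connected_def by meson
    then have z: "z \<in> ?F" "(x, z) \<in> parcs K" by auto
    have "bag_quotient H \<phi> (contract_edge K x z)"
      by (rule bag_quotient_contract_edge[OF less.prems(1) z(2)]) (use z in simp)
    moreover have "contracts_to S (contract_edge K x z)"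
      by (rule contracts_to.step[OF less.prems(2) z(2)])
    moreover have "card (pverts (contract_edge K x z)) < card (pverts K)"
      using card_Diff1_less[OF pair_finite_verts, of z] z(1) by (simp add: contract_edge_def)
    ultimately show ?thesis using less.hyps by blast
  qed
qed

text \<open>Keep only the edges inside a hub or between a hub and a leaf. Sending the hubs to 0 and
  1 and the leaves to 2, ..., 6 is then a quotient map, which contractions realise.\<close>

lemma has_K25_minor:
  assumes "pair_graph G" "has_K25 (parcs G)"
  shows "minor_of (complete_bipartite_graph 2 5) G"
proof -
  interpret pair_graph G by fact
  let ?E = "parcs G" and ?H = "complete_bipartite_graph 2 5"
  obtain A B where A: "cut_connected ?E A" "cut_connected ?E B" "A \<inter> B = {}"
    "5 \<le> card (nbhd ?E A \<inter> nbhd ?E B)" using assms(2) unfolding has_K25_def by auto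
  obtain L where L: "L \<subseteq> nbhd ?E A \<inter> nbhd ?E B" "card L = 5"
    using obtain_subset_with_card_n[OF A(4)] by metis
  have LE: "L \<inter> A = {}" "L \<inter> B = {}" using L by (auto simp: nbhd_def)
  have finL: "finite L" using L(2) by (metis card.infinite zero_neq_numeral)
  \<comment> \<open>\<open>has_K25\<close> does not place its hubs inside the graph, but every
    vertex of a hub is the tail of an arc, to the rest of the hub or to a leaf.\<close>
  have hubV: "U \<subseteq> pverts G" if U: "cut_connected ?E U" "L \<subseteq> nbhd ?E U" for U
  proof
    fix x assume x: "x \<in> U"
    show "x \<in> pverts G"
    proof (cases "U = {x}")
      case True
      obtain l where "l \<in> L" using L(2) by fastforce
      then have "(x, l) \<in> ?E" using U(2) True by (auto simp: nbhd_def)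
      then show ?thesis by (rule in_arcsD1)
    next
      case False
      then have "{x} \<subset> U" using x by blast
      then obtain y where "(x, y) \<in> ?E"
        using U(1) unfolding cut_connected_def by (metis insert_not_empty singletonD)
      then show ?thesis by (rule in_arcsD1)
    qed
  qed
  have V: "A \<subseteq> pverts G" "B \<subseteq> pverts G" "L \<subseteq> pverts G"
    using hubV A L by (auto simp: nbhd_def dest: in_arcsD2)
  obtain g where g: "bij_betw g L {2..<7::nat}"
    using finite_same_card_bij[OF finL, of "{2..<7::nat}"] L(2) by auto
  define \<phi> where "\<phi> x = (if x \<in> A then 0 else if x \<in> B then 1 else g x)" for x
  have gL: "g x \<in> {2..<7}" if "x \<in> L" for x using g that by (auto simp: bij_betw_def)
  have \<phi>: "x \<in> A \<Longrightarrow> \<phi> x = 0" "x \<in> B \<Longrightarrow> \<phi> x = 1" "x \<in> L \<Longrightarrow> \<phi> x = g x" for x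
    using A(3) LE by (auto simp: \<phi>_def)
  define S where "S = \<lparr>pverts = A \<union> B \<union> L,
    parcs = {(x, y) \<in> ?E. (x, y) \<in> (A \<times> A) \<union> (B \<times> B) \<union> ((A \<union> B) \<times> L) \<union> (L \<times> (A \<union> B))}\<rparr>"
  have pS: "(x, y) \<in> parcs S \<longleftrightarrow> (x, y) \<in> ?E \<and>
    (x, y) \<in> (A \<times> A) \<union> (B \<times> B) \<union> ((A \<union> B) \<times> L) \<union> (L \<times> (A \<union> B))" for x y by (auto simp: S_def)
  have vS: "pverts S = A \<union> B \<union> L" by (simp add: S_def)
  have gS: "pair_graph S"
  proof
    show "finite (pverts S)" using V pair_finite_verts unfolding vS by (meson finite_Un finite_subset)
    show "finite (parcs S)" by (rule finite_subset[OF _ pair_finite_arcs]) (auto simp: S_def)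
    show "symmetric (with_proj S)" using arcs_symmetric by (auto simp: symmetric_def sym_def pS)
    show "fst e \<in> pverts S" "snd e \<in> pverts S" if "e \<in> parcs S" for e
      using that by (auto simp: S_def)
    show "fst e \<noteq> snd e" if "e \<in> parcs S" for e using that no_loops' by (auto simp: S_def)
  qed
  have fib: "{x \<in> pverts S. \<phi> x = 0} = A" "{x \<in> pverts S. \<phi> x = 1} = B"
    "\<And>l. l \<in> L \<Longrightarrow> {x \<in> pverts S. \<phi> x = g l} = {l}"
  proof -
    have in_S: "\<phi> x = 0 \<longleftrightarrow> x \<in> A" "\<phi> x = 1 \<longleftrightarrow> x \<in> B" "l \<in> L \<Longrightarrow> \<phi> x = g l \<longleftrightarrow> x = l"
      if x: "x \<in> pverts S" for x l
    proof -
      have injg: "g x = g l \<longleftrightarrow> x = l" if "x \<in> L" "l \<in> L"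
        using g that by (auto simp: bij_betw_def dest: inj_onD)
      have gl: "g l \<noteq> 0" "g l \<noteq> 1" if "l \<in> L" for l using gL[OF that] by auto
      consider "x \<in> A" "x \<notin> B" "x \<notin> L" | "x \<in> B" "x \<notin> A" "x \<notin> L" | "x \<in> L" "x \<notin> A" "x \<notin> B"
        using x A(3) LE unfolding vS by blast
      then show "\<phi> x = 0 \<longleftrightarrow> x \<in> A" "\<phi> x = 1 \<longleftrightarrow> x \<in> B" "l \<in> L \<Longrightarrow> \<phi> x = g l \<longleftrightarrow> x = l"
        by (cases; use \<phi>[of x] gl[of x] gl[of l] injg in auto)+
    qed
    show "{x \<in> pverts S. \<phi> x = 0} = A" "{x \<in> pverts S. \<phi> x = 1} = B"
      using in_S(1,2) unfolding vS by blast+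
    show "{x \<in> pverts S. \<phi> x = g l} = {l}" if "l \<in> L" for l
      using in_S(3)[OF _ that] that unfolding vS by blast
  qed
  have lt: "\<phi> x < 2" if "x \<in> A \<union> B" for x using that \<phi> by auto
  have ge: "\<phi> x \<in> {2..<7}" if "x \<in> L" for x using that \<phi> gL by simp
  have conS: "cut_connected (parcs S) U" if U: "cut_connected ?E U" "U = A \<or> U = B" for U
    unfolding cut_connected_def
  proof (intro conjI allI impI)
    show "U \<noteq> {}" using U by (simp add: cut_connected_def)
    fix P assume "P \<subset> U" "P \<noteq> {}"
    then obtain x y where "x \<in> P" "y \<in> U - P" "(x, y) \<in> ?E"
      using U(1) unfolding cut_connected_def by meson
    then show "\<exists>x\<in>P. \<exists>y\<in>U - P. (x, y) \<in> parcs S"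
      using U(2) \<open>P \<subset> U\<close> unfolding pS by blast
  qed
  have cases: "i = 0 \<or> i = 1 \<or> (\<exists>l\<in>L. i = g l)" if "i \<in> pverts ?H" for i
  proof -
    have "i = 0 \<or> i = 1 \<or> i \<in> {2..<7}" using that by (auto simp: complete_bipartite_graph_def)
    then show ?thesis using g by (auto simp: bij_betw_def)
  qed
  have "bag_quotient ?H \<phi> S" unfolding bag_quotient_def
  proof (intro conjI allI impI ballI)
    show "\<phi> ` pverts S = pverts ?H"
    proof
      show "\<phi> ` pverts S \<subseteq> pverts ?H"
      proof (rule image_subsetI)
        fix x assume "x \<in> pverts S"
        then have "\<phi> x < 2 \<or> \<phi> x \<in> {2..<7}" using lt ge unfolding vS by blast
        then show "\<phi> x \<in> pverts ?H" by (auto simp: complete_bipartite_graph_def)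
      qed
      show "pverts ?H \<subseteq> \<phi> ` pverts S"
      proof
        fix i assume i: "i \<in> pverts ?H"
        have "A \<noteq> {}" "B \<noteq> {}" using A by (auto simp: cut_connected_def)
        then have "\<exists>x\<in>A \<union> B \<union> L. \<phi> x = i" using cases[OF i] \<phi> by blast
        then show "i \<in> \<phi> ` pverts S" unfolding vS by blast
      qed
    qed
    fix i assume "i \<in> pverts ?H"
    then show "cut_connected (parcs S) {x \<in> pverts S. \<phi> x = i}"
      using cases[of i] fib conS A by auto
  next
    fix x y assume "(x, y) \<in> parcs S" "\<phi> x \<noteq> \<phi> y"
    then show "(\<phi> x, \<phi> y) \<in> parcs ?H"
    proof -
      have "\<not> (x \<in> A \<and> y \<in> A)" "\<not> (x \<in> B \<and> y \<in> B)"
        using \<open>\<phi> x \<noteq> \<phi> y\<close> \<phi>(1,2) by metis+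
      then have "x \<in> A \<union> B \<and> y \<in> L \<or> x \<in> L \<and> y \<in> A \<union> B"
        using \<open>(x, y) \<in> parcs S\<close> unfolding pS by blast
      then have "\<phi> x < 2 \<and> \<phi> y \<in> {2..<7} \<or> \<phi> x \<in> {2..<7} \<and> \<phi> y < 2"
        using lt ge by blast
      then show ?thesis by (auto simp: complete_bipartite_graph_def)
    qed
  next
    fix i j assume ij: "(i, j) \<in> parcs ?H"
    then show "i \<noteq> j" by (auto simp: complete_bipartite_graph_def)
    have *: "\<exists>x y. (x, y) \<in> parcs S \<and> \<phi> x = k \<and> \<phi> y = g l" if kl: "k < 2" "l \<in> L" for k l
    proof -
      have "k = 0 \<or> k = 1" using kl by auto
      then show ?thesis
      proof
        assume "k = 0"
        obtain a where "a \<in> A" "(a, l) \<in> ?E" using L kl by (auto simp: nbhd_def)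
        then show ?thesis using \<phi> kl \<open>k = 0\<close> unfolding pS by blast
      next
        assume "k = 1"
        obtain b where "b \<in> B" "(b, l) \<in> ?E" using L kl by (auto simp: nbhd_def)
        then show ?thesis using \<phi> kl \<open>k = 1\<close> unfolding pS by blast
      qed
    qed
    have symS: "(y, x) \<in> parcs S" if "(x, y) \<in> parcs S" for x y
      using that arcs_symmetric unfolding pS by blast
    have "\<exists>l\<in>L. k = g l" if "k \<in> {2..<7}" for k using g that by (auto simp: bij_betw_def)
    moreover have "i < 2 \<and> j \<in> {2..<7} \<or> j < 2 \<and> i \<in> {2..<7}"
      using ij by (auto simp: complete_bipartite_graph_def)
    ultimately show "\<exists>x y. (x, y) \<in> parcs S \<and> \<phi> x = i \<and> \<phi> y = j"
      using * symS by metis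
  qed (rule gS)
  then obtain K where "contracts_to S K" "digraph_iso (with_proj K) (with_proj ?H)"
    using bag_quotient_contracts[OF _ contracts_to.refl] by blast
  moreover have "subgraph (with_proj S) (with_proj G)"
  proof (rule subgraphI)
    show "wf_digraph (with_proj S)"
      using gS wf_digraph_wp_iff pair_graph.axioms(1) pair_digraph.axioms(1) pair_fin_digraph.axioms(1) by blast
    show "wf_digraph (with_proj G)" by (rule wf_digraph_axioms)
    show "compatible (with_proj G) (with_proj S)" by (rule compatibleI_with_proj)
    show "arcs (with_proj S) \<subseteq> arcs (with_proj G)" by (auto simp: S_def)
  qed (use V in \<open>auto simp: vS\<close>)
  ultimately show ?thesis unfolding minor_of_def using gS by blast
qed

text \<open>Each vertex of \<open>K\<close> stands for the vertices of \<open>S\<close> merged into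
  it. Contracting an edge unites two bags with an edge between them, which keeps the union
  connected.\<close>

lemma contracts_to_bags:
  assumes "contracts_to S K" "pair_graph S"
  shows "pair_graph K \<and> (\<exists>B. (\<forall>v\<in>pverts K. cut_connected (parcs S) (B v) \<and> B v \<subseteq> pverts S) \<and>
    (\<forall>u\<in>pverts K. \<forall>v\<in>pverts K. u \<noteq> v \<longrightarrow> B u \<inter> B v = {}) \<and>
    (\<forall>u v. (u, v) \<in> parcs K \<longrightarrow> (\<exists>x\<in>B u. \<exists>y\<in>B v. (x, y) \<in> parcs S)))"
  using assms
proof (induction rule: contracts_to.induct)
  case (refl G)
  then show ?case by (intro conjI exI[of _ "\<lambda>v. {v}"]) auto
next
  case (step G K u v)
  then have K: "pair_graph K" by blast
  obtain B where B': "\<forall>v\<in>pverts K. cut_connected (parcs G) (B v) \<and> B v \<subseteq> pverts G"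
    "\<forall>u\<in>pverts K. \<forall>v\<in>pverts K. u \<noteq> v \<longrightarrow> B u \<inter> B v = {}"
    "\<forall>u v. (u, v) \<in> parcs K \<longrightarrow> (\<exists>x\<in>B u. \<exists>y\<in>B v. (x, y) \<in> parcs G)"
      using step by blast
  have B: "\<And>v. v \<in> pverts K \<Longrightarrow> cut_connected (parcs G) (B v) \<and> B v \<subseteq> pverts G"
    "\<And>u v. u \<in> pverts K \<Longrightarrow> v \<in> pverts K \<Longrightarrow> u \<noteq> v \<Longrightarrow> B u \<inter> B v = {}"
    "\<And>u v. (u, v) \<in> parcs K \<Longrightarrow> \<exists>x\<in>B u. \<exists>y\<in>B v. (x, y) \<in> parcs G"
    using B'(1) B'(2) B'(3) by (simp, metis, metis)
  interpret K: pair_graph K by fact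
  interpret G: pair_graph G by fact
  have uv: "u \<in> pverts K" "v \<in> pverts K" "u \<noteq> v"
    using K.in_arcsD1[OF step.hyps(2)] K.in_arcsD2[OF step.hyps(2)] K.no_loops' step.hyps(2) by auto
  have symG: "sym (parcs G)" using G.arcs_symmetric by (auto simp: sym_def)
  define C where "C = B(u := B u \<union> B v)"
  have pv: "pverts (contract_edge K u v) = pverts K - {v}" by (simp add: contract_edge_def)
  have c: "cut_connected (parcs G) (B u \<union> B v)"
    by (rule cut_connected_Un[OF symG]) (use B(1) uv B(3)[OF step.hyps(2)] in auto)
  have Csup: "B a \<subseteq> C ((id(v := u)) a)" for a using uv(3) by (auto simp: C_def)
  have "(\<forall>w\<in>pverts K - {v}. cut_connected (parcs G) (C w) \<and> C w \<subseteq> pverts G)"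
    using B(1) c uv by (auto simp: C_def)
  moreover have "(\<forall>x\<in>pverts K - {v}. \<forall>y\<in>pverts K - {v}. x \<noteq> y \<longrightarrow> C x \<inter> C y = {})"
  proof (intro ballI impI)
    fix x y assume xy: "x \<in> pverts K - {v}" "y \<in> pverts K - {v}" "x \<noteq> y"
    then show "C x \<inter> C y = {}"
      using B(2)[of x y] B(2)[of u y] B(2)[of v y] B(2)[of x u] B(2)[of x v] uv
      by (auto simp: C_def)
  qed
  moreover have "(\<forall>x y. (x, y) \<in> parcs (contract_edge K u v) \<longrightarrow> (\<exists>s\<in>C x. \<exists>t\<in>C y. (s, t) \<in> parcs G))"
  proof (intro allI impI)
    fix x y assume "(x, y) \<in> parcs (contract_edge K u v)"
    then obtain a b where ab: "(a, b) \<in> parcs K" "x = (id(v := u)) a" "y = (id(v := u)) b"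
      by (auto simp: contract_edge_def)
    then show "\<exists>s\<in>C x. \<exists>t\<in>C y. (s, t) \<in> parcs G"
      using B(3)[OF ab(1)] Csup[of a] Csup[of b] by blast
  qed
  ultimately show ?case
    unfolding pv using pair_graph_contract_edge[OF K step.hyps(2)] by (intro conjI exI[of _ C]) auto
qed

lemma minor_of_bags:
  assumes "pair_graph G" "minor_of H G" "pair_graph H"
  obtains B where
    "\<And>i. i \<in> pverts H \<Longrightarrow> cut_connected (parcs G) (B i) \<and> B i \<subseteq> pverts G"
    "\<And>i j. i \<in> pverts H \<Longrightarrow> j \<in> pverts H \<Longrightarrow> i \<noteq> j \<Longrightarrow> B i \<inter> B j = {}"
    "\<And>i j. (i, j) \<in> parcs H \<Longrightarrow> \<exists>x\<in>B i. \<exists>y\<in>B j. (x, y) \<in> parcs G"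
proof -
  obtain S K where SK: "pair_graph S" "subgraph (with_proj S) (with_proj G)" "contracts_to S K"
    "digraph_iso (with_proj K) (with_proj H)" using assms(2) unfolding minor_of_def by blast
  have sub: "pverts S \<subseteq> pverts G" "parcs S \<subseteq> parcs G"
    using SK(2) by (auto simp: subgraph_def)
  obtain B where K: "pair_graph K"
    and B: "\<And>v. v \<in> pverts K \<Longrightarrow> cut_connected (parcs S) (B v) \<and> B v \<subseteq> pverts S"
    "\<And>u v. u \<in> pverts K \<Longrightarrow> v \<in> pverts K \<Longrightarrow> u \<noteq> v \<Longrightarrow> B u \<inter> B v = {}"
    "\<And>u v. (u, v) \<in> parcs K \<Longrightarrow> \<exists>x\<in>B u. \<exists>y\<in>B v. (x, y) \<in> parcs S"
    using contracts_to_bags[OF SK(3,1)] by metis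
  interpret H: pair_graph H by fact
  obtain \<phi> where \<phi>: "bij_betw \<phi> (pverts K) (pverts H)"
    "\<And>x y. x \<in> pverts K \<Longrightarrow> y \<in> pverts K \<Longrightarrow> (x, y) \<in> parcs K \<longleftrightarrow> (\<phi> x, \<phi> y) \<in> parcs H"
    using digraph_iso_pairE[OF K SK(4)] by blast
  define \<psi> where "\<psi> = the_inv_into (pverts K) \<phi>"
  have \<psi>: "\<psi> i \<in> pverts K" "\<phi> (\<psi> i) = i" if "i \<in> pverts H" for i
    using \<phi>(1) that unfolding \<psi>_def bij_betw_def
    by (auto simp: f_the_inv_into_f the_inv_into_into)
  have mono: "cut_connected (parcs G) U" if "cut_connected (parcs S) U" for U
    using that sub(2) unfolding cut_connected_def by (meson subsetD)
  show ?thesis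
  proof (rule that[of "\<lambda>i. B (\<psi> i)"])
    show "cut_connected (parcs G) (B (\<psi> i)) \<and> B (\<psi> i) \<subseteq> pverts G" if "i \<in> pverts H" for i
      using B(1)[OF \<psi>(1)[OF that]] mono sub(1) by blast
    show "B (\<psi> i) \<inter> B (\<psi> j) = {}" if "i \<in> pverts H" "j \<in> pverts H" "i \<noteq> j" for i j
      using B(2) \<psi> that by metis
    show "\<exists>x\<in>B (\<psi> i). \<exists>y\<in>B (\<psi> j). (x, y) \<in> parcs G" if "(i, j) \<in> parcs H" for i j
    proof -
      have "i \<in> pverts H" "j \<in> pverts H" using that H.in_arcsD1 H.in_arcsD2 by blast+
      then have "(\<psi> i, \<psi> j) \<in> parcs K" using \<phi>(2) \<psi> that by simp
      then show ?thesis using B(3) sub(2) by blast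
    qed
  qed
qed

text \<open>Passing to the symmetric closure adds no arcs, as \<open>G\<close> is symmetric. A walk
  leaving a part crosses its cut; conversely, no edge leaves the set of vertices reached from
  \<open>u\<close>.\<close>

lemma connected_iff_cut_connected:
  assumes "pair_graph G" "U \<subseteq> pverts G"
  shows "Digraph_Component.connected (induce_subgraph (with_proj G) U) \<longleftrightarrow> cut_connected (parcs G) U"
proof -
  interpret pair_graph G by fact
  let ?I = "induce_subgraph (with_proj G) U"
  let ?M = "mk_symmetric ?I"
  have M: "pverts ?M = U" "\<And>x y. (x, y) \<in> parcs ?M \<longleftrightarrow> (x, y) \<in> parcs G \<and> x \<in> U \<and> y \<in> U"
    using arcs_symmetric by (auto simp: parcs_mk_symmetric induce_subgraph_def with_proj_def)
  have reach: "u \<rightarrow>\<^sup>*\<^bsub>with_proj ?M\<^esub> v \<longleftrightarrow> (u, v) \<in> rtrancl_on U (parcs ?M)" for u v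
    by (simp add: reachable_def M)
  show ?thesis
  proof
    assume c: "Digraph_Component.connected ?I"
    show "cut_connected (parcs G) U" unfolding cut_connected_def
    proof (intro conjI allI impI)
      show "U \<noteq> {}" using c M(1) by (auto simp: connected_def strongly_connected_def)
      fix P assume P: "P \<subset> U" "P \<noteq> {}"
      then obtain x y where xy: "x \<in> P" "y \<in> U - P" by blast
      then have "(x, y) \<in> rtrancl_on U (parcs ?M)"
        using c P M(1) reach unfolding connected_def strongly_connected_def by auto
      then have "y \<in> P \<or> (\<exists>x\<in>P. \<exists>y\<in>U - P. (x, y) \<in> parcs G)"
        using xy(1)
      proof (induction rule: rtrancl_on.induct)
        case (rtrancl_on_into_rtrancl_on a b c)
        then show ?case using M(2) by blast
      qed simp
      then show "\<exists>x\<in>P. \<exists>y\<in>U - P. (x, y) \<in> parcs G" using xy by blast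
    qed
  next
    assume c: "cut_connected (parcs G) U"
    show "Digraph_Component.connected ?I" unfolding connected_def
    proof (rule strongly_connectedI)
      show "verts (with_proj ?M) \<noteq> {}" using c M(1) by (auto simp: cut_connected_def)
      fix u v assume "u \<in> verts (with_proj ?M)" "v \<in> verts (with_proj ?M)"
      then have uv: "u \<in> U" "v \<in> U" using M(1) by auto
      define P where "P = {w \<in> U. (u, w) \<in> rtrancl_on U (parcs ?M)}"
      have "u \<in> P" using uv by (simp add: P_def)
      have "P = U"
      proof (rule ccontr)
        assume "P \<noteq> U"
        then have "P \<subset> U" "P \<noteq> {}" using \<open>u \<in> P\<close> by (auto simp: P_def)
        then obtain x y where xy: "x \<in> P" "y \<in> U - P" "(x, y) \<in> parcs G"
          using c unfolding cut_connected_def by meson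
        then have "(u, y) \<in> rtrancl_on U (parcs ?M)"
          using M(2) by (auto simp: P_def intro: rtrancl_on_into_rtrancl_on)
        then show False using xy by (simp add: P_def)
      qed
      then show "u \<rightarrow>\<^sup>*\<^bsub>with_proj ?M\<^esub> v" using uv reach by (auto simp: P_def)
    qed
  qed
qed

lemma k_connected_iff:
  assumes "pair_graph G"
  shows "k_connected k G \<longleftrightarrow> k < card (pverts G) \<and>
    (\<forall>X \<subseteq> pverts G. card X < k \<longrightarrow> cut_connected (parcs G) (pverts G - X))"
  unfolding k_connected_def using connected_iff_cut_connected[OF assms] by (metis Diff_subset)

section \<open>The square of a cycle: connectivity and \<open>K\<^bsub>2,5\<^esub>\<close>\<close>

text \<open>All integers serve as positions, with period \<open>n\<close>. Intervals and reflection
  are then a matter of linear arithmetic, since each vertex has a position in any given window of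
  length \<open>n\<close>.\<close>

locale cyclic_square =
  fixes n :: int and vt :: "int \<Rightarrow> 'a" and V :: "'a set" and E :: "('a \<times> 'a) set"
  assumes n: "5 \<le> n" and vt_eq: "vt i = vt j \<longleftrightarrow> n dvd j - i" and V: "V = range vt"
    and E: "(vt i, vt j) \<in> E \<longleftrightarrow> (\<exists>d\<in>{-2, -1, 1, 2}. n dvd j - i - d)"
begin

lemma reflection: "cyclic_square n (\<lambda>i. vt (- i)) V E"
proof
  show "5 \<le> n" by (rule n)
  show "vt (- i) = vt (- j) \<longleftrightarrow> n dvd j - i" for i j
    unfolding vt_eq by (metis dvd_minus_iff minus_diff_eq minus_diff_minus)
  show "V = range (\<lambda>i. vt (- i))"
  proof -
    have "x \<in> range (\<lambda>i. vt (- i))" if "x \<in> range vt" for x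
    proof -
      obtain i where "x = vt i" using \<open>x \<in> range vt\<close> by blast
      then have "x = vt (- (- i))" by simp
      then show ?thesis by blast
    qed
    then show ?thesis unfolding V by blast
  qed
  show "(vt (- i), vt (- j)) \<in> E \<longleftrightarrow> (\<exists>d\<in>{-2, -1, 1, 2}. n dvd j - i - d)" for i j
  proof -
    have "n dvd - j - - i - d \<longleftrightarrow> n dvd j - i - (- d)" for d
      by (metis add.commute dvd_minus_iff minus_add_distrib minus_minus uminus_add_conv_diff)
    then show ?thesis unfolding E by auto
  qed
qed

lemma obtain_in_window:
  assumes "x \<in> V" obtains i where "vt i = x" "a \<le> i" "i < a + n"
proof -
  obtain j where j: "x = vt j" using assms V by blast
  define i where "i = a + (j - a) mod n"
  have "(j - a) mod n < n" "0 \<le> (j - a) mod n" using n by simp_all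
  moreover have "n dvd j - i"
    unfolding i_def by (metis diff_diff_eq dvd_minus_mod)
  ultimately show ?thesis using that[of i] j vt_eq[of i j] by (simp add: i_def)
qed

lemma vt_period: "vt (i + n) = vt i"
  unfolding vt_eq by simp

lemma vt_shift: "vt (i + k) = vt (j + k) \<longleftrightarrow> vt i = vt j"
  unfolding vt_eq by simp

lemma adjacent:
  assumes "1 \<le> \<bar>i - j\<bar>" "\<bar>i - j\<bar> \<le> 2" shows "(vt i, vt j) \<in> E"
proof -
  have "j - i \<in> {-2, -1, 1, 2}" using assms by auto
  moreover have "n dvd j - i - (j - i)" by simp
  ultimately show ?thesis unfolding E by blast
qed

lemma obtain_adjacent:
  assumes "(vt i, y) \<in> E" "y \<in> V"
  obtains j where "vt j = y" "1 \<le> \<bar>i - j\<bar>" "\<bar>i - j\<bar> \<le> 2"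
proof -
  obtain k where k: "y = vt k" using assms V by blast
  then obtain d where d: "d \<in> {-2, -1, 1, 2}" "n dvd k - i - d" using assms(1) E by blast
  then have "vt (i + d) = y" unfolding k vt_eq by (simp add: algebra_simps)
  then show ?thesis using that[of "i + d"] d(1) by auto
qed

lemma symE: "(x, y) \<in> E \<Longrightarrow> x \<in> V \<Longrightarrow> y \<in> V \<Longrightarrow> (y, x) \<in> E"
proof -
  assume xy: "(x, y) \<in> E" "x \<in> V" "y \<in> V"
  obtain i where i: "x = vt i" using xy(2) V by blast
  obtain j where "vt j = y" "1 \<le> \<bar>i - j\<bar>" "\<bar>i - j\<bar> \<le> 2"
    by (rule obtain_adjacent[OF xy(1)[unfolded i] xy(3)])
  then show "(y, x) \<in> E" using adjacent[of j i] i by (simp add: abs_minus_commute)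
qed

definition barrier :: "'a set \<Rightarrow> int \<Rightarrow> bool" where
  "barrier Q i \<longleftrightarrow> vt i \<notin> Q \<and> \<not> (vt (i - 1) \<in> Q \<and> vt (i + 1) \<in> Q)"

text \<open>An edge joins positions at distance at most 2, so it can only jump over a vertex whose two
  cyclic neighbours are its ends.\<close>

lemma barriers_separate:
  assumes Q: "cut_connected E Q" "Q \<subseteq> V" and b: "barrier Q b" "barrier Q b'"
    and i: "b < i" "i < b'" "vt i \<in> Q" and j: "b' < j" "j < b + n" "vt j \<in> Q"
  shows False
proof -
  define I where "I = vt ` {b<..<b'}"
  have "vt j \<notin> I"
  proof
    assume "vt j \<in> I"
    then obtain k where k: "b < k" "k < b'" "vt k = vt j" unfolding I_def by force
    then have "n dvd j - k" by (simp add: vt_eq)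
    then have "n \<le> j - k" using k(2) j(1) by (intro zdvd_imp_le) auto
    then show False using k(1) j(2) by linarith
  qed
  then have "Q \<inter> I \<subset> Q" "Q \<inter> I \<noteq> {}" using i j by (auto simp: I_def)
  then obtain x y where xy: "x \<in> Q \<inter> I" "y \<in> Q - (Q \<inter> I)" "(x, y) \<in> E"
    using Q(1) unfolding cut_connected_def by meson
  then obtain k where k: "x = vt k" "b < k" "k < b'" by (auto simp: I_def)
  have "y \<in> V" using xy(2) Q(2) by blast
  with xy(3)[unfolded k(1)] obtain l where l: "vt l = y" "1 \<le> \<bar>k - l\<bar>" "\<bar>k - l\<bar> \<le> 2"
    by (rule obtain_adjacent)
  have "vt l \<in> Q" "vt k \<in> Q" "l \<notin> {b<..<b'}" using l xy k(1) by (auto simp: I_def)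
  moreover have "l \<noteq> b" "l \<noteq> b'" using calculation(1) b by (auto simp: barrier_def)
  ultimately have "l < b \<or> b' < l" by auto
  then have "l = b - 1 \<and> k = b + 1 \<or> k = b' - 1 \<and> l = b' + 1" using k(2,3) l(3) by linarith
  then show False using b \<open>vt l \<in> Q\<close> \<open>vt k \<in> Q\<close> by (auto simp: barrier_def)
qed

text \<open>Going to the right, each of two parts separated by \<open>X\<close> is stopped by two
  consecutive vertices of \<open>X\<close>. The two stopping pairs are disjoint, so \<open>X\<close>
  would have four elements.\<close>

lemma square_4_connected:
  assumes X: "X \<subseteq> V" "finite X" "card X < 4" and ne: "V - X \<noteq> {}"
  shows "cut_connected E (V - X)"
proof (rule ccontr)
  assume "\<not> ?thesis"
  then obtain P where P: "P \<subset> V - X" "P \<noteq> {}" and no: "\<And>x y. x \<in> P \<Longrightarrow> y \<in> V - X - P \<Longrightarrow> (x, y) \<notin> E"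
    using ne unfolding cut_connected_def by blast
  have exit: "\<exists>i. vt i \<in> R \<and> vt (i + 1) \<in> X \<and> vt (i + 2) \<in> X"
    if R: "R \<noteq> {}" "R \<subset> V - X" and nR: "\<And>x y. x \<in> R \<Longrightarrow> y \<in> V - X - R \<Longrightarrow> (x, y) \<notin> E" for R
  proof -
    \<comment> \<open>If \<open>R\<close> were never stopped, it would contain one of any two
      consecutive vertices, hence a neighbour of every vertex of the other part.\<close>
    have "\<exists>i. vt i \<in> R \<and> vt (i + 1) \<notin> R \<and> vt (i + 2) \<notin> R"
    proof (rule ccontr)
      assume con: "\<not> ?thesis"
      obtain x where "x \<in> R" using R by blast
      then obtain a where a: "vt a \<in> R" using R V by blast
      have step: "vt (a + int m) \<in> R \<or> vt (a + int m + 1) \<in> R" for m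
      proof (induction m)
        case (Suc m)
        have "a + int (Suc m) = a + int m + 1" "a + int m + 1 + 1 = a + int m + 2" by simp_all
        then show ?case using Suc con by metis
      qed (simp add: a)
      obtain y where y: "y \<in> V - X - R" using R by blast
      then obtain j where j: "vt j = y" "a \<le> j" "j < a + n" using obtain_in_window[of y a] by blast
      have "a + int (nat (j - a)) = j" using j by simp
      then have "vt (j + 1) \<in> R" using step[of "nat (j - a)"] j(1) y by auto
      moreover have "(vt (j + 1), vt j) \<in> E" by (rule adjacent) auto
      ultimately show False using nR y j(1) by blast
    qed
    then obtain i where i: "vt i \<in> R" "vt (i + 1) \<notin> R" "vt (i + 2) \<notin> R" by blast
    have "(vt i, vt (i + 1)) \<in> E" "(vt i, vt (i + 2)) \<in> E" by (auto intro: adjacent)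
    then have "vt (i + 1) \<in> X" "vt (i + 2) \<in> X" using nR i V by blast+
    then show ?thesis using i by blast
  qed
  define Q where "Q = V - X - P"
  have Q: "Q \<noteq> {}" "Q \<subset> V - X" using P by (auto simp: Q_def)
  have nQ: "(x, y) \<notin> E" if "x \<in> Q" "y \<in> V - X - Q" for x y
    using no[of y x] that P(1) symE[of x y] by (auto simp: Q_def)
  obtain i where i: "vt i \<in> P" "vt (i + 1) \<in> X" "vt (i + 2) \<in> X" using exit[OF P(2,1) no] by blast
  obtain j where j: "vt j \<in> Q" "vt (j + 1) \<in> X" "vt (j + 2) \<in> X" using exit[OF Q nQ] by blast
  have PX: "P \<inter> X = {}" "Q \<inter> X = {}" "P \<inter> Q = {}" using P(1) by (auto simp: Q_def)
  \<comment> \<open>Shifting an equality of this kind back by one would put a vertex outside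
    \<open>X\<close> into \<open>X\<close>.\<close>
  have s: "vt (k + 1) \<noteq> vt (l + 2)" if "vt k \<notin> X" "vt (l + 1) \<in> X" for k l
    using vt_shift[of k 1 "l + 1"] that by (auto simp: add.assoc)
  have "vt (i + 1) \<noteq> vt (i + 2)" "vt (i + 1) \<noteq> vt (j + 2)" "vt (j + 1) \<noteq> vt (j + 2)" "vt (j + 1) \<noteq> vt (i + 2)"
    using s i j PX by blast+
  moreover have "vt (i + 1) \<noteq> vt (j + 1)" "vt (i + 2) \<noteq> vt (j + 2)"
    using i(1) j(1) PX(3) unfolding vt_shift by auto
  ultimately have "card {vt (i + 1), vt (i + 2), vt (j + 1), vt (j + 2)} = 4" by auto
  moreover have "card {vt (i + 1), vt (i + 2), vt (j + 1), vt (j + 2)} \<le> card X"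
    using i j by (intro card_mono[OF X(2)]) simp
  ultimately show False using X(3) by linarith
qed

section \<open>Ends of a connected set, and the vertices it jumps over\<close>

definition enclosed :: "'a set \<Rightarrow> int \<Rightarrow> bool" where
  "enclosed H i \<longleftrightarrow> vt i \<notin> H \<and> vt (i - 1) \<in> H \<and> vt (i + 1) \<in> H"

text \<open>Two free positions are demanded because an edge of the square jumps over a single one; a
  gap of length one is no end.\<close>

definition right_end :: "'a set \<Rightarrow> int \<Rightarrow> bool" where
  "right_end H e \<longleftrightarrow> vt e \<in> H \<and> vt (e + 1) \<notin> H \<and> vt (e + 2) \<notin> H"

lemma enclosed_cong:
  assumes "vt i = vt j" shows "enclosed H i \<longleftrightarrow> enclosed H j"
proof -
  have "vt (i + 1) = vt (j + 1)" "vt (i - 1) = vt (j - 1)"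
    using vt_shift[of i 1 j] vt_shift[of i "-1" j] assms by simp_all
  then show ?thesis unfolding enclosed_def using assms by metis
qed

lemma obtain_shift:
  assumes "vt a \<noteq> vt b" obtains c where "vt c = vt b" "a < c" "c < a + n"
proof -
  have "vt b \<in> V" using V by blast
  then obtain c where c: "vt c = vt b" "a \<le> c" "c < a + n" by (rule obtain_in_window)
  have "c \<noteq> a" using assms c(1) by metis
  then have "a < c" using c(2) by linarith
  then show ?thesis by (rule that[OF c(1) _ c(3)])
qed

lemma obtain_last_before:
  assumes "vt m \<in> H" "m < q"
  obtains l where "m \<le> l" "l < q" "vt l \<in> H" "\<forall>i. l < i \<longrightarrow> i < q \<longrightarrow> vt i \<notin> H"
proof -
  define X where "X = {l \<in> {m..<q}. vt l \<in> H}"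
  have "X \<subseteq> {m..<q}" unfolding X_def by blast
  then have X: "finite X" "m \<in> X"
    using assms finite_subset[of X "{m..<q}"] unfolding X_def by simp_all
  then have "Max X \<in> X" using Max_in[OF X(1)] by blast
  moreover have "vt i \<notin> H" if "Max X < i" "i < q" for i
  proof
    assume "vt i \<in> H"
    then have "i \<in> X" using that calculation unfolding X_def by simp
    then have "i \<le> Max X" by (rule Max_ge[OF X(1)])
    then show False using that(1) by linarith
  qed
  moreover have "m \<le> l \<and> l < q \<and> vt l \<in> H" if "l \<in> X" for l
    using that by (simp add: X_def)
  ultimately have "m \<le> Max X" "Max X < q" "vt (Max X) \<in> H" "\<forall>i. Max X < i \<longrightarrow> i < q \<longrightarrow> vt i \<notin> H"
    by blast+
  then show ?thesis by (rule that)
qed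

text \<open>The position after a right end is a barrier for \<open>H\<close>, and two different ends
  would give two barriers with vertices of \<open>H\<close> on both sides.\<close>

lemma right_end_unique:
  assumes H: "cut_connected E H" "H \<subseteq> V" and e: "right_end H e" "right_end H e'"
  shows "vt e = vt e'"
proof (rule ccontr)
  assume "vt e \<noteq> vt e'"
  then obtain d where d: "vt d = vt e'" "e < d" "d < e + n" by (rule obtain_shift)
  have rd: "right_end H d" using e(2) vt_shift[of d 1 e'] vt_shift[of d 2 e'] d(1) by (simp add: right_end_def)
  have b: "barrier H (i + 1)" if "right_end H i" for i
    using that by (auto simp: barrier_def right_end_def add.assoc)
  have "d \<noteq> e + 1" "e + n \<noteq> d + 1"
    using e(1) rd vt_period[of e] by (auto simp: right_end_def)
  then show False
    using barriers_separate[OF H b[OF e(1)] b[OF rd], of d "e + n"] d rd e(1) vt_period[of e]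
    by (auto simp: right_end_def)
qed

text \<open>The last vertex of \<open>H\<close> before two consecutive gaps is an end; the second
  gap is needed when that vertex is at \<open>q - 1\<close>.\<close>

lemma obtain_right_end:
  assumes "vt q \<notin> H" "vt (q + 1) \<notin> H" "H \<noteq> {}" "H \<subseteq> V"
  obtains e where "right_end H e"
proof -
  obtain x where "x \<in> H" "x \<in> V" using assms by blast
  obtain m where m: "vt m = x" "q - n \<le> m" "m < q - n + n"
    by (rule obtain_in_window[OF \<open>x \<in> V\<close>])
  then have "vt m \<in> H" "m < q" using \<open>x \<in> H\<close> by simp_all
  then obtain l where l: "m \<le> l" "l < q" "vt l \<in> H" "\<forall>i. l < i \<longrightarrow> i < q \<longrightarrow> vt i \<notin> H"
    by (rule obtain_last_before)
  have "vt (l + 1) \<notin> H" using l assms(1) by (cases "l + 1 = q") auto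
  moreover have "vt (l + 2) \<notin> H"
  proof -
    consider "l + 2 < q" | "l + 2 = q" | "l + 2 = q + 1" using l(2) by linarith
    then show ?thesis using l(4) assms(1,2) by cases (simp, metis, metis)
  qed
  ultimately show ?thesis using that[of l] l(3) by (simp add: right_end_def)
qed

text \<open>The contact vertices between the two hubs of a \<open>K\<^bsub>2,5\<^esub>\<close> minor and its leaves, seen from the
  right; the left versions follow by reflection.\<close>

lemma enclosed_hub_right:
  assumes Q: "cut_connected E Q" "Q \<subseteq> V" and HQ: "H \<inter> Q = {}"
    and enc: "\<And>i. vt i \<in> Q \<Longrightarrow> enclosed H i"
    and B: "vt h \<in> Q" "vt (h + 2) \<in> B" "B \<inter> Q = {}"
    and B': "vt h' \<in> Q" "vt (h' + 2) \<in> B'" "B' \<inter> Q = {}" and "B \<inter> B' = {}"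
  shows False
proof -
  have "vt h \<noteq> vt h'" using assms vt_shift[of h 2 h'] by auto
  then obtain k where k: "vt k = vt h'" "h < k" "k < h + n" by (rule obtain_shift)
  then have B'': "vt k \<in> Q" "vt (k + 2) \<in> B'" using B' vt_shift[of k 2 h'] by auto
  have H: "vt (i + 1) \<in> H" if "vt i \<in> Q" for i using enc[OF that] by (simp add: enclosed_def)
  \<comment> \<open>Since \<open>vt i\<close> is enclosed, the position after it belongs to
    \<open>H\<close>, so \<open>Q\<close> cannot jump over \<open>i + 2\<close>.\<close>
  have bar: "barrier Q (i + 2)" if "vt i \<in> Q" "vt (i + 2) \<notin> Q" for i
  proof -
    have "i + 2 - 1 = i + 1" by simp
    then have "vt (i + 2 - 1) \<notin> Q" using H[OF that(1)] HQ by (metis disjoint_iff)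
    then show ?thesis using that(2) by (simp only: barrier_def) blast
  qed
  have b: "barrier Q (h + 2)" "barrier Q (k + 2)" using bar B B'' B' by blast+
  have "k \<noteq> h + 1" "k \<noteq> h + 2" using B''(1) H[OF B(1)] HQ B by blast+
  moreover have "vt (h + n) \<in> Q" "vt (k + 1) \<notin> Q" "vt (k + 2) \<notin> Q"
    using vt_period[of h] B(1) H[OF B''(1)] HQ B''(2) B'(3) by auto
  then have "h + n \<noteq> k + 1" "h + n \<noteq> k + 2" by metis+
  ultimately show False
    using barriers_separate[OF Q b, of k "h + n"] k B''(1) B(1) vt_period[of h] by auto
qed

text \<open>The cyclic neighbours of an enclosed vertex are in \<open>H\<close>, which makes it a
  barrier for \<open>Q\<close>. Two such barriers would separate the vertices of \<open>Q\<close>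
  two steps to their right.\<close>

lemma enclosed_leaf_right_unique:
  assumes Q: "cut_connected E Q" "Q \<subseteq> V" and HQ: "H \<inter> Q = {}"
    and B: "vt b \<in> B" "vt (b + 2) \<in> Q" "enclosed H b" "B \<inter> Q = {}"
    and B': "vt b' \<in> B'" "vt (b' + 2) \<in> Q" "enclosed H b'" "B' \<inter> Q = {}" and "B \<inter> B' = {}"
  shows False
proof -
  have "vt b \<noteq> vt b'" using assms by auto
  then obtain c where c: "vt c = vt b'" "b < c" "c < b + n" by (rule obtain_shift)
  have C: "vt c \<in> B'" "vt (c + 2) \<in> Q" "enclosed H c"
    using B' c(1) vt_shift[of c 2 b'] enclosed_cong[OF c(1)] by auto
  have bar: "barrier Q b" "barrier Q c" using B B' C HQ by (auto simp: barrier_def enclosed_def)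
  have "c \<noteq> b + 1" "c \<noteq> b + 2" using B C B'(4) HQ by (auto simp: enclosed_def)
  moreover have "b + n \<noteq> c + 1" "b + n \<noteq> c + 2"
  proof -
    have "vt (b + n) \<notin> Q" "vt (b + n) \<notin> H" "vt (c + 1) \<in> H" "vt (c + 2) \<in> Q"
      using vt_period[of b] B C by (auto simp: enclosed_def)
    then show "b + n \<noteq> c + 1" "b + n \<noteq> c + 2" by metis+
  qed
  ultimately show False
    using barriers_separate[OF Q bar, of "b + 2" "c + 2"] c B(2) C(2) by auto
qed

text \<open>If \<open>Q\<close> missed \<open>e + 1\<close>, both \<open>b\<close> and the end
  \<open>e\<close> of \<open>H\<close> would be barriers for \<open>Q\<close>. Between them
  \<open>H\<close> has no two consecutive gaps, so \<open>Q\<close> has only enclosed vertices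
  there, and the other one, \<open>o'\<close>, is cut off from \<open>b + 2\<close>.\<close>

lemma enclosed_leaf_right:
  assumes H: "cut_connected E H" "H \<subseteq> V" and Q: "cut_connected E Q" "Q \<subseteq> V" and HQ: "H \<inter> Q = {}"
    and out: "vt o' \<in> Q" "\<not> enclosed H o'" and e: "right_end H e"
    and b: "vt (b + 2) \<in> Q" "enclosed H b" "vt b \<notin> Q"
  shows "vt (e + 1) \<in> Q"
proof (rule ccontr)
  assume no: "vt (e + 1) \<notin> Q"
  have "vt b \<noteq> vt e" using e b by (auto simp: right_end_def enclosed_def)
  then obtain d where d: "vt d = vt e" "b < d" "d < b + n" by (rule obtain_shift)
  have D: "vt d \<in> H" "vt (d + 1) \<notin> Q"
    using e no d(1) vt_shift[of d 1 e] by (auto simp: right_end_def)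
  have "vt b \<noteq> vt o'" using out b by auto
  then obtain p where p: "vt p = vt o'" "b < p" "p < b + n" by (rule obtain_shift)
  have P: "vt p \<in> Q" "\<not> enclosed H p" "vt p \<notin> H"
    using out p(1) enclosed_cong[OF p(1)] HQ by auto
  have bar: "barrier Q b" "barrier Q d" using b D HQ by (auto simp: barrier_def enclosed_def)
  have "b + 1 \<noteq> d" "b + 2 \<noteq> d" using b(1) D HQ by (auto simp: add.assoc)
  then have bd: "b + 2 < d" using d by linarith
  consider "p < d" | "p = d" | "d < p" by linarith
  then show False
  proof cases
    case 1
    \<comment> \<open>A gap that is not enclosed has another gap next to it; this pair yields a
      right end of \<open>H\<close> before \<open>d\<close>.\<close>
    obtain j where j: "vt j \<notin> H" "vt (j + 1) \<notin> H" "b < j" "j + 1 \<le> d"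
    proof (cases "vt (p + 1) \<in> H")
      case True
      then have "vt (p - 1) \<notin> H" using P by (auto simp: enclosed_def)
      moreover have "p - 1 \<noteq> b" using P(3) b(2) by (auto simp: enclosed_def)
      ultimately show ?thesis using that[of "p - 1"] P 1 p by auto
    next
      case False
      then show ?thesis using that[of p] P 1 p by auto
    qed
    have b1: "vt (b + 1) \<in> H" "b + 1 < j"
    proof -
      show "vt (b + 1) \<in> H" using b(2) by (simp add: enclosed_def)
      then have "b + 1 \<noteq> j" using j(1) by auto
      then show "b + 1 < j" using j(3) by linarith
    qed
    obtain l where l: "b + 1 \<le> l" "l < j" "vt l \<in> H" "\<forall>i. l < i \<longrightarrow> i < j \<longrightarrow> vt i \<notin> H"
      by (rule obtain_last_before[OF b1])
    have "right_end H l"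
    proof -
      have "l + 1 < j \<or> l + 1 = j" "l + 2 < j \<or> l + 2 = j \<or> l + 2 = j + 1" using l(2) by linarith+
      then have "vt (l + 1) \<notin> H" "vt (l + 2) \<notin> H"
        using l(4)[rule_format, of "l + 1"] l(4)[rule_format, of "l + 2"] j(1,2) less_add_one[of l]
          by (metis, smt (verit) j(1,2))
      then show ?thesis using l(3) by (simp add: right_end_def)
    qed
    then have "vt l = vt d" using right_end_unique[OF H _ e] d(1) by simp
    then have "n dvd d - l" using vt_eq by blast
    then have "n \<le> d - l" using l(2) j(4) by (intro zdvd_imp_le) auto
    then show False using l(1) d(3) by linarith
  next
    case 2
    then show False using P D by blast
  next
    case 3
    then show False using barriers_separate[OF Q bar, of "b + 2" p] bd b(1) P(1) p(3) by auto
  qed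
qed

text \<open>Meeting \<open>H\<close> on the left at a vertex that \<open>H\<close> does not jump
  over means that \<open>H\<close> stops there, and it stops only once.\<close>

lemma contact_right:
  assumes H: "cut_connected E H" "H \<subseteq> V" and e: "right_end H e"
    and i: "vt i \<notin> H" "\<not> enclosed H i" "vt (i - 1) \<in> H \<or> vt (i - 2) \<in> H"
  shows "vt i = vt (e + 1) \<or> vt i = vt (e + 2)"
proof (cases "vt (i - 1) \<in> H")
  case True
  moreover have "i - 1 + 1 = i" "i - 1 + 2 = i + 1" by simp_all
  ultimately have "right_end H (i - 1)" using i(1,2) unfolding right_end_def enclosed_def by metis
  then have "vt (i - 1) = vt e" using right_end_unique[OF H _ e] by blast
  then show ?thesis using vt_shift[of "i - 1" 1 e] by simp
next
  case False
  moreover have "i - 2 + 1 = i - 1" "i - 2 + 2 = i" by simp_all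
  ultimately have "right_end H (i - 2)" using i(1,3) unfolding right_end_def by metis
  then have "vt (i - 2) = vt e" using right_end_unique[OF H _ e] by blast
  then show ?thesis using vt_shift[of "i - 2" 2 e] by simp
qed

end

section \<open>Five leaves for four positions\<close>

locale cyclic_K25 = cyclic_square +
  fixes H Q :: "'a set" and B :: "nat \<Rightarrow> 'a set"
  assumes H: "cut_connected E H" "H \<subseteq> V" and Q: "cut_connected E Q" "Q \<subseteq> V" and HQ: "H \<inter> Q = {}"
    and B: "\<And>k. k < 5 \<Longrightarrow> cut_connected E (B k) \<and> B k \<subseteq> V \<and> B k \<inter> H = {} \<and> B k \<inter> Q = {}"
    and disj: "\<And>k l. k < 5 \<Longrightarrow> l < 5 \<Longrightarrow> k \<noteq> l \<Longrightarrow> B k \<inter> B l = {}"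
    and touch: "\<And>k. k < (5::nat) \<Longrightarrow> (\<exists>x\<in>B k. \<exists>y\<in>H. (x, y) \<in> E) \<and> (\<exists>x\<in>B k. \<exists>y\<in>Q. (x, y) \<in> E)"
begin

sublocale R: cyclic_square n "\<lambda>i. vt (- i)" V E by (rule reflection)

lemma R_enclosed: "R.enclosed U i \<longleftrightarrow> enclosed U (- i)"
proof -
  have "- (i - 1) = - i + 1" "- (i + 1) = - i - 1" by simp_all
  then show ?thesis unfolding R.enclosed_def enclosed_def by metis
qed

lemma obtain_touch:
  assumes "k < 5" "U = H \<or> U = Q"
  obtains i j where "vt i \<in> B k" "vt j \<in> U" "j \<in> {i - 2, i - 1, i + 1, i + 2}"
proof -
  obtain x y where xy: "x \<in> B k" "y \<in> U" "(x, y) \<in> E" using touch[OF assms(1)] assms(2) by blast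
  have V': "x \<in> V" "y \<in> V" using xy B[OF assms(1)] H Q assms(2) by auto
  obtain i where i: "x = vt i" using V'(1) V by blast
  obtain j where "vt j = y" "1 \<le> \<bar>i - j\<bar>" "\<bar>i - j\<bar> \<le> 2"
    by (rule obtain_adjacent[OF xy(3)[unfolded i] V'(2)])
  moreover then have "j \<in> {i - 2, i - 1, i + 1, i + 2}" by auto
  ultimately show ?thesis using that[of i j] i xy by blast
qed

text \<open>Otherwise each contact of a leaf with \<open>Q\<close> is a jump over a vertex of
  \<open>H\<close>, to the left or to the right. Each side admits only one leaf, so three leaves are
  already too many. The vertex found here guarantees that \<open>H\<close> has ends.\<close>

lemma hub_not_enclosed: "\<exists>i. vt i \<in> Q \<and> \<not> enclosed H i"
proof (rule ccontr)
  assume "\<not> ?thesis"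
  then have enc: "\<And>i. vt i \<in> Q \<Longrightarrow> enclosed H i" by blast
  define right where "right k \<longleftrightarrow> (\<exists>h. vt h \<in> Q \<and> vt (h + 2) \<in> B k)" for k
  define left where "left k \<longleftrightarrow> (\<exists>h. vt h \<in> Q \<and> vt (h - 2) \<in> B k)" for k
  have lr: "right k \<or> left k" if k: "k < 5" for k
  proof -
    obtain i j where ij: "vt i \<in> B k" "vt j \<in> Q" "j \<in> {i - 2, i - 1, i + 1, i + 2}"
      by (rule obtain_touch[OF k disjI2[OF HOL.refl]])
    have "vt (j - 1) \<in> H" "vt (j + 1) \<in> H" using enc[OF ij(2)] by (auto simp: enclosed_def)
    then have "i \<noteq> j - 1" "i \<noteq> j + 1" using ij(1) B[OF k] by auto
    then have "i = j + 2 \<or> i = j - 2" using ij(3) by auto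
    then show ?thesis using ij right_def left_def by blast
  qed
  have r1: "k = l" if kl: "right k" "right l" "k < 5" "l < 5" for k l
  proof (rule ccontr)
    assume "k \<noteq> l"
    obtain h h' where "vt h \<in> Q" "vt (h + 2) \<in> B k" "vt h' \<in> Q" "vt (h' + 2) \<in> B l"
      using kl unfolding right_def by blast
    then show False
      using enclosed_hub_right[OF Q HQ enc, of h "B k" h' "B l"] B kl disj \<open>k \<noteq> l\<close> by blast
  qed
  have l1: "k = l" if kl: "left k" "left l" "k < 5" "l < 5" for k l
  proof (rule ccontr)
    assume "k \<noteq> l"
    obtain h h' where h: "vt h \<in> Q" "vt (h - 2) \<in> B k" "vt h' \<in> Q" "vt (h' - 2) \<in> B l"
      using kl unfolding left_def by blast
    show False
      by (rule R.enclosed_hub_right[OF Q HQ, of "- h" "B k" "- h'" "B l"])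
        (use h enc B kl disj \<open>k \<noteq> l\<close> in \<open>auto simp: R_enclosed\<close>)
  qed
  have "right 0 \<and> right 1 \<or> right 0 \<and> right 2 \<or> right 1 \<and> right 2 \<or>
    left 0 \<and> left 1 \<or> left 0 \<and> left 2 \<or> left 1 \<and> left 2" using lr[of 0] lr[of 1] lr[of 2] by auto
  then show False using r1[of 0 1] r1[of 0 2] r1[of 1 2] l1[of 0 1] l1[of 0 2] l1[of 1 2] by auto
qed

text \<open>A vertex of \<open>Q\<close> that is not enclosed provides two consecutive gaps of
  \<open>H\<close>, hence a left and a right end. Contacts with \<open>H\<close> at vertices that
  are not enclosed occur only at the two positions beyond each end: four places for five
  leaves.\<close>

lemma no_K25_bags: False
proof -
  obtain w where w: "vt w \<in> Q" "\<not> enclosed H w" using hub_not_enclosed by blast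
  have wH: "vt w \<notin> H" using w(1) HQ by blast
  have Hne: "H \<noteq> {}" using H by (simp add: cut_connected_def)
  obtain q where q: "vt q \<notin> H" "vt (q + 1) \<notin> H"
  proof (cases "vt (w + 1) \<in> H")
    case True
    then have "vt (w - 1) \<notin> H" using w wH by (auto simp: enclosed_def)
    then show ?thesis using that[of "w - 1"] wH by simp
  next
    case False
    then show ?thesis using that[of w] wH by simp
  qed
  obtain e where e: "right_end H e" by (rule obtain_right_end[OF q Hne H(2)])
  obtain s' where s': "R.right_end H s'"
  proof (rule R.obtain_right_end[OF _ _ Hne H(2)])
    have "- (- q - 1) = q + 1" "- (- q - 1 + 1) = q" by simp_all
    then show "vt (- (- q - 1)) \<notin> H" "vt (- (- q - 1 + 1)) \<notin> H" using q by metis+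
  qed
  define s where "s = - s'"
  have neg: "- (s' + 1) = s - 1" "- (s' + 2) = s - 2" "- s' = s" by (simp_all add: s_def)
  have s: "vt s \<in> H" "vt (s - 1) \<notin> H" "vt (s - 2) \<notin> H"
    using s' unfolding R.right_end_def neg by simp_all
  define right where "right k \<longleftrightarrow> (\<exists>b. vt b \<in> B k \<and> enclosed H b \<and> vt (b + 2) \<in> Q)" for k
  define left where "left k \<longleftrightarrow> (\<exists>b. vt b \<in> B k \<and> enclosed H b \<and> vt (b - 2) \<in> Q)" for k
  have r1: "k = l" if kl: "right k" "right l" "k < 5" "l < 5" for k l
  proof (rule ccontr)
    assume "k \<noteq> l"
    obtain b b' where b: "vt b \<in> B k" "enclosed H b" "vt (b + 2) \<in> Q" "vt b' \<in> B l" "enclosed H b'" "vt (b' + 2) \<in> Q"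
      using kl unfolding right_def by blast
    show False
      by (rule enclosed_leaf_right_unique[OF Q HQ, of b "B k" b' "B l"]) (use b B kl disj \<open>k \<noteq> l\<close> in auto)
  qed
  have l1: "k = l" if kl: "left k" "left l" "k < 5" "l < 5" for k l
  proof (rule ccontr)
    assume "k \<noteq> l"
    obtain b b' where b: "vt b \<in> B k" "enclosed H b" "vt (b - 2) \<in> Q" "vt b' \<in> B l" "enclosed H b'" "vt (b' - 2) \<in> Q"
      using kl unfolding left_def by blast
    show False
      by (rule R.enclosed_leaf_right_unique[OF Q HQ, of "- b" "B k" "- b'" "B l"])
        (use b B kl disj \<open>k \<noteq> l\<close> in \<open>auto simp: R_enclosed\<close>)
  qed
  have rQ: "vt (e + 1) \<in> Q" if k: "right k" "k < 5" for k
  proof -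
    obtain b where b: "vt b \<in> B k" "enclosed H b" "vt (b + 2) \<in> Q" using k unfolding right_def by blast
    show ?thesis by (rule enclosed_leaf_right[OF H Q HQ w e b(3,2)]) (use b B k in auto)
  qed
  have lQ: "vt (s - 1) \<in> Q" if k: "left k" "k < 5" for k
  proof -
    obtain b where b: "vt b \<in> B k" "enclosed H b" "vt (b - 2) \<in> Q" using k unfolding left_def by blast
    have "vt (- (s' + 1)) \<in> Q"
      by (rule R.enclosed_leaf_right[OF H Q HQ, of "- w" s' "- b"])
        (use b B k w s' in \<open>auto simp: R_enclosed\<close>)
    then show ?thesis unfolding neg .
  qed
  \<comment> \<open>A leaf with all vertices enclosed in \<open>H\<close> reaches \<open>Q\<close> by a jump, and is charged to the position
    next to the corresponding end of \<open>H\<close>, which \<open>Q\<close> occupies then.\<close>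
  define slot where "slot k z \<longleftrightarrow> z \<in> B k \<or> right k \<and> z = vt (e + 1) \<or> left k \<and> z = vt (s - 1)" for k z
  let ?Z = "{vt (e + 1), vt (e + 2), vt (s - 1), vt (s - 2)}"
  have contact: "vt i \<in> ?Z" if i: "vt i \<notin> H" "\<not> enclosed H i" "vt (i - 1) \<in> H \<or> vt (i - 2) \<in> H \<or> vt (i + 1) \<in> H \<or> vt (i + 2) \<in> H" for i
  proof (cases "vt (i - 1) \<in> H \<or> vt (i - 2) \<in> H")
    case True
    then show ?thesis using contact_right[OF H e i(1,2)] by blast
  next
    case False
    then have *: "vt (i + 1) \<in> H \<or> vt (i + 2) \<in> H" using i(3) by blast
    have "vt (- (- i)) = vt (- (s' + 1)) \<or> vt (- (- i)) = vt (- (s' + 2))"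
    proof (rule R.contact_right[OF H s'])
      have "- (- i - 1) = i + 1" "- (- i - 2) = i + 2" by simp_all
      then show "vt (- (- i - 1)) \<in> H \<or> vt (- (- i - 2)) \<in> H" using * by metis
    qed (use i in \<open>simp_all add: R_enclosed\<close>)
    then show ?thesis unfolding neg minus_minus by blast
  qed
  have ex: "\<exists>z\<in>?Z. slot k z" if k: "k < 5" for k
  proof (cases "\<forall>i. vt i \<in> B k \<longrightarrow> enclosed H i")
    case True
    obtain i j where ij: "vt i \<in> B k" "vt j \<in> Q" "j \<in> {i - 2, i - 1, i + 1, i + 2}"
      by (rule obtain_touch[OF k disjI2[OF HOL.refl]])
    have en: "enclosed H i" using True ij(1) by blast
    then have "j \<noteq> i - 1" "j \<noteq> i + 1" using ij(2) HQ by (auto simp: enclosed_def)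
    then have "j = i - 2 \<or> j = i + 2" using ij(3) by auto
    then have "left k \<or> right k" using ij en unfolding left_def right_def by blast
    then show ?thesis by (auto simp: slot_def)
  next
    case False
    then obtain o' where o': "vt o' \<in> B k" "\<not> enclosed H o'" by blast
    have BH: "B k \<inter> H = {}" and Bk: "cut_connected E (B k)" "B k \<subseteq> V" using B[OF k] by auto
    \<comment> \<open>Cut the leaf into its enclosed part and the rest. If \<open>P\<close> is
      empty, the contact with \<open>H\<close> lies in \<open>?Z\<close>; otherwise an edge crossing
      the cut jumps over a vertex of \<open>H\<close>, so its far end is next to \<open>H\<close>
      and lies in \<open>?Z\<close>.\<close>
    define P where "P = {x \<in> B k. \<exists>i. x = vt i \<and> enclosed H i}"
    have enP: "vt i \<in> P \<longleftrightarrow> vt i \<in> B k \<and> enclosed H i" for i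
      unfolding P_def mem_Collect_eq using enclosed_cong by metis
    show ?thesis
    proof (cases "P = {}")
      case True
      obtain i j where ij: "vt i \<in> B k" "vt j \<in> H" "j \<in> {i - 2, i - 1, i + 1, i + 2}"
        by (rule obtain_touch[OF k disjI1[OF HOL.refl]])
      have "vt i \<in> ?Z"
        by (rule contact) (use ij True enP BH in auto)
      then show ?thesis using ij(1) unfolding slot_def by blast
    next
      case False
      moreover have "vt o' \<notin> P" using o'(2) enP by blast
      then have "P \<subset> B k" using o'(1) unfolding P_def by blast
      ultimately obtain x y where xy: "x \<in> P" "y \<in> B k - P" "(x, y) \<in> E"
        using Bk(1) unfolding cut_connected_def by meson
      obtain i where i: "x = vt i" "enclosed H i" using xy(1) by (auto simp: P_def)
      have "y \<in> V" using xy(2) Bk(2) by blast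
      with xy(3)[unfolded i(1)] obtain j where j: "vt j = y" "1 \<le> \<bar>i - j\<bar>" "\<bar>i - j\<bar> \<le> 2"
        by (rule obtain_adjacent)
      have jB: "vt j \<in> B k" "\<not> enclosed H j" using xy(2) j(1) enP by auto
      have "vt (i - 1) \<in> H" "vt (i + 1) \<in> H" using i(2) by (auto simp: enclosed_def)
      then have "j \<noteq> i - 1" "j \<noteq> i + 1" using jB(1) BH by auto
      then have "j = i - 2 \<or> j = i + 2" using j(2,3) by linarith
      then have "j + 1 = i - 1 \<or> j - 1 = i + 1" by auto
      then have "vt (j - 1) \<in> H \<or> vt (j + 1) \<in> H"
        using \<open>vt (i - 1) \<in> H\<close> \<open>vt (i + 1) \<in> H\<close> by metis
      then have "vt j \<in> ?Z" using contact[of j] jB BH by blast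
      then show ?thesis using jB(1) unfolding slot_def by blast
    qed
  qed
  \<comment> \<open>\<open>e + 2\<close> is outside \<open>H\<close> and \<open>s\<close> inside, so
    charges to different ends never coincide.\<close>
  have es: "vt (e + 1) \<noteq> vt (s - 1)"
  proof
    assume "vt (e + 1) = vt (s - 1)"
    then have "vt (e + 1 + 1) = vt (s - 1 + 1)" unfolding vt_shift .
    then show False using e s by (simp add: right_end_def add.assoc)
  qed
  \<comment> \<open>A position held by a leaf is not in \<open>Q\<close>, whereas a charged one is;
    two charges to one position come from the same side, which serves a single leaf.\<close>
  have uniq: "k = l" if kl: "k < 5" "l < 5" "slot k z" "slot l z" for k l z
  proof (rule ccontr)
    assume ne: "k \<noteq> l"
    have a: "z \<notin> Q" "\<not> z \<in> B l" if "z \<in> B k"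
      using that B[OF kl(1)] disj[OF kl(1,2) ne] by auto
    have b: "z \<notin> Q" "\<not> z \<in> B k" if "z \<in> B l"
      using that B[OF kl(2)] disj[OF kl(1,2) ne] by auto
    show False using kl(3,4) a b rQ lQ r1 l1 es ne kl(1,2) unfolding slot_def by metis
  qed
  obtain z where z: "\<And>k. k < 5 \<Longrightarrow> z k \<in> ?Z \<and> slot k (z k)" using ex by metis
  have "inj_on z {..<5}" using z uniq by (intro inj_onI) (metis lessThan_iff)
  then have "card (z ` {..<5}) = 5" by (simp add: card_image)
  moreover have "card (z ` {..<5}) \<le> card ?Z" using z by (intro card_mono) auto
  moreover have "card ?Z \<le> 4" by (simp add: card_insert_if)
  ultimately show False by simp
qed

end

section \<open>Drawing the antiprism\<close>

text \<open>Unrolled drawing of the antiprism: vertex \<open>i\<close> sits at abscissa \<open>i\<close> and height \<open>i mod 2\<close> in a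
  horizontal strip, all edges are straight, and the exponential map wraps the strip, with
  period \<open>n\<close>, around the origin.\<close>

definition wrap :: "nat \<Rightarrow> real \<Rightarrow> real \<Rightarrow> complex" where
  "wrap n x y = exp (Complex y (2 * pi * x / real n))"

lemma wrap_eq:
  assumes "0 < n"
  shows "wrap n x y = wrap n x' y' \<longleftrightarrow> y = y' \<and> (\<exists>k::int. x = x' + of_int k * real n)"
proof -
  have "2 * pi * x / real n = 2 * pi * x' / real n + of_int (2 * k) * pi \<longleftrightarrow> x = x' + of_int k * real n" for k :: int
  proof -
    have "2 * pi * x / real n = 2 * pi * x' / real n + of_int (2 * k) * pi \<longleftrightarrow>
      2 * pi * x = 2 * pi * (x' + of_int k * real n)"
      using assms by (simp add: field_simps)
    then show ?thesis by simp
  qed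
  moreover have "Complex y a = Complex y' a' + (of_int (2 * k) * pi) * \<i> \<longleftrightarrow> y = y' \<and> a = a' + of_int (2 * k) * pi"
    for a a' and k :: int by (simp add: complex_eq_iff)
  ultimately show ?thesis unfolding wrap_def exp_eq by metis
qed

definition height :: "nat \<Rightarrow> real" where
  "height i = (if even i then 0 else 1)"

text \<open>After wrapping, these edges run along the circle of radius 1 for even \<open>i\<close>
  and of radius \<open>exp 1\<close> for odd \<open>i\<close>.\<close>

definition rim :: "nat \<Rightarrow> nat \<Rightarrow> real \<Rightarrow> complex" where
  "rim n i t = wrap n (real i + 2 * t) (height i)"

definition spoke_curve :: "nat \<Rightarrow> nat \<Rightarrow> real \<Rightarrow> complex" where
  "spoke_curve n i t = wrap n (real i + t) (height i + t * (height (i + 1) - height i))"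

definition position :: "nat \<Rightarrow> nat \<Rightarrow> complex" where
  "position n i = wrap n (real i) (height i)"

lemma small_multiple:
  fixes k :: int and n :: nat
  assumes "0 < n" "x = y + of_int k * real n" "\<bar>x - y\<bar> < real n" shows "k = 0"
proof (rule ccontr)
  assume "k \<noteq> 0"
  then have "1 \<le> \<bar>real_of_int k\<bar>" by linarith
  then have "real n \<le> \<bar>real_of_int k\<bar> * real n" by (simp add: mult_le_cancel_right1)
  also have "\<dots> = \<bar>x - y\<bar>" using assms(2) by (simp add: abs_mult)
  finally show False using assms(3) by simp
qed

text \<open>Each curve spans an abscissa of at most two, less than the period, so it is injective on
  its own.\<close>

lemma wrap_near:
  assumes "0 < n" "wrap n x y = wrap n x' y'" "\<bar>x - x'\<bar> < real n" shows "x = x' \<and> y = y'"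
  using assms small_multiple wrap_eq by (metis add.right_neutral mult_zero_left of_int_0)

text \<open>Heights alternate with the parity of the index and therefore survive reduction modulo an
  even \<open>n\<close>.\<close>

lemma position_mod:
  assumes "even n" "0 < n" shows "position n (i mod n) = position n i"
proof -
  have "height (i mod n) = height i" using assms(1) by (simp add: height_def dvd_mod_iff)
  moreover have "real (i mod n) = real i + of_int (- int (i div n)) * real n"
  proof -
    have "real i = real (n * (i div n) + i mod n)" by simp
    then show ?thesis by (simp only: of_nat_add of_nat_mult) simp
  qed
  ultimately show ?thesis unfolding position_def wrap_eq[OF assms(2)] by blast
qed

lemma position_inj: "0 < n \<Longrightarrow> i < n \<Longrightarrow> j < n \<Longrightarrow> position n i = position n j \<Longrightarrow> i = j"
  using wrap_near[of n "real i" "height i" "real j" "height j"] by (auto simp: position_def)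

lemma arc_rim:
  assumes "5 \<le> n"
  shows "Path_Connected.arc (rim n i)" "pathstart (rim n i) = position n i"
    "pathfinish (rim n i) = position n (i + 2)"
proof -
  have "continuous_on {0..1} (rim n i)"
    unfolding rim_def wrap_def Complex_eq by (intro continuous_intros) (use assms in auto)
  moreover have "inj_on (rim n i) {0..1}"
  proof (rule inj_onI)
    fix s t :: real assume "s \<in> {0..1}" "t \<in> {0..1}" "rim n i s = rim n i t"
    then show "s = t"
      using wrap_near[of n "real i + 2 * s" "height i" "real i + 2 * t" "height i"] assms
      by (auto simp: rim_def abs_if)
  qed
  ultimately show "Path_Connected.arc (rim n i)" by (simp add: Path_Connected.arc_def path_def)
qed (simp_all add: rim_def position_def pathstart_def pathfinish_def height_def add.commute)

lemma arc_spoke: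
  assumes "5 \<le> n"
  shows "Path_Connected.arc (spoke_curve n i)" "pathstart (spoke_curve n i) = position n i"
    "pathfinish (spoke_curve n i) = position n (i + 1)"
proof -
  have "continuous_on {0..1} (spoke_curve n i)"
    unfolding spoke_curve_def wrap_def Complex_eq by (intro continuous_intros) (use assms in auto)
  moreover have "inj_on (spoke_curve n i) {0..1}"
  proof (rule inj_onI)
    fix s t :: real assume "s \<in> {0..1}" "t \<in> {0..1}" "spoke_curve n i s = spoke_curve n i t"
    then show "s = t"
      using wrap_near[of n "real i + s" _ "real i + t"] assms
      by (auto simp: spoke_curve_def abs_if)
  qed
  ultimately show "Path_Connected.arc (spoke_curve n i)" by (simp add: Path_Connected.arc_def path_def)
qed (simp_all add: spoke_curve_def position_def pathstart_def pathfinish_def height_def add.commute)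

text \<open>The unrolled curves as point sets, with \<open>r\<close> telling rims from spokes. As
  \<open>wrap\<close> only identifies abscissas modulo \<open>n\<close>, intersections become linear
  problems.\<close>

definition strip :: "bool \<Rightarrow> nat \<Rightarrow> real \<Rightarrow> real \<Rightarrow> bool" where
  "strip r i x y \<longleftrightarrow> (if r then real i \<le> x \<and> x \<le> real i + 2 \<and> y = height i
     else real i \<le> x \<and> x \<le> real i + 1 \<and> y = height i + (x - real i) * (height (i + 1) - height i))"

definition edge_curve :: "nat \<Rightarrow> bool \<Rightarrow> nat \<Rightarrow> real \<Rightarrow> complex" where
  "edge_curve n r i = (if r then rim n i else spoke_curve n i)"

lemma edge_curve_image:
  "path_image (edge_curve n r i) = {wrap n x y |x y. strip r i x y}"
proof (cases r)
  case True
  have "z \<in> path_image (rim n i) \<longleftrightarrow> (\<exists>x y. z = wrap n x y \<and> strip True i x y)" for z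
  proof
    assume "z \<in> path_image (rim n i)"
    then obtain t where "t \<in> {0..1}" "z = rim n i t" by (auto simp: path_image_def)
    then show "\<exists>x y. z = wrap n x y \<and> strip True i x y"
      by (intro exI[of _ "real i + 2 * t"] exI[of _ "height i"]) (auto simp: rim_def strip_def)
  next
    assume "\<exists>x y. z = wrap n x y \<and> strip True i x y"
    then obtain x y where xy: "z = wrap n x y" "strip True i x y" by blast
    have "real i + 2 * ((x - real i) / 2) = x" by (simp add: diff_divide_distrib)
    then have "z = rim n i ((x - real i) / 2)" "(x - real i) / 2 \<in> {0..1}"
      using xy unfolding rim_def strip_def by simp_all
    then show "z \<in> path_image (rim n i)" unfolding path_image_def by blast
  qed
  then show ?thesis using True by (auto simp: edge_curve_def)
next
  case False
  have "z \<in> path_image (spoke_curve n i) \<longleftrightarrow> (\<exists>x y. z = wrap n x y \<and> strip False i x y)" for z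
  proof
    assume "z \<in> path_image (spoke_curve n i)"
    then obtain t where "t \<in> {0..1}" "z = spoke_curve n i t" by (auto simp: path_image_def)
    then show "\<exists>x y. z = wrap n x y \<and> strip False i x y"
      by (intro exI[of _ "real i + t"] exI[of _ "height i + t * (height (i + 1) - height i)"])
        (auto simp: spoke_curve_def strip_def)
  next
    assume "\<exists>x y. z = wrap n x y \<and> strip False i x y"
    then obtain x y where xy: "z = wrap n x y" "strip False i x y" by blast
    then have "z = spoke_curve n i (x - real i)" "x - real i \<in> {0..1}"
      by (auto simp: spoke_curve_def strip_def)
    then show "z \<in> path_image (spoke_curve n i)" unfolding path_image_def by blast
  qed
  then show ?thesis using False by (auto simp: edge_curve_def)
qed

text \<open>Not reduced modulo \<open>n\<close>, so that it also serves as an abscissa in the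
  strip.\<close>

definition curve_end :: "bool \<Rightarrow> nat \<Rightarrow> nat" where
  "curve_end r i = (if r then i + 2 else i + 1)"

lemma arc_edge_curve:
  assumes "5 \<le> n"
  shows "Path_Connected.arc (edge_curve n r i)" "pathstart (edge_curve n r i) = position n i"
    "pathfinish (edge_curve n r i) = position n (curve_end r i)"
  using arc_rim[OF assms] arc_spoke[OF assms] by (auto simp: edge_curve_def curve_end_def)

text \<open>A rim passes the integer abscissa \<open>i + 1\<close>, but the vertex there has the
  other height, by parity. No integer lies strictly between the ends of a spoke.\<close>

lemma strip_vertex:
  assumes "strip r i x (height j)" "x = real j + of_int k * real n" "even n"
  shows "x = real i \<or> x = real (curve_end r i)"
proof (cases r)
  case True
  then have x: "real i \<le> x" "x \<le> real i + 2" "height j = height i"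
    using assms(1) by (auto simp: strip_def)
  have m: "x = of_int (int j + k * int n)" using assms(2) by simp
  have "even (int j + k * int n) \<longleftrightarrow> even (int i)"
    using x(3) assms(3) by (auto simp: height_def split: if_splits)
  then have "int j + k * int n \<noteq> int i + 1" by (metis even_plus_one_iff)
  moreover have "int i \<le> int j + k * int n" "int j + k * int n \<le> int i + 2"
    using x(1,2) unfolding m by linarith+
  ultimately have "int j + k * int n = int i \<or> int j + k * int n = int i + 2" by linarith
  then have "x = of_int (int i) \<or> x = of_int (int i + 2)" unfolding m by metis
  then show ?thesis using True by (auto simp: curve_end_def)
next
  case False
  then have x: "real i \<le> x" "x \<le> real i + 1" using assms(1) by (auto simp: strip_def)
  have m: "x = of_int (int j + k * int n)" using assms(2) by simp
  have "int i \<le> int j + k * int n" "int j + k * int n \<le> int i + 1"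
    using x(1,2) unfolding m by linarith+
  then have "int j + k * int n = int i \<or> int j + k * int n = int i + 1" by linarith
  then have "x = of_int (int i) \<or> x = of_int (int i + 1)" unfolding m by metis
  then show ?thesis using False by (auto simp: curve_end_def)
qed

lemma strip_end_height:
  assumes "strip r i x y" shows "x = real i \<Longrightarrow> y = height i"
    "x = real (curve_end r i) \<Longrightarrow> y = height (curve_end r i)"
  using assms by (auto simp: strip_def curve_end_def height_def split: if_splits)

lemma spoke_end:
  assumes "strip False i x y" "y \<in> {0, 1}"
  shows "x = real i \<or> x = real (curve_end False i)"
proof (rule ccontr)
  assume "\<not> ?thesis"
  then have "0 < x - real i" "x - real i < 1" using assms(1) by (auto simp: strip_def curve_end_def)
  moreover have "y = height i + (x - real i) * (height (i + 1) - height i)"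
    using assms(1) by (simp add: strip_def)
  ultimately show False using assms(2) by (auto simp: height_def split: if_splits)
qed

lemma residue_unique:
  fixes i j n :: nat
  assumes "int i = int j + k * int n" "i < n" "j < n"
  shows "i = j"
proof -
  have "int i mod int n = int j mod int n" unfolding assms(1) by simp
  then show ?thesis using assms(2,3) by simp
qed

text \<open>Rims lie at height 0 or 1 and the interiors of spokes strictly between. Two rims or two spokes
  are told apart by the abscissa modulo \<open>n\<close>.\<close>

lemma strips_meet:
  assumes "strip r i x y" "strip r' j x' y" "x = x' + of_int k * real n" "even n"
    and "i < n" "j < n" "(r, i) \<noteq> (r', j)"
  shows "x = real i \<or> x = real (curve_end r i)"
proof (cases "r \<longrightarrow> \<not> r'")
  case True
  then consider "\<not> r" "y \<in> {0, 1}" | "r" "\<not> r'" | "\<not> r" "\<not> r'" "y \<notin> {0, 1}" | "\<not> r" "r'"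
    by blast
  then show ?thesis
  proof cases
    case 1
    then show ?thesis using spoke_end[of i x y] assms(1) by simp
  next
    case 2
    \<comment> \<open>At the height of a rim the spoke is at one of its ends, so the common point is
      a vertex and \<open>strip_vertex\<close> applies to the rim.\<close>
    then have "y \<in> {0, 1}" using assms(1) by (auto simp: strip_def height_def)
    then have "x' = real j \<or> x' = real (curve_end False j)" using spoke_end[of j x' y] assms(2) 2 by simp
    then obtain l where l: "x' = real l" "y = height l"
      using strip_end_height[OF assms(2)] 2 by auto
    show ?thesis by (rule strip_vertex[of r i x l k n]) (use assms l in auto)
  next
    case 3
    have "x \<noteq> real i" "x \<noteq> real i + 1" "x' \<noteq> real j" "x' \<noteq> real j + 1"
      using strip_end_height[OF assms(1)] strip_end_height[OF assms(2)] 3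
      by (auto simp: curve_end_def height_def split: if_splits)
    then have "real i < x" "x < real i + 1" "real j < x'" "x' < real j + 1"
      using assms(1,2) 3 by (auto simp: strip_def)
    then have "real_of_int (int i) < of_int (int j + k * int n) + 1"
      "real_of_int (int j + k * int n) < of_int (int i) + 1" using assms(3) by auto
    then have "int i = int j + k * int n" by linarith
    then show ?thesis using residue_unique[of i j k n] 3 assms(5-7) by simp
  next
    case 4
    then have "y \<in> {0, 1}" using assms(2) by (auto simp: strip_def height_def)
    then show ?thesis using spoke_end[of i x y] assms(1) 4 by simp
  qed
next
  case False
  then have r: "r" "r'" by auto
  then have x: "real i \<le> x" "x \<le> real i + 2" "y = height i"
    and x': "real j \<le> x'" "x' \<le> real j + 2" "y = height j"
    using assms(1,2) by (auto simp: strip_def)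
  define e where "e = int j + k * int n"
  \<comment> \<open>Rims at equal height start at indices of equal parity and have length two. So
    after the shift their starts agree, which makes them the same rim, or differ by two, which
    leaves one common end.\<close>
  have "even e \<longleftrightarrow> even (int i)"
    using x(3) x'(3) assms(4) by (auto simp: e_def height_def split: if_splits)
  then have "int i \<noteq> e + 1" "e \<noteq> int i + 1" by (metis even_plus_one_iff)+
  moreover have re: "real_of_int e = real j + of_int k * real n" by (simp add: e_def)
  have "real_of_int (int i) \<le> of_int e + 2" "real_of_int e \<le> of_int (int i) + 2"
    using x x' assms(3) unfolding re by auto
  then have "int i \<le> e + 2" "e \<le> int i + 2" by linarith+
  ultimately consider "int i = e" | "int i = e + 2" | "e = int i + 2" by linarith
  then show ?thesis
  proof cases
    case 1
    then show ?thesis using residue_unique[of i j k n] r assms(5-7) by (simp add: e_def)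
  next
    case 2
    then have "real i = real_of_int e + 2" by (metis of_int_add of_int_numeral of_int_of_nat_eq)
    then show ?thesis using x x' assms(3) re by linarith
  next
    case 3
    then have "real_of_int e = real i + 2" by (metis of_int_add of_int_numeral of_int_of_nat_eq)
    then show ?thesis using x x' assms(3) r re by (auto simp: curve_end_def)
  qed
qed

section \<open>Squares of cycles as graphs\<close>

lemma pair_wf_cycle_graph: "pair_wf_digraph (cycle_graph n)"
  by unfold_locales (auto simp: cycle_graph_def)

text \<open>Costs under unit weights are lengths: without a walk of length at most two, every cost
  is at least three, and so is the infimum.\<close>

lemma distance_le_2_iff:
  assumes "pair_wf_digraph G" "u \<noteq> v"
  shows "wf_digraph.\<mu> (with_proj G) (\<lambda>_. 1) u v \<le> 2 \<longleftrightarrow>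
    (u, v) \<in> parcs G \<or> (\<exists>w. (u, w) \<in> parcs G \<and> (w, v) \<in> parcs G)"
proof -
  interpret pair_wf_digraph G by fact
  have cost: "awalk_cost (\<lambda>_. 1) p = real (length p)" for p :: "('a \<times> 'a) awalk"
    by (simp add: awalk_cost_def sum_list_triv)
  show ?thesis
  proof
    assume le: "\<mu> (\<lambda>_. 1) u v \<le> 2"
    have "\<exists>p. awalk u p v \<and> length p \<le> 2"
    proof (rule ccontr)
      assume no: "\<not> ?thesis"
      have "ereal 3 \<le> ereal (awalk_cost (\<lambda>_. 1) p)" if "awalk u p v" for p
        using no that unfolding cost by fastforce
      then have "ereal 3 \<le> \<mu> (\<lambda>_. 1) u v" unfolding \<mu>_def by (auto intro: INF_greatest)
      then have "ereal 3 \<le> 2" using le by (rule order_trans)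
      then show False by simp
    qed
    then obtain p where p: "awalk u p v" "length p \<le> 2" by blast
    then consider "p = []" | a where "p = [a]" | a b where "p = [a, b]"
      by (cases p; cases "tl p") auto
    then show "(u, v) \<in> parcs G \<or> (\<exists>w. (u, w) \<in> parcs G \<and> (w, v) \<in> parcs G)"
    proof cases
      case 1
      then show ?thesis using p assms(2) by (auto simp: awalk_simps)
    next
      case 2
      then show ?thesis using p by (cases a) (auto simp: awalk_simps)
    next
      case 3
      then show ?thesis using p by (cases a; cases b) (auto simp: awalk_simps)
    qed
  next
    assume "(u, v) \<in> parcs G \<or> (\<exists>w. (u, w) \<in> parcs G \<and> (w, v) \<in> parcs G)"
    then have "\<exists>p. awalk u p v \<and> length p \<le> 2"
    proof
      assume "(u, v) \<in> parcs G"
      then have "awalk u [(u, v)] v" by (auto simp: awalk_simps dest: in_arcsD1 in_arcsD2)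
      then show ?thesis by (intro exI[of _ "[(u, v)]"]) simp
    next
      assume "\<exists>w. (u, w) \<in> parcs G \<and> (w, v) \<in> parcs G"
      then obtain w where "(u, w) \<in> parcs G" "(w, v) \<in> parcs G" by blast
      then have "awalk u [(u, w), (w, v)] v" by (auto simp: awalk_simps dest: in_arcsD1 in_arcsD2)
      then show ?thesis by (intro exI[of _ "[(u, w), (w, v)]"]) simp
    qed
    then obtain p where p: "awalk u p v" "length p \<le> 2" by blast
    have "\<mu> (\<lambda>_. 1) u v \<le> ereal (awalk_cost (\<lambda>_. 1) p)"
      unfolding \<mu>_def using p(1) by (intro INF_lower) simp
    also have "\<dots> \<le> 2" using p(2) unfolding cost by simp
    finally show "\<mu> (\<lambda>_. 1) u v \<le> 2" .
  qed
qed

text \<open>Two steps along the cycle go both forward, both backward, or return to the start;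
  \<open>i \<noteq> j\<close> excludes the return because the successor map is injective.\<close>

lemma graph_square_cycle_graph:
  assumes "5 \<le> n"
  shows "pverts (graph_square (cycle_graph n)) = {..<n}"
    "(i, j) \<in> parcs (graph_square (cycle_graph n)) \<longleftrightarrow> i < n \<and> j < n \<and> square_adj n i j"
proof -
  show "pverts (graph_square (cycle_graph n)) = {..<n}"
    by (simp add: graph_square_def cycle_graph_def)
  have C: "(i, j) \<in> parcs (cycle_graph n) \<longleftrightarrow> i < n \<and> j < n \<and> (j = (i + 1) mod n \<or> i = (j + 1) mod n)" for i j
    by (simp add: cycle_graph_def)
  have "(i, j) \<in> parcs (graph_square (cycle_graph n)) \<longleftrightarrow> i < n \<and> j < n \<and> i \<noteq> j \<and>
    ((i, j) \<in> parcs (cycle_graph n) \<or>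
      (\<exists>w. (i, w) \<in> parcs (cycle_graph n) \<and> (w, j) \<in> parcs (cycle_graph n)))"
    using distance_le_2_iff[OF pair_wf_cycle_graph, of i j n]
    by (auto simp: graph_square_def cycle_graph_def)
  also have "\<dots> \<longleftrightarrow> i < n \<and> j < n \<and> square_adj n i j"
  proof (cases "i < n \<and> j < n \<and> i \<noteq> j")
    case True
    then have ij: "i < n" "j < n" "i \<noteq> j" by auto
    have s: "((k + 1) mod n + 1) mod n = (k + 2) mod n" for k by (simp add: mod_Suc_eq)
    have same: "i = j" if "w < n" "i < n" "j < n" "w = (i + 1) mod n" "w = (j + 1) mod n" for w
    proof (rule inj_onD[OF inj_on_add_mod[of 1 n]])
      show "(1 + i) mod n = (1 + j) mod n" using that(4,5) by (simp only: add.commute)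
    qed (use that assms in auto)
    have via: "square_adj n i j" if "(i, w) \<in> parcs (cycle_graph n)" "(w, j) \<in> parcs (cycle_graph n)" for w
    proof -
      have w: "w < n" "w = (i + 1) mod n \<or> i = (w + 1) mod n" "j = (w + 1) mod n \<or> w = (j + 1) mod n"
        using that by (auto simp: C)
      then show ?thesis using same[of w] ij s unfolding square_adj_def by metis
    qed
    have fwd: "\<exists>w. (i, w) \<in> parcs (cycle_graph n) \<and> (w, j) \<in> parcs (cycle_graph n)" if "j = (i + 2) mod n"
      using that ij s[of i] by (intro exI[of _ "(i + 1) mod n"]) (simp add: C)
    have bwd: "\<exists>w. (i, w) \<in> parcs (cycle_graph n) \<and> (w, j) \<in> parcs (cycle_graph n)" if "i = (j + 2) mod n"
      using that ij s[of j] by (intro exI[of _ "(j + 1) mod n"]) (simp add: C)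
    have "square_adj n i j \<longleftrightarrow> (i, j) \<in> parcs (cycle_graph n) \<or> j = (i + 2) mod n \<or> i = (j + 2) mod n"
      using ij by (auto simp only: square_adj_def C)
    then show ?thesis using ij via fwd bwd by blast
  next
    case False
    then show ?thesis by (auto simp: square_adj_def)
  qed
  finally show "(i, j) \<in> parcs (graph_square (cycle_graph n)) \<longleftrightarrow> i < n \<and> j < n \<and> square_adj n i j" .
qed

section \<open>From graph hypotheses to the combinatorial setting\<close>

lemma k_connected_separator:
  assumes G: "pair_graph G" "k_connected k G"
    and A: "A \<subseteq> pverts G" "A \<noteq> {}" "A \<union> nbhd (parcs G) A \<noteq> pverts G"
  shows "k \<le> card (nbhd (parcs G) A)"
proof (rule ccontr)
  interpret pair_graph G by fact
  define X where "X = nbhd (parcs G) A"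
  assume "\<not> ?thesis"
  moreover have XV: "X \<subseteq> pverts G" by (auto simp: X_def nbhd_def dest: in_arcsD2)
  ultimately have "cut_connected (parcs G) (pverts G - X)"
    using G(2) unfolding k_connected_iff[OF G(1)] X_def by simp
  moreover have "A \<subset> pverts G - X" using A XV by (auto simp: X_def nbhd_def)
  ultimately obtain x y where "x \<in> A" "y \<in> pverts G - X - A" "(x, y) \<in> parcs G"
    using A(2) unfolding cut_connected_def by meson
  then show False by (auto simp: X_def nbhd_def)
qed

lemma planar_K33_K5_free:
  assumes G: "pair_graph G" "planar G"
  shows "\<not> has_K33 (parcs G)"
    and "distinct [a, b, c, d, e] \<Longrightarrow>
      (\<And>u v. u \<in> {a, b, c, d, e} \<Longrightarrow> v \<in> {a, b, c, d, e} \<Longrightarrow> u \<noteq> v \<Longrightarrow> (u, v) \<in> parcs G) \<Longrightarrow> False"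
proof -
  obtain p \<gamma> where d: "plane_drawing G p \<gamma>" using G(2) unfolding planar_def by blast
  interpret drawn_graph G p \<gamma> using G(1) d by (simp add: drawn_graph_def drawn_graph_axioms_def)
  show "distinct [a, b, c, d, e] \<Longrightarrow>
      (\<And>u v. u \<in> {a, b, c, d, e} \<Longrightarrow> v \<in> {a, b, c, d, e} \<Longrightarrow> u \<noteq> v \<Longrightarrow> (u, v) \<in> parcs G) \<Longrightarrow> False"
    by (rule no_K5)
  show "\<not> has_K33 (parcs G)"
  proof
    assume "has_K33 (parcs G)"
    then obtain A B C where ABC: "cut_connected (parcs G) A" "cut_connected (parcs G) B" "cut_connected (parcs G) C"
      "A \<inter> B = {}" "A \<inter> C = {}" "B \<inter> C = {}"
      "3 \<le> card (nbhd (parcs G) A \<inter> nbhd (parcs G) B \<inter> nbhd (parcs G) C)" unfolding has_K33_def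
        by blast
    obtain S where S: "S \<subseteq> nbhd (parcs G) A \<inter> nbhd (parcs G) B \<inter> nbhd (parcs G) C" "card S = 3"
      using obtain_subset_with_card_n[OF ABC(7)] by metis
    then obtain x y z where xyz: "S = {x, y, z}" "x \<noteq> y" "x \<noteq> z" "y \<noteq> z"
      by (auto simp: card_3_iff)
    have sub: "U \<subseteq> pverts G" if U: "cut_connected (parcs G) U" "x \<in> nbhd (parcs G) U" for U
    proof
      fix u assume u: "u \<in> U"
      show "u \<in> pverts G"
      proof (cases "U = {u}")
        case True
        then have "(u, x) \<in> parcs G" using U(2) by (auto simp: nbhd_def)
        then show ?thesis by (rule in_arcsD1)
      next
        case False
        then have "{u} \<subset> U" "{u} \<noteq> {}" using u by auto
        then obtain w w' where "w \<in> {u}" "(w, w') \<in> parcs G"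
          using U(1) unfolding cut_connected_def by meson
        then show ?thesis using in_arcsD1 by auto
      qed
    qed
    define H where "H i = (if i = 0 then A else if i = 1 then B else C)" for i :: nat
    show False
    proof (rule no_K33_minor[of H x y z])
      fix i :: nat assume "i < 3"
      show "cut_connected (parcs G) (H i) \<and> H i \<subseteq> pverts G"
        using ABC S xyz sub by (auto simp: H_def)
      show "{x, y, z} \<subseteq> nbhd (parcs G) (H i)" using S xyz by (auto simp: H_def)
    next
      fix i j :: nat assume "i < 3" "j < 3" "i \<noteq> j"
      then show "H i \<inter> H j = {}" using ABC by (auto simp: H_def)
    qed (use xyz in auto)
  qed
qed

lemma planar_4_connected_K25_minor_free_is_square:
  assumes G: "pair_graph G" "planar G" "k_connected 4 G" "minor_free (complete_bipartite_graph 2 5) G"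
  shows "\<exists>n. n \<ge> 6 \<and> even n \<and> digraph_iso (with_proj G) (with_proj (graph_square (cycle_graph n)))"
proof -
  interpret pair_graph G by fact
  let ?V = "pverts G" and ?E = "parcs G"
  have c5: "5 \<le> card ?V" using G(3) by (simp add: k_connected_def)
  have "card ?V \<noteq> 5"
  proof
    assume V5: "card ?V = 5"
    \<comment> \<open>Deleting the other three of five vertices leaves a connected pair, so the
      graph would be K5.\<close>
    have adj: "(u, v) \<in> ?E" if uv: "u \<in> ?V" "v \<in> ?V" "u \<noteq> v" for u v
    proof -
      have "card (?V - {u, v}) = 3" using uv V5 pair_finite_verts by (simp add: card_Diff_subset)
      then have "cut_connected ?E (?V - (?V - {u, v}))"
        using G(3) unfolding k_connected_iff[OF G(1)] by simp
      moreover have "?V - (?V - {u, v}) = {u, v}" using uv by blast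
      ultimately have "cut_connected ?E {u, v}" by simp
      moreover have "{u} \<subset> {u, v}" "{u} \<noteq> {}" using uv by auto
      ultimately obtain x y where "x \<in> {u}" "y \<in> {u, v} - {u}" "(x, y) \<in> ?E"
        unfolding cut_connected_def by meson
      then show ?thesis by auto
    qed
    obtain xs where xs: "set xs = ?V" "distinct xs" "length xs = 5"
      using finite_distinct_list[OF pair_finite_verts] distinct_card V5 by metis
    then obtain a b c d e where "xs = [a, b, c, d, e]"
      by (auto simp: numeral_eq_Suc length_Suc_conv)
    then show False using planar_K33_K5_free(2)[OF G(1,2), of a b c d e] xs adj by auto
  qed
  then have c6: "6 \<le> card ?V" using c5 by simp
  interpret F: K33_K25_free ?V ?E
  proof
    show "finite ?V" by (rule pair_finite_verts)
    show "?E \<subseteq> ?V \<times> ?V" by (auto dest: in_arcsD1 in_arcsD2)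
    show "sym ?E" using arcs_symmetric by (auto simp: sym_def)
    show "(x, x) \<notin> ?E" for x using no_loops' by blast
    show "4 \<le> card (nbhd ?E A)" if "A \<subseteq> ?V" "A \<noteq> {}" "A \<union> nbhd ?E A \<noteq> ?V" for A
      by (rule k_connected_separator[OF G(1,3) that])
    show "\<not> has_K33 ?E" by (rule planar_K33_K5_free(1)[OF G(1,2)])
    show "\<not> has_K25 ?E" using has_K25_minor[OF G(1)] G(4) unfolding minor_free_def by blast
  qed (rule c6)
  obtain n f where n: "6 \<le> n" "even n" and f: "bij_betw f {..<n} ?V"
    "\<And>i j. i < n \<Longrightarrow> j < n \<Longrightarrow> (f i, f j) \<in> ?E \<longleftrightarrow> square_adj n i j"
      using F.is_cycle_square by blast
  define g where "g = the_inv_into {..<n} f"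
  have g: "bij_betw g ?V {..<n}" unfolding g_def by (rule bij_betw_the_inv_into[OF f(1)])
  have fg: "f (g x) = x" "g x < n" if "x \<in> ?V" for x
    using that f(1) bij_betwE[OF g] by (auto simp: g_def bij_betw_def f_the_inv_into_f)
  have gf: "g (f i) = i" if "i < n" for i
    using that f(1) by (simp add: g_def bij_betw_def the_inv_into_f_f)
  have n5: "5 \<le> n" using n by simp
  have "digraph_iso (with_proj G) (with_proj (graph_square (cycle_graph n)))"
  proof (rule digraph_iso_pairI[OF G(1)])
    show "bij_betw g ?V (pverts (graph_square (cycle_graph n)))"
      using g by (simp add: graph_square_cycle_graph(1)[OF n5])
    show "(g x, g y) \<in> parcs (graph_square (cycle_graph n))" if "(x, y) \<in> ?E" for x y
    proof -
      have "x \<in> ?V" "y \<in> ?V" using that in_arcsD1 in_arcsD2 by blast+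
      then show ?thesis using fg f(2)[of "g x" "g y"] that by (simp add: graph_square_cycle_graph(2)[OF n5])
    qed
    show "\<exists>x y. (x, y) \<in> ?E \<and> g x = i \<and> g y = j" if "(i, j) \<in> parcs (graph_square (cycle_graph n))" for i j
      using that f(2)[of i j] gf by (auto simp: graph_square_cycle_graph(2)[OF n5])
  qed
  then show ?thesis using n by blast
qed

locale square_labelling = pair_graph G for G :: "'a pair_pre_digraph" +
  fixes n :: nat and \<phi> :: "'a \<Rightarrow> nat"
  assumes n: "6 \<le> n" "even n" and bij: "bij_betw \<phi> (pverts G) {..<n}"
    and adj: "\<And>x y. x \<in> pverts G \<Longrightarrow> y \<in> pverts G \<Longrightarrow> (x, y) \<in> parcs G \<longleftrightarrow> square_adj n (\<phi> x) (\<phi> y)"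
begin

text \<open>The vertex labelled by the residue of \<open>i\<close> sits at the integer position
  \<open>i\<close>. Equalities of residues become divisibilities, and the backward clauses of
  \<open>square_adj\<close> become the differences -1 and -2.\<close>

lemma cyclic: "cyclic_square (int n) (\<lambda>i. the_inv_into (pverts G) \<phi> (nat (i mod int n))) (pverts G) (parcs G)"
proof
  define vt where "vt i = the_inv_into (pverts G) \<phi> (nat (i mod int n))" for i
  have lt: "nat (i mod int n) < n" for i using n by (simp add: nat_less_iff)
  have vtV: "vt i \<in> pverts G" and \<phi>vt: "\<phi> (vt i) = nat (i mod int n)" for i
    using bij lt[of i] the_inv_into_into[of \<phi> "pverts G" "nat (i mod int n)" "pverts G"]
    by (auto simp: vt_def bij_betw_def f_the_inv_into_f)
  have inj: "x = y \<longleftrightarrow> \<phi> x = \<phi> y" if "x \<in> pverts G" "y \<in> pverts G" for x y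
    using bij that by (auto simp: bij_betw_def dest: inj_onD)
  have natmod: "nat (i mod int n) = nat (j mod int n) \<longleftrightarrow> int n dvd j - i" for i j
  proof -
    have "nat (i mod int n) = nat (j mod int n) \<longleftrightarrow> j mod int n = i mod int n"
      using n by (auto simp: nat_eq_iff)
    then show ?thesis by (simp add: mod_eq_dvd_iff)
  qed
  show "5 \<le> int n" using n by simp
  show eq: "the_inv_into (pverts G) \<phi> (nat (i mod int n)) = the_inv_into (pverts G) \<phi> (nat (j mod int n)) \<longleftrightarrow>
    int n dvd j - i" for i j
    using inj[OF vtV vtV, of i j] \<phi>vt natmod by (simp add: vt_def)
  show "pverts G = range (\<lambda>i. the_inv_into (pverts G) \<phi> (nat (i mod int n)))"
  proof -
    have "x = vt (int (\<phi> x))" if "x \<in> pverts G" for x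
    proof -
      have "\<phi> x < n" using bij that by (auto simp: bij_betw_def)
      then show ?thesis using inj[OF that vtV] \<phi>vt by (simp add: nat_mod_as_int)
    qed
    then show ?thesis using vtV unfolding vt_def by blast
  qed
  fix i j :: int
  have k: "nat (j mod int n) = (nat (i mod int n) + k) mod n \<longleftrightarrow> int n dvd j - i - int k" for i j and k
  proof -
    have "int ((nat (i mod int n) + k) mod n) = (i + int k) mod int n"
      using n by (simp add: zmod_int mod_add_left_eq)
    then have "(nat (i mod int n) + k) mod n = nat ((i + int k) mod int n)" by (metis nat_int)
    then show ?thesis using natmod[of "i + int k" j] by (metis diff_diff_eq)
  qed
  have "square_adj n (nat (i mod int n)) (nat (j mod int n)) \<longleftrightarrow>
    i mod int n \<noteq> j mod int n \<and> (int n dvd j - i - 1 \<or> int n dvd j - i - 2 \<or> int n dvd i - j - 1 \<or> int n dvd i - j - 2)"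
    unfolding square_adj_def using k[of j i 1] k[of j i 2] k[of i j 1] k[of i j 2] n by (auto simp: nat_eq_iff)
  also have "\<dots> \<longleftrightarrow> (\<exists>d\<in>{-2, -1, 1, 2}. int n dvd j - i - d)"
  proof -
    have s: "int n dvd i - j - d \<longleftrightarrow> int n dvd j - i - (- d)" for d
    proof -
      have "i - j - d = - (j - i - (- d))" by simp
      then show ?thesis by (simp only: dvd_minus_iff)
    qed
    \<comment> \<open>Equal residues would make \<open>n\<close> divide some \<open>d\<close> with
      \<open>0 < \<bar>d\<bar> \<le> 2\<close>.\<close>
    have "i mod int n \<noteq> j mod int n" if "d \<in> {-2, -1, 1, 2}" "int n dvd j - i - d" for d
    proof
      assume "i mod int n = j mod int n"
      then have "int n dvd j - i" by (metis mod_eq_dvd_iff)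
      then have "int n dvd (j - i) - (j - i - d)" using that(2) by (rule dvd_diff)
      then have "int n \<le> \<bar>d\<bar>" using that(1) dvd_imp_le_int[of d "int n"] by auto
      then show False using that(1) n by auto
    qed
    from this[of "-2"] this[of "-1"] this[of 1] this[of 2] show ?thesis unfolding s by auto
  qed
  finally show "(the_inv_into (pverts G) \<phi> (nat (i mod int n)), the_inv_into (pverts G) \<phi> (nat (j mod int n))) \<in> parcs G \<longleftrightarrow>
    (\<exists>d\<in>{-2, -1, 1, 2}. int n dvd j - i - d)"
    using adj[OF vtV vtV, of i j] \<phi>vt by (simp add: vt_def)
qed

lemma card_V: "card (pverts G) = n"
  using bij_betw_same_card[OF bij] by simp

lemma four_connected: "k_connected 4 G"
  unfolding k_connected_iff[OF pair_graph]
proof (intro conjI allI impI)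
  show "4 < card (pverts G)" using n card_V by simp
  interpret cyclic_square "int n" "\<lambda>i. the_inv_into (pverts G) \<phi> (nat (i mod int n))" "pverts G" "parcs G"
    by (rule cyclic)
  fix X assume X: "X \<subseteq> pverts G" "card X < 4"
  have "pverts G - X \<noteq> {}"
  proof
    assume "pverts G - X = {}"
    then have "X = pverts G" using X by blast
    then show False using X card_V n by simp
  qed
  then show "cut_connected (parcs G) (pverts G - X)"
    using square_4_connected[OF X(1) _ X(2)] X(1) pair_finite_verts finite_subset by blast
qed

lemma K25_minor_free: "minor_free (complete_bipartite_graph 2 5) G"
  unfolding minor_free_def
proof
  let ?H = "complete_bipartite_graph 2 5"
  assume m: "minor_of ?H G"
  have "pair_graph ?H"
    by unfold_locales (auto simp: complete_bipartite_graph_def symmetric_def sym_def)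
  from minor_of_bags[OF pair_graph m this] obtain B where
    B: "\<And>i. i \<in> pverts ?H \<Longrightarrow> cut_connected (parcs G) (B i) \<and> B i \<subseteq> pverts G"
      "\<And>i j. i \<in> pverts ?H \<Longrightarrow> j \<in> pverts ?H \<Longrightarrow> i \<noteq> j \<Longrightarrow> B i \<inter> B j = {}"
      "\<And>i j. (i, j) \<in> parcs ?H \<Longrightarrow> \<exists>x\<in>B i. \<exists>y\<in>B j. (x, y) \<in> parcs G"
        by blast
  have VH: "i \<in> pverts ?H \<longleftrightarrow> i < 7" for i by (simp add: complete_bipartite_graph_def)
  have A: "(k + 2, h) \<in> parcs ?H" if "k < 5" "h < 2" for k h
    using that by (auto simp: complete_bipartite_graph_def)
  interpret cyclic_square "int n" "\<lambda>i. the_inv_into (pverts G) \<phi> (nat (i mod int n))" "pverts G" "parcs G"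
    by (rule cyclic)
  \<comment> \<open>The hubs of K25 are the vertices 0 and 1, the leaves 2, ..., 6, whence the
    offset by two.\<close>
  interpret cyclic_K25 "int n" "\<lambda>i. the_inv_into (pverts G) \<phi> (nat (i mod int n))" "pverts G" "parcs G"
    "B 0" "B 1" "\<lambda>k. B (k + 2)"
  proof
    show "cut_connected (parcs G) (B 0)" "B 0 \<subseteq> pverts G" "cut_connected (parcs G) (B 1)" "B 1 \<subseteq> pverts G"
      using B(1) VH by simp_all
    show "B 0 \<inter> B 1 = {}" using B(2)[of 0 1] VH by simp
    show "cut_connected (parcs G) (B (k + 2)) \<and> B (k + 2) \<subseteq> pverts G \<and> B (k + 2) \<inter> B 0 = {} \<and> B (k + 2) \<inter> B 1 = {}"
      if "k < 5" for k
      using that B(1)[of "k + 2"] B(2)[of "k + 2" 0] B(2)[of "k + 2" 1] VH by simp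
    show "B (k + 2) \<inter> B (l + 2) = {}" if "k < 5" "l < 5" "k \<noteq> l" for k l
      using that B(2)[of "k + 2" "l + 2"] VH by simp
    show "(\<exists>x\<in>B (k + 2). \<exists>y\<in>B 0. (x, y) \<in> parcs G) \<and> (\<exists>x\<in>B (k + 2). \<exists>y\<in>B 1. (x, y) \<in> parcs G)"
      if "k < 5" for k using B(3) A that by simp
  qed
  show False by (rule no_K25_bags)
qed

text \<open>A code for an edge: the kind of its curve and the index where the curve starts. The end
  is reduced modulo \<open>n\<close>, since a curve may run past the last index.\<close>

definition is_curve :: "'a set \<Rightarrow> bool \<times> nat \<Rightarrow> bool" where
  "is_curve e q \<longleftrightarrow> snd q < n \<and> \<phi> ` e = {snd q, curve_end (fst q) (snd q) mod n}"

lemma planar_drawing: "planar G"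
proof -
  have n0: "0 < n" "5 \<le> n" using n by auto
  have lt: "\<phi> x < n" if "x \<in> pverts G" for x using bij that by (auto simp: bij_betw_def)
  have inj: "inj_on \<phi> (pverts G)" using bij by (simp add: bij_betw_def)
  have eV: "e \<subseteq> pverts G" if "e \<in> edges G" for e
    using that by (auto simp: edges_def dest: in_arcsD1 in_arcsD2)
  have ex: "\<exists>q. is_curve e q" if e: "e \<in> edges G" for e
  proof -
    obtain u v where uv: "e = {u, v}" "(u, v) \<in> parcs G" using e by (auto simp: edges_def)
    have V: "u \<in> pverts G" "v \<in> pverts G" using uv(2) in_arcsD1 in_arcsD2 by blast+
    then consider "\<phi> v = (\<phi> u + 1) mod n" | "\<phi> v = (\<phi> u + 2) mod n" | "\<phi> u = (\<phi> v + 1) mod n" | "\<phi> u = (\<phi> v + 2) mod n"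
      using adj uv(2) by (auto simp: square_adj_def)
    then show ?thesis
    proof cases
      case 1 then show ?thesis
        using lt V uv by (intro exI[of _ "(False, \<phi> u)"]) (simp add: is_curve_def curve_end_def)
    next
      case 2 then show ?thesis
        using lt V uv by (intro exI[of _ "(True, \<phi> u)"]) (simp add: is_curve_def curve_end_def)
    next
      case 3 then show ?thesis
        using lt V uv by (intro exI[of _ "(False, \<phi> v)"]) (simp add: is_curve_def curve_end_def insert_commute)
    next
      case 4 then show ?thesis
        using lt V uv by (intro exI[of _ "(True, \<phi> v)"]) (simp add: is_curve_def curve_end_def insert_commute)
    qed
  qed
  \<comment> \<open>Any code will do: it determines the labels of both ends, so distinct edges never
    share one.\<close>
  define q where "q e = (SOME q. is_curve e q)" for e
  have q: "is_curve e (q e)" if "e \<in> edges G" for e unfolding q_def using ex[OF that] by (rule someI_ex)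
  define r where "r e = fst (q e)" for e
  define s where "s e = snd (q e)" for e
  have s: "s e < n" "\<phi> ` e = {s e, curve_end (r e) (s e) mod n}" if "e \<in> edges G" for e
    using q[OF that] by (simp_all add: is_curve_def r_def s_def)
  have qinj: "(r e, s e) \<noteq> (r f, s f)" if ef: "e \<in> edges G" "f \<in> edges G" "e \<noteq> f" for e f
  proof
    assume "(r e, s e) = (r f, s f)"
    then have "\<phi> ` e = \<phi> ` f" using s(2)[OF ef(1)] s(2)[OF ef(2)] by simp
    then show False using inj_on_image_eq_iff[OF inj eV[OF ef(1)] eV[OF ef(2)]] ef(3) by blast
  qed
  define p where "p x = position n (\<phi> x)" for x
  define \<gamma> where "\<gamma> e = edge_curve n (r e) (s e)" for e
  have pe: "p ` e = {position n (s e), position n (curve_end (r e) (s e))}" if "e \<in> edges G" for e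
  proof -
    have "p ` e = position n ` (\<phi> ` e)" by (simp add: p_def image_image)
    then show ?thesis unfolding s(2)[OF that] using position_mod[OF n(2) n0(1)] by simp
  qed
  have on_end: "z \<in> p ` e" if e: "e \<in> edges G" and z: "z = wrap n x y" "strip (r e) (s e) x y"
    "x = real (s e) \<or> x = real (curve_end (r e) (s e))" for e z x y
    using strip_end_height[OF z(2)] z(1,3) unfolding pe[OF e] position_def by auto
  have "plane_drawing G p \<gamma>" unfolding plane_drawing_def
  proof (intro conjI ballI impI)
    show "inj_on p (pverts G)"
      using inj lt position_inj[OF n0(1)] by (intro inj_onI) (metis inj_onD p_def)
  next
    fix e assume e: "e \<in> edges G"
    show "Path_Connected.arc (\<gamma> e)" "{pathstart (\<gamma> e), pathfinish (\<gamma> e)} = p ` e"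
      using arc_edge_curve[OF n0(2)] by (simp_all add: \<gamma>_def pe[OF e])
    show "(path_image (\<gamma> e) - p ` e) \<inter> p ` pverts G = {}"
    proof (rule ccontr)
      assume "\<not> ?thesis"
      then obtain z v where z: "z \<in> path_image (\<gamma> e)" "z \<notin> p ` e" "v \<in> pverts G" "z = p v"
        by blast
      then obtain x y where xy: "z = wrap n x y" "strip (r e) (s e) x y"
        unfolding \<gamma>_def edge_curve_image by blast
      have "wrap n x y = wrap n (real (\<phi> v)) (height (\<phi> v))"
        using xy(1) z(4) by (simp add: p_def position_def)
      then obtain k where k: "y = height (\<phi> v)" "x = real (\<phi> v) + of_int k * real n"
        using wrap_eq[OF n0(1)] by blast
      have "x = real (s e) \<or> x = real (curve_end (r e) (s e))"
        by (rule strip_vertex[OF _ k(2) n(2)]) (use xy(2) k(1) in simp)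
      then show False using on_end[OF e xy] z(2) by blast
    qed
    fix f assume f: "f \<in> edges G" "e \<noteq> f"
    show "(path_image (\<gamma> e) - p ` e) \<inter> path_image (\<gamma> f) = {}"
    proof (rule ccontr)
      assume "\<not> ?thesis"
      then obtain z where z: "z \<in> path_image (\<gamma> e)" "z \<notin> p ` e" "z \<in> path_image (\<gamma> f)"
        by blast
      obtain x y where xy: "z = wrap n x y" "strip (r e) (s e) x y"
        using z(1) unfolding \<gamma>_def edge_curve_image by blast
      obtain x' y' where xy': "z = wrap n x' y'" "strip (r f) (s f) x' y'"
        using z(3) unfolding \<gamma>_def edge_curve_image by blast
      obtain k where k: "y = y'" "x = x' + of_int k * real n" using wrap_eq[OF n0(1)] xy(1) xy'(1) by metis
      have "x = real (s e) \<or> x = real (curve_end (r e) (s e))"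
        by (rule strips_meet[OF xy(2) _ k(2) n(2) s(1)[OF e] s(1)[OF f(1)] qinj[OF e f]])
          (use xy'(2) k(1) in simp)
      then show False using on_end[OF e xy] z(2) by blast
    qed
  qed
  then show ?thesis unfolding planar_def by blast
qed

end

theorem theorem1:
  fixes G :: "'a pair_pre_digraph"
  assumes "pair_graph G"
  shows "planar G \<and> k_connected 4 G \<and> minor_free (complete_bipartite_graph 2 5) G \<longleftrightarrow>
    (\<exists>n. n \<ge> 6 \<and> even n \<and> digraph_iso (with_proj G) (with_proj (graph_square (cycle_graph n))))"
proof
  assume "planar G \<and> k_connected 4 G \<and> minor_free (complete_bipartite_graph 2 5) G"
  then show "\<exists>n. n \<ge> 6 \<and> even n \<and> digraph_iso (with_proj G) (with_proj (graph_square (cycle_graph n)))"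
    using planar_4_connected_K25_minor_free_is_square[OF assms] by blast
next
  assume "\<exists>n. n \<ge> 6 \<and> even n \<and> digraph_iso (with_proj G) (with_proj (graph_square (cycle_graph n)))"
  then obtain n where n: "6 \<le> n" "even n"
    and iso: "digraph_iso (with_proj G) (with_proj (graph_square (cycle_graph n)))" by blast
  have n5: "5 \<le> n" using n by simp
  obtain \<phi> where \<phi>: "bij_betw \<phi> (pverts G) (pverts (graph_square (cycle_graph n)))"
    "\<And>x y. x \<in> pverts G \<Longrightarrow> y \<in> pverts G \<Longrightarrow>
      (x, y) \<in> parcs G \<longleftrightarrow> (\<phi> x, \<phi> y) \<in> parcs (graph_square (cycle_graph n))"
    using digraph_iso_pairE[OF assms iso] by blast
  have lt: "\<phi> x < n" if "x \<in> pverts G" for x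
    using \<phi>(1) that by (auto simp: graph_square_cycle_graph(1)[OF n5] bij_betw_def)
  interpret square_labelling G n \<phi>
    using assms n \<phi> lt
    by (simp add: square_labelling_def square_labelling_axioms_def graph_square_cycle_graph[OF n5])
  show "planar G \<and> k_connected 4 G \<and> minor_free (complete_bipartite_graph 2 5) G"
    using planar_drawing four_connected K25_minor_free by blast
qed

end
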